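(* For every constant $c>0$, unless the Exponential Time Hypothesis fails, there is no function $f$ such that Dominating Set can be solved in time $f(k)\,n^{o(k/\log k)}$ on $n$-vertex graphs of degeneracy at most $c\log n$, where $k$ is the solution size.
   Context: Dominating Set: given an undirected graph $G=(V,E)$ and an integer $k$, decide whether there is $S\subseteq V$ with $|S|\le k$ such that every vertex of $G$ is in $S$ or adjacent to a vertex of $S$. The degeneracy of $G$ is the least $d$ such that every subgraph of $G$ has a vertex of degree at most $d$. ETH: 3-SAT on $n$ variables cannot be solved in time $2^{o(n)}$. *)

theory Defs
  imports Complex_Main "HOL-Library.Landau_Symbols"
begin

section \<open>Random access machines\<close>

text \<open>
  Deterministic random access machines with registers indexed by the natural numbers, a read-only
  input array, and uniform cost. The only arithmetic is addition and truncated subtraction (no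
  multiplication and no bit operations), so that running times agree with those of multitape Turing
  machines up to a polynomial. Both time classes considered below are closed under polynomial
  overhead, hence do not depend on this choice of model.

  In the comments, \<open>R\<close> denotes the register contents and \<open>x\<close> the input, with \<open>x\<^sub>i = 0\<close> beyond
  its length.
\<close>

datatype instr =
    Const nat nat       \<comment> \<open>\<open>Const i a\<close>: \<open>R\<^sub>i := a\<close>\<close>
  | Add nat nat nat     \<comment> \<open>\<open>Add i j l\<close>: \<open>R\<^sub>i := R\<^sub>j + R\<^sub>l\<close>\<close>
  | Sub nat nat nat     \<comment> \<open>\<open>Sub i j l\<close>: \<open>R\<^sub>i := max 0 (R\<^sub>j - R\<^sub>l)\<close>\<close>
  | Load nat nat        \<comment> \<open>\<open>Load i j\<close>: \<open>R\<^sub>i := R\<^bsub>R j\<^esub>\<close>\<close>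
  | Store nat nat       \<comment> \<open>\<open>Store i j\<close>: \<open>R\<^bsub>R i\<^esub> := R\<^sub>j\<close>\<close>
  | Input nat nat       \<comment> \<open>\<open>Input i j\<close>: \<open>R\<^sub>i := x\<^bsub>R j\<^esub>\<close>\<close>
  | JumpZero nat nat    \<comment> \<open>\<open>JumpZero i p\<close>: if \<open>R\<^sub>i = 0\<close> continue at instruction \<open>p\<close>\<close>

type_synonym config = "nat \<times> (nat \<Rightarrow> nat)"

fun exec :: "nat list \<Rightarrow> instr \<Rightarrow> config \<Rightarrow> config" where
  "exec x (Const i a) (pc, R) = (pc + 1, R(i := a))"
| "exec x (Add i j l) (pc, R) = (pc + 1, R(i := R j + R l))"
| "exec x (Sub i j l) (pc, R) = (pc + 1, R(i := R j - R l))"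
| "exec x (Load i j) (pc, R) = (pc + 1, R(i := R (R j)))"
| "exec x (Store i j) (pc, R) = (pc + 1, R(R i := R j))"
| "exec x (Input i j) (pc, R) = (pc + 1, R(i := (if R j < length x then x ! R j else 0)))"
| "exec x (JumpZero i p) (pc, R) = ((if R i = 0 then p else pc + 1), R)"

definition halted :: "instr list \<Rightarrow> config \<Rightarrow> bool" where
  "halted P s \<longleftrightarrow> length P \<le> fst s"

definition step :: "instr list \<Rightarrow> nat list \<Rightarrow> config \<Rightarrow> config" where
  "step P x s = (if halted P s then s else exec x (P ! fst s) s)"

text \<open>Initially register 0 holds the length of the input and all other registers hold 0.\<close>

definition init_config :: "nat list \<Rightarrow> config" where
  "init_config x = (0, (\<lambda>_. 0)(0 := length x))"

definition config_after :: "instr list \<Rightarrow> nat list \<Rightarrow> nat \<Rightarrow> config" where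
  "config_after P x t = (step P x ^^ t) (init_config x)"

text \<open>The answer of a halted machine is read off register 0.\<close>

definition answers_within :: "instr list \<Rightarrow> nat list \<Rightarrow> bool \<Rightarrow> real \<Rightarrow> bool" where
  "answers_within P x b T \<longleftrightarrow>
     (\<exists>t. real t \<le> T \<and> halted P (config_after P x t) \<and>
          snd (config_after P x t) 0 = (if b then 1 else 0))"

text \<open>
  A (promise) problem is given by its set \<open>I\<close> of instances, their encoding, and the set of
  yes-instances; \<open>T\<close> bounds the running time on each individual instance.
\<close>

definition solvable_in_time ::
  "'i set \<Rightarrow> ('i \<Rightarrow> nat list) \<Rightarrow> ('i \<Rightarrow> bool) \<Rightarrow> ('i \<Rightarrow> real) \<Rightarrow> bool" where
  "solvable_in_time I enc yes T \<longleftrightarrow>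
     (\<exists>P. \<forall>x\<in>I. answers_within P (enc x) (yes x) (T x))"


section \<open>3-SAT and the Exponential Time Hypothesis\<close>

type_synonym literal = "nat \<times> bool"
type_synonym clause3 = "literal \<times> literal \<times> literal"

text \<open>
  An instance consists of the number \<open>n\<close> of variables and a list of pairwise distinct clauses over
  the variables \<open>0, \<dots>, n - 1\<close>. Literals may be repeated within a clause, so clauses with fewer
  than three different literals are covered. Distinctness makes the input length polynomial in \<open>n\<close>,
  so that it makes sense to bound the running time in terms of \<open>n\<close> alone.
\<close>

definition sat3_instances :: "(nat \<times> clause3 list) set" where
  "sat3_instances =
     {(n, \<phi>). distinct \<phi> \<and> (\<forall>(a, b, c) \<in> set \<phi>. fst a < n \<and> fst b < n \<and> fst c < n)}"

definition lit_true :: "(nat \<Rightarrow> bool) \<Rightarrow> literal \<Rightarrow> bool" where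
  "lit_true \<alpha> l \<longleftrightarrow> \<alpha> (fst l) = snd l"

definition satisfiable3 :: "clause3 list \<Rightarrow> bool" where
  "satisfiable3 \<phi> \<longleftrightarrow>
     (\<exists>\<alpha>. \<forall>(a, b, c) \<in> set \<phi>. lit_true \<alpha> a \<or> lit_true \<alpha> b \<or> lit_true \<alpha> c)"

definition enc_literal :: "literal \<Rightarrow> nat" where
  "enc_literal l = 2 * fst l + (if snd l then 1 else 0)"

definition enc_sat3 :: "nat \<times> clause3 list \<Rightarrow> nat list" where
  "enc_sat3 = (\<lambda>(n, \<phi>).
     n # concat (map (\<lambda>(a, b, c). [enc_literal a, enc_literal b, enc_literal c]) \<phi>))"

definition ETH :: bool where
  "ETH \<longleftrightarrow> \<not> (\<exists>h :: nat \<Rightarrow> real. h \<in> o(\<lambda>n. real n) \<and>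
     solvable_in_time sat3_instances enc_sat3 (\<lambda>(n, \<phi>). satisfiable3 \<phi>) (\<lambda>(n, \<phi>). 2 powr h n))"


section \<open>Graphs, degeneracy, and Dominating Set\<close>

definition simple_graph :: "'a set \<Rightarrow> 'a set set \<Rightarrow> bool" where
  "simple_graph V E \<longleftrightarrow> finite V \<and> (\<forall>e\<in>E. e \<subseteq> V \<and> card e = 2)"

definition subgraph :: "'a set \<Rightarrow> 'a set set \<Rightarrow> 'a set \<Rightarrow> 'a set set \<Rightarrow> bool" where
  "subgraph V' E' V E \<longleftrightarrow> V' \<subseteq> V \<and> E' \<subseteq> E \<and> simple_graph V' E'"

definition degree :: "'a set set \<Rightarrow> 'a \<Rightarrow> nat" where
  "degree E v = card {e \<in> E. v \<in> e}"

definition degeneracy :: "'a set \<Rightarrow> 'a set set \<Rightarrow> nat" where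
  "degeneracy V E =
     (LEAST d. \<forall>V' E'. subgraph V' E' V E \<and> V' \<noteq> {} \<longrightarrow> (\<exists>v\<in>V'. degree E' v \<le> d))"

definition dominating_set :: "'a set \<Rightarrow> 'a set set \<Rightarrow> 'a set \<Rightarrow> bool" where
  "dominating_set V E S \<longleftrightarrow> S \<subseteq> V \<and> (\<forall>v\<in>V. v \<in> S \<or> (\<exists>u\<in>S. {u, v} \<in> E))"

text \<open>
  An instance \<open>(n, E, k)\<close> consists of the graph with vertex set \<open>{0, \<dots>, n - 1}\<close> and edge set
  \<open>E\<close>, and the solution size \<open>k\<close>. The empty graph is excluded, since for \<open>n = 0\<close> neither
  \<open>log n\<close> nor the time bound is meaningful.
\<close>

definition ds_instances :: "real \<Rightarrow> (nat \<times> nat set set \<times> nat) set" where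
  "ds_instances c =
     {(n, E, k). 1 \<le> n \<and> simple_graph {..<n} E \<and>
        real (degeneracy {..<n} E) \<le> c * log 2 (real n)}"

definition has_dominating_set :: "nat \<times> nat set set \<times> nat \<Rightarrow> bool" where
  "has_dominating_set = (\<lambda>(n, E, k). \<exists>S. card S \<le> k \<and> dominating_set {..<n} E S)"

text \<open>The graph is encoded by its adjacency matrix, row by row.\<close>

definition enc_ds :: "nat \<times> nat set set \<times> nat \<Rightarrow> nat list" where
  "enc_ds = (\<lambda>(n, E, k).
     n # k # concat (map (\<lambda>i. map (\<lambda>j. if {i, j} \<in> E then 1 else 0) [0..<n]) [0..<n]))"

end

theory Submission
  imports Defs "HOL-Real_Asymp.Real_Asymp"
begin

text \<open>
  Suppose that Dominating Set on graphs of degeneracy at most \<open>c log n\<close> can be solved in time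
  \<open>f(k) n\<^bsup>g(k)\<^esup>\<close> with \<open>g(k) = o(k / log k)\<close>. By the Sparsification Lemma of Impagliazzo, Paturi and
  Zane, a 3-CNF formula with \<open>N\<close> variables is equivalent to the disjunction of \<open>2\<^bsup>\<epsilon>N\<^esup>\<close> formulas in
  which every literal occurs at most \<open>\<Delta> = \<Delta>(\<epsilon>)\<close> times. Split the variables of such a formula into \<open>k\<close>
  blocks of length \<open>s \<approx> N / k\<close>, and take a vertex for each of the \<open>2\<^sup>s\<close> assignments of each block and a
  vertex for each clause, adjacent if the assignment satisfies the clause. With gadgets forcing the
  choice of one assignment per block, and with enough pendant vertices to make \<open>n\<close> of size
  \<open>2\<^bsup>\<Theta>(s\<Delta>/c)\<^esup>\<close>, this is a graph of degeneracy at most \<open>s\<Delta> + 2 \<le> c log n\<close> that has a dominating set of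
  size \<open>k + 1\<close> iff the formula is satisfiable. For large \<open>k\<close> the time \<open>f(k + 1) n\<^bsup>g(k + 1)\<^esup>\<close> is at most
  \<open>2\<^bsup>\<epsilon>N\<^esup>\<close> up to a constant factor.

  Since \<open>f\<close> need not be computable, no machine can pick \<open>k\<close> and \<open>\<epsilon>\<close>. The algorithm for 3-SAT therefore
  tries all parameters below a bound \<open>B\<close>, spending time polynomial in \<open>B\<close>, and increases \<open>B\<close> until
  some choice of parameters completes the computation.
\<close>

section \<open>A loop language with built-in polynomial running time\<close>

text \<open>The exponents fit because \<open>n\<close> is about 2 to the power C \<Delta> N / k with
  C about 1 / c, so that \<open>n powr g k\<close> has the exponent C \<Delta> N (g k) / k. The
  order of choice is therefore \<epsilon>, then the sparsification thresholds and with them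
  \<Delta>, then a constant \<open>k\<close>, then large \<open>N\<close>: with \<Delta> fixed, both
  1 / k and g k / k can be made small against it. The Exponential Time Hypothesis speaks of one
  function in o(n), while a choice of parameters serves a single \<epsilon>. The exponent is
  therefore taken to be the logarithm of a fixed polynomial in the least sufficient
  \<open>B\<close>; every choice of parameters bounds it from above, so one machine serves all
  \<epsilon>. This is possible because wrong parameters never cause a wrong answer. All loops and
  quantifiers of the program range below \<open>B\<close>: its time is polynomial in
  \<open>B\<close> by its shape, and adjacency in the graph is transcribed as a bounded formula.
  Sparsification is analysed by a potential, which turns the size of the branching tree into a bound
  on the iterations of one stack loop.\<close>

datatype arr = StackU | StackD | CurU | CurD | Powers | Graph | Mem | Slot | Log

text \<open>\<open>BSum\<close> is the only iteration inside expressions: bounded quantifiers,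
  counting, products and minimization are all expressed by it.\<close>

datatype expr =
    Num nat
  | Var nat
  | Bound
  | Cell arr expr
  | Inp expr
  | Plus expr expr
  | Minus expr expr
  | Ite expr expr expr
  | BSum nat expr

datatype cmd =
    Skip
  | Assign nat expr
  | Write arr expr expr
  | Seq cmd cmd  (infixr \<open>;;\<close> 60)
  | Cond expr cmd cmd
  | For nat cmd

type_synonym store = "nat \<Rightarrow> nat"
type_synonym heap = "arr \<Rightarrow> nat \<Rightarrow> nat"

fun ev :: "nat list \<Rightarrow> nat \<Rightarrow> heap \<Rightarrow> store \<Rightarrow> expr \<Rightarrow> nat" where
  "ev x B \<mu> \<rho> (Num n) = n"
| "ev x B \<mu> \<rho> (Var v) = \<rho> v"
| "ev x B \<mu> \<rho> Bound = B"
| "ev x B \<mu> \<rho> (Cell a e) = \<mu> a (ev x B \<mu> \<rho> e)"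
| "ev x B \<mu> \<rho> (Inp e) = (if ev x B \<mu> \<rho> e < length x then x ! ev x B \<mu> \<rho> e else 0)"
| "ev x B \<mu> \<rho> (Plus e1 e2) = ev x B \<mu> \<rho> e1 + ev x B \<mu> \<rho> e2"
| "ev x B \<mu> \<rho> (Minus e1 e2) = ev x B \<mu> \<rho> e1 - ev x B \<mu> \<rho> e2"
| "ev x B \<mu> \<rho> (Ite e e1 e2) = (if ev x B \<mu> \<rho> e \<noteq> 0 then ev x B \<mu> \<rho> e1 else ev x B \<mu> \<rho> e2)"
| "ev x B \<mu> \<rho> (BSum v e) = (\<Sum>i<B. ev x B \<mu> (\<rho>(v := i)) e)"

fun sem :: "nat list \<Rightarrow> nat \<Rightarrow> cmd \<Rightarrow> store \<times> heap \<Rightarrow> store \<times> heap" where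
  "sem x B Skip s = s"
| "sem x B (Assign v e) (\<rho>, \<mu>) = (\<rho>(v := ev x B \<mu> \<rho> e), \<mu>)"
| "sem x B (Write a e1 e2) (\<rho>, \<mu>) =
     (\<rho>, \<mu>(a := (\<mu> a)(ev x B \<mu> \<rho> e1 := ev x B \<mu> \<rho> e2)))"
| "sem x B (Seq c1 c2) s = sem x B c2 (sem x B c1 s)"
| "sem x B (Cond e c1 c2) (\<rho>, \<mu>) =
     (if ev x B \<mu> \<rho> e \<noteq> 0 then sem x B c1 (\<rho>, \<mu>) else sem x B c2 (\<rho>, \<mu>))"
| "sem x B (For v c) s = fold (\<lambda>i (\<rho>, \<mu>). sem x B c (\<rho>(v := i), \<mu>)) [0..<B] s"

subsection \<open>Compilation\<close>

text \<open>
  Register \<open>16 i\<close> holds the scalar \<open>i\<close>, register \<open>16 i + 1\<close> the \<open>i\<close>-th temporary, and the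
  remaining residues modulo 16 hold the arrays. Temporary 0 is always 0 and temporary 1 holds the
  bound on the loops.
\<close>

fun code :: "arr \<Rightarrow> nat" where
  "code StackU = 2" | "code StackD = 3" | "code CurU = 4" | "code CurD = 5" | "code Powers = 6"
| "code Graph = 7" | "code Mem = 8" | "code Slot = 9" | "code Log = 10"

definition sc :: "nat \<Rightarrow> nat" where "sc v = 16 * v"
definition tmp :: "nat \<Rightarrow> nat" where "tmp t = 16 * t + 1"
definition cel :: "arr \<Rightarrow> nat \<Rightarrow> nat" where "cel a i = 16 * i + code a"

lemma code_bounds: "2 \<le> code a" "code a < 16"
  by (cases a; simp)+

lemma code_inject: "code a = code b \<longleftrightarrow> a = b"
  by (cases a; cases b; simp)

lemma address_inject [simp]:
  "sc v = sc w \<longleftrightarrow> v = w" "tmp t = tmp u \<longleftrightarrow> t = u"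
  "cel a i = cel b j \<longleftrightarrow> a = b \<and> i = j"
proof -
  show "cel a i = cel b j \<longleftrightarrow> a = b \<and> i = j"
  proof
    assume h: "cel a i = cel b j"
    have "cel a i mod 16 = code a" "cel b j mod 16 = code b"
      using code_bounds[of a] code_bounds[of b] by (simp_all add: cel_def)
    with h have "a = b" by (simp add: code_inject)
    with h show "a = b \<and> i = j" by (simp add: cel_def)
  qed auto
qed (simp_all add: sc_def tmp_def)

lemma address_distinct [simp]:
  "sc v \<noteq> tmp t" "tmp t \<noteq> sc v" "sc v \<noteq> cel a i" "cel a i \<noteq> sc v" "tmp t \<noteq> cel a i" "cel a i \<noteq> tmp t"
proof -
  have "sc v mod 16 = 0" "tmp t mod 16 = 1" "cel a i mod 16 = code a"
    using code_bounds[of a] by (simp_all add: sc_def tmp_def cel_def)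
  then show "sc v \<noteq> tmp t" "tmp t \<noteq> sc v" "sc v \<noteq> cel a i" "cel a i \<noteq> sc v" "tmp t \<noteq> cel a i" "cel a i \<noteq> tmp t"
    using code_bounds[of a] by fastforce+
qed

text \<open>The position \<open>p\<close> is needed because jump targets are absolute. The value
  ends up in temporary \<open>t\<close>, and only temporaries from \<open>t\<close> on are
  overwritten. As there is no multiplication, the factor 16 of an address is made by four doublings;
  \<open>JumpZero (tmp 0)\<close> serves as unconditional jump. \<open>BSum\<close> saves its
  variable and restores it, so that evaluation leaves all scalars as they were.\<close>

fun ce :: "nat \<Rightarrow> nat \<Rightarrow> expr \<Rightarrow> instr list" where
  "ce p t (Num n) = [Const (tmp t) n]"
| "ce p t (Var v) = [Add (tmp t) (sc v) (tmp 0)]"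
| "ce p t Bound = [Add (tmp t) (tmp 1) (tmp 0)]"
| "ce p t (Cell a e) = ce p t e @
     [Add (tmp t) (tmp t) (tmp t), Add (tmp t) (tmp t) (tmp t),
      Add (tmp t) (tmp t) (tmp t), Add (tmp t) (tmp t) (tmp t),
      Const (tmp (t + 1)) (code a), Add (tmp t) (tmp t) (tmp (t + 1)), Load (tmp t) (tmp t)]"
| "ce p t (Inp e) = ce p t e @ [Input (tmp t) (tmp t)]"
| "ce p t (Plus e1 e2) =
     (let c1 = ce p t e1 in c1 @ ce (p + length c1) (t + 1) e2 @ [Add (tmp t) (tmp t) (tmp (t + 1))])"
| "ce p t (Minus e1 e2) =
     (let c1 = ce p t e1 in c1 @ ce (p + length c1) (t + 1) e2 @ [Sub (tmp t) (tmp t) (tmp (t + 1))])"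
| "ce p t (Ite e e1 e2) =
     (let c = ce p t e; q = p + length c; c1 = ce (q + 1) t e1; q' = q + length c1 + 2;
          c2 = ce q' t e2
      in c @ [JumpZero (tmp t) q'] @ c1 @ [JumpZero (tmp 0) (q' + length c2)] @ c2)"
| "ce p t (BSum v e) =
     (let c = ce (p + 5) (t + 3) e
      in [Const (tmp t) 0, Add (tmp (t + 1)) (tmp 1) (tmp 0), Add (tmp (t + 2)) (sc v) (tmp 0),
          Const (sc v) 0] @ [JumpZero (tmp (t + 1)) (p + length c + 10)] @ c @
         [Add (tmp t) (tmp t) (tmp (t + 3)), Const (tmp (t + 3)) 1,
          Add (sc v) (sc v) (tmp (t + 3)), Sub (tmp (t + 1)) (tmp (t + 1)) (tmp (t + 3))] @
         [JumpZero (tmp 0) (p + 4)] @ [Add (sc v) (tmp (t + 2)) (tmp 0)])"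

text \<open>The counters of \<open>For\<close> live in two temporaries and the index is copied into
  the variable at each iteration, so that the body is free to overwrite the loop variable.\<close>

fun cc :: "nat \<Rightarrow> nat \<Rightarrow> cmd \<Rightarrow> instr list" where
  "cc p t Skip = []"
| "cc p t (Assign v e) = ce p t e @ [Add (sc v) (tmp t) (tmp 0)]"
| "cc p t (Write a e1 e2) =
     (let c1 = ce p t e1 in c1 @ ce (p + length c1) (t + 1) e2 @
     [Add (tmp t) (tmp t) (tmp t), Add (tmp t) (tmp t) (tmp t),
      Add (tmp t) (tmp t) (tmp t), Add (tmp t) (tmp t) (tmp t),
      Const (tmp (t + 2)) (code a), Add (tmp t) (tmp t) (tmp (t + 2)), Store (tmp t) (tmp (t + 1))])"
| "cc p t (Seq c1 c2) = (let d = cc p t c1 in d @ cc (p + length d) t c2)"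
| "cc p t (Cond e c1 c2) =
     (let c = ce p t e; q = p + length c; d1 = cc (q + 1) t c1; q' = q + length d1 + 2;
          d2 = cc q' t c2
      in c @ [JumpZero (tmp t) q'] @ d1 @ [JumpZero (tmp 0) (q' + length d2)] @ d2)"
| "cc p t (For v c) =
     (let d = cc (p + 4) (t + 2) c
      in [Add (tmp t) (tmp 1) (tmp 0), Const (tmp (t + 1)) 0] @
         [JumpZero (tmp t) (p + length d + 8)] @ [Add (sc v) (tmp (t + 1)) (tmp 0)] @ d @
         [Const (tmp (t + 2)) 1, Add (tmp (t + 1)) (tmp (t + 1)) (tmp (t + 2)),
          Sub (tmp t) (tmp t) (tmp (t + 2))] @ [JumpZero (tmp 0) (p + 2)])"

fun te :: "nat \<Rightarrow> expr \<Rightarrow> nat" where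
  "te B (Num n) = 1"
| "te B (Var v) = 1"
| "te B Bound = 1"
| "te B (Cell a e) = te B e + 7"
| "te B (Inp e) = te B e + 1"
| "te B (Plus e1 e2) = te B e1 + te B e2 + 1"
| "te B (Minus e1 e2) = te B e1 + te B e2 + 1"
| "te B (Ite e e1 e2) = te B e + te B e1 + te B e2 + 2"
| "te B (BSum v e) = B * (te B e + 6) + 6"

fun tc :: "nat \<Rightarrow> cmd \<Rightarrow> nat" where
  "tc B Skip = 0"
| "tc B (Assign v e) = te B e + 1"
| "tc B (Write a e1 e2) = te B e1 + te B e2 + 7"
| "tc B (Seq c1 c2) = tc B c1 + tc B c2"
| "tc B (Cond e c1 c2) = te B e + tc B c1 + tc B c2 + 2"
| "tc B (For v c) = B * (tc B c + 6) + 3"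

section \<open>Polynomial bounds on the running time\<close>

definition poly_bounded :: "(nat \<Rightarrow> nat) \<Rightarrow> bool" where
  "poly_bounded f \<longleftrightarrow> (\<exists>K D. \<forall>B. f B \<le> K * (B + 1) ^ D)"

lemma poly_bounded_const: "poly_bounded (\<lambda>_. a)"
  unfolding poly_bounded_def by (rule exI[of _ a], rule exI[of _ 0]) simp

lemma poly_bounded_add:
  assumes "poly_bounded f" "poly_bounded g"
  shows "poly_bounded (\<lambda>B. f B + g B)"
proof -
  obtain K D where f: "\<And>B. f B \<le> K * (B + 1) ^ D" using assms(1) unfolding poly_bounded_def by blast
  obtain K' D' where g: "\<And>B. g B \<le> K' * (B + 1) ^ D'" using assms(2) unfolding poly_bounded_def by blast
  have "f B + g B \<le> (K + K') * (B + 1) ^ (D + D')" for B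
  proof -
    have "(B + 1) ^ D \<le> (B + 1) ^ (D + D')" "(B + 1) ^ D' \<le> (B + 1) ^ (D + D')"
      by (rule power_increasing; simp)+
    then have "K * (B + 1) ^ D \<le> K * (B + 1) ^ (D + D')" "K' * (B + 1) ^ D' \<le> K' * (B + 1) ^ (D + D')"
      by (simp_all only: mult_le_mono2)
    then have "f B + g B \<le> K * (B + 1) ^ (D + D') + K' * (B + 1) ^ (D + D')"
      using f[of B] g[of B] by linarith
    then show ?thesis by (simp only: distrib_right)
  qed
  then show ?thesis unfolding poly_bounded_def by blast
qed

lemma poly_bounded_times_arg:
  assumes "poly_bounded f"
  shows "poly_bounded (\<lambda>B. B * f B)"
proof -
  obtain K D where f: "\<And>B. f B \<le> K * (B + 1) ^ D" using assms(1) unfolding poly_bounded_def by blast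
  have "B * f B \<le> K * (B + 1) ^ Suc D" for B
  proof -
    have "B * f B \<le> (B + 1) * (K * (B + 1) ^ D)" by (intro mult_mono f) auto
    then show ?thesis by (simp add: algebra_simps)
  qed
  then show ?thesis unfolding poly_bounded_def by blast
qed

lemma poly_bounded_te: "poly_bounded (\<lambda>B. te B e)"
  by (induction e) (simp_all only: te.simps poly_bounded_const poly_bounded_add poly_bounded_times_arg)

lemma poly_bounded_tc: "poly_bounded (\<lambda>B. tc B c)"
  by (induction c)
    (simp_all only: tc.simps poly_bounded_const poly_bounded_add poly_bounded_times_arg poly_bounded_te)

section \<open>Execution of code fragments inside a program\<close>

definition code_at :: "instr list \<Rightarrow> nat \<Rightarrow> instr list \<Rightarrow> bool" where
  "code_at P p c \<longleftrightarrow> (\<exists>u w. P = u @ c @ w \<and> length u = p)"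

lemma code_at_append:
  assumes "code_at P p (c @ d)"
  shows "code_at P p c" "code_at P (p + length c) d"
proof -
  obtain u w where h: "P = u @ (c @ d) @ w" "length u = p" using assms unfolding code_at_def by blast
  have "P = u @ c @ (d @ w)" "P = (u @ c) @ d @ w" "length (u @ c) = p + length c" using h by auto
  then show "code_at P p c" "code_at P (p + length c) d"
    unfolding code_at_def using h(2) by blast+
qed

definition runs :: "instr list \<Rightarrow> nat list \<Rightarrow> nat \<Rightarrow> config \<Rightarrow> config \<Rightarrow> bool" where
  "runs P x n s s' \<longleftrightarrow> (\<exists>j\<le>n. (step P x ^^ j) s = s')"

lemma runs_refl: "runs P x 0 s s"
  unfolding runs_def by simp

lemma runs_trans:
  assumes "runs P x n s s'" "runs P x n' s' s''"
  shows "runs P x (n + n') s s''"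
proof -
  obtain j j' where "j \<le> n" "j' \<le> n'" "(step P x ^^ j) s = s'" "(step P x ^^ j') s' = s''"
    using assms unfolding runs_def by blast
  then have "(step P x ^^ (j' + j)) s = s''" "j' + j \<le> n + n'" by (simp_all add: funpow_add)
  then show ?thesis unfolding runs_def by blast
qed

lemma runs_mono: "runs P x n s s' \<Longrightarrow> n \<le> n' \<Longrightarrow> runs P x n' s s'"
  unfolding runs_def using order_trans by blast

lemma runs_instr:
  assumes "code_at P p (i # c)"
  shows "runs P x 1 (p, m) (exec x i (p, m))"
proof -
  obtain u w where h: "P = u @ (i # c) @ w" "length u = p" using assms unfolding code_at_def by blast
  then have "step P x (p, m) = exec x i (p, m)" by (auto simp: step_def halted_def)
  then show ?thesis unfolding runs_def by (intro exI[of _ 1]) simp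
qed

lemma runs_jump:
  assumes "code_at P p [JumpZero i q]"
  shows "runs P x 1 (p, m) (if m i = 0 then q else p + 1, m)"
  using runs_instr[OF assms, of x m] by simp

fun no_jump :: "instr \<Rightarrow> bool" where
  "no_jump (JumpZero i p) = False"
| "no_jump _ = True"

text \<open>The program counter 0 is a dummy: the effect of an instruction on the registers does not
  depend on it, and a \<open>no_jump\<close> instruction merely advances it.\<close>

definition blk :: "nat list \<Rightarrow> instr list \<Rightarrow> store \<Rightarrow> store" where
  "blk x c m = fold (\<lambda>i m. snd (exec x i (0, m))) c m"

lemma blk_simps [simp]:
  "blk x [] m = m" "blk x (i # c) m = blk x c (snd (exec x i (0, m)))"
  unfolding blk_def by simp_all

lemma runs_blk:
  assumes "code_at P p c" "\<forall>i\<in>set c. no_jump i"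
  shows "runs P x (length c) (p, m) (p + length c, blk x c m)"
  using assms
proof (induction c arbitrary: p m)
  case Nil
  then show ?case by (simp add: runs_refl)
next
  case (Cons i c)
  have e: "exec x i (p, m) = (p + 1, snd (exec x i (0, m)))" using Cons.prems(2) by (cases i) auto
  have "code_at P (p + 1) c" using code_at_append(2)[of P p "[i]" c] Cons.prems(1) by simp
  from Cons.IH[OF this] have "runs P x (length c) (p + 1, snd (exec x i (0, m)))
    (p + 1 + length c, blk x c (snd (exec x i (0, m))))" using Cons.prems(2) by simp
  from runs_trans[OF runs_instr[OF Cons.prems(1), of x m, unfolded e] this] show ?case by simp
qed

definition rel :: "store \<Rightarrow> heap \<Rightarrow> nat \<Rightarrow> store \<Rightarrow> bool" where
  "rel \<rho> \<mu> B m \<longleftrightarrow> (\<forall>v. m (sc v) = \<rho> v) \<and> (\<forall>a i. m (cel a i) = \<mu> a i) \<and> m (tmp 0) = 0 \<and> m (tmp 1) = B"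

text \<open>Protects the partial results and loop counters that enclosing code keeps in lower
  temporaries.\<close>

definition same_tmp :: "nat \<Rightarrow> store \<Rightarrow> store \<Rightarrow> bool" where
  "same_tmp t m m' \<longleftrightarrow> (\<forall>j<t. m' (tmp j) = m (tmp j))"

lemma same_tmp_trans: "same_tmp t m m' \<Longrightarrow> same_tmp u m' m'' \<Longrightarrow> t \<le> u \<Longrightarrow> same_tmp t m m''"
  unfolding same_tmp_def by auto

definition exec_expr :: "instr list \<Rightarrow> nat list \<Rightarrow> nat \<Rightarrow> heap \<Rightarrow> store \<Rightarrow> nat \<Rightarrow> nat \<Rightarrow> expr \<Rightarrow> store \<Rightarrow> store \<Rightarrow> bool" where
  "exec_expr P x B \<mu> \<rho> p t e m m' \<longleftrightarrow>
     runs P x (te B e) (p, m) (p + length (ce p t e), m') \<and> rel \<rho> \<mu> B m' \<and>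
     m' (tmp t) = ev x B \<mu> \<rho> e \<and> same_tmp t m m'"

lemma ce_bin_correct:
  assumes "\<And>p t m. code_at P p (ce p t e1) \<Longrightarrow> rel \<rho> \<mu> B m \<Longrightarrow> 2 \<le> t \<Longrightarrow> \<exists>m'. exec_expr P x B \<mu> \<rho> p t e1 m m'"
    and "\<And>p t m. code_at P p (ce p t e2) \<Longrightarrow> rel \<rho> \<mu> B m \<Longrightarrow> 2 \<le> t \<Longrightarrow> \<exists>m'. exec_expr P x B \<mu> \<rho> p t e2 m m'"
    and c: "code_at P p (ce p t e1 @ ce (p + length (ce p t e1)) (t + 1) e2)"
    and m: "rel \<rho> \<mu> B m" and t: "2 \<le> t"
  shows "\<exists>m'. runs P x (te B e1 + te B e2) (p, m)
      (p + length (ce p t e1 @ ce (p + length (ce p t e1)) (t + 1) e2), m') \<and> rel \<rho> \<mu> B m' \<and>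
      m' (tmp t) = ev x B \<mu> \<rho> e1 \<and> m' (tmp (t + 1)) = ev x B \<mu> \<rho> e2 \<and> same_tmp t m m'"
proof -
  obtain m1 where m1: "exec_expr P x B \<mu> \<rho> p t e1 m m1" using assms(1)[OF code_at_append(1)[OF c] m t] by blast
  obtain m2 where m2: "exec_expr P x B \<mu> \<rho> (p + length (ce p t e1)) (t + 1) e2 m1 m2"
    using assms(2)[OF code_at_append(2)[OF c]] m1 t unfolding exec_expr_def by force
  show ?thesis
    using runs_trans[of P x _ "(p, m)" _ _ _] m1 m2 unfolding exec_expr_def
    by (intro exI[of _ m2]) (auto simp: same_tmp_def add.assoc)
qed

lemma sixteenfold:
  "y + y + (y + y) + (y + y + (y + y)) + (y + y + (y + y) + (y + y + (y + y))) = 16 * (y::nat)"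
  by simp

lemma ce_correct:
  assumes "code_at P p (ce p t e)" "rel \<rho> \<mu> B m" "2 \<le> t"
  shows "\<exists>m'. exec_expr P x B \<mu> \<rho> p t e m m'"
  using assms
proof (induction e arbitrary: p t \<rho> m)
  case (Num n)
  show ?case using runs_blk[OF Num.prems(1), of x m] Num.prems(2,3)
    by (auto simp: exec_expr_def rel_def same_tmp_def)
next
  case (Var v)
  show ?case using runs_blk[OF Var.prems(1), of x m] Var.prems(2,3)
    by (auto simp: exec_expr_def rel_def same_tmp_def)
next
  case Bound
  show ?case using runs_blk[OF Bound.prems(1), of x m] Bound.prems(2,3)
    by (auto simp: exec_expr_def rel_def same_tmp_def)
next
  case (Cell a e)
  let ?c = "[Add (tmp t) (tmp t) (tmp t), Add (tmp t) (tmp t) (tmp t),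
      Add (tmp t) (tmp t) (tmp t), Add (tmp t) (tmp t) (tmp t),
      Const (tmp (t + 1)) (code a), Add (tmp t) (tmp t) (tmp (t + 1)), Load (tmp t) (tmp t)]"
  have c: "code_at P p (ce p t e @ ?c)" using Cell.prems(1) by simp
  obtain m1 where m1: "exec_expr P x B \<mu> \<rho> p t e m m1"
    using Cell.IH[OF code_at_append(1)[OF c] Cell.prems(2,3)] by blast
  have r: "runs P x 7 (p + length (ce p t e), m1) (p + length (ce p t e) + 7, blk x ?c m1)"
    using runs_blk[OF code_at_append(2)[OF c], of x m1] by (simp add: eval_nat_numeral del: blk_simps)
  have v: "m1 (tmp t) = ev x B \<mu> \<rho> e" using m1 by (simp add: exec_expr_def)
  have b: "blk x ?c m1 = m1(tmp t := 16 * m1 (tmp t), tmp (t + 1) := code a,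
     tmp t := (m1(tmp t := 16 * m1 (tmp t) + code a, tmp (t + 1) := code a)) (cel a (m1 (tmp t))))"
    by (simp add: fun_eq_iff cel_def sixteenfold)
  have "blk x ?c m1 (tmp t) = \<mu> a (ev x B \<mu> \<rho> e)"
    using m1 unfolding b by (simp add: exec_expr_def rel_def v)
  moreover have "rel \<rho> \<mu> B (blk x ?c m1)" "same_tmp t m (blk x ?c m1)"
    using m1 Cell.prems(3) unfolding b by (auto simp: exec_expr_def rel_def same_tmp_def)
  moreover have "runs P x (te B e) (p, m) (p + length (ce p t e), m1)" using m1 by (simp add: exec_expr_def)
  from runs_trans[OF this r]
  have "runs P x (te B (Cell a e)) (p, m) (p + length (ce p t (Cell a e)), blk x ?c m1)"
    by (simp add: eval_nat_numeral del: blk_simps)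
  ultimately show ?case unfolding exec_expr_def by auto
next
  case (Inp e)
  let ?c = "[Input (tmp t) (tmp t)]"
  have c: "code_at P p (ce p t e @ ?c)" using Inp.prems(1) by simp
  obtain m1 where m1: "exec_expr P x B \<mu> \<rho> p t e m m1"
    using Inp.IH[OF code_at_append(1)[OF c] Inp.prems(2,3)] by blast
  have r: "runs P x 1 (p + length (ce p t e), m1) (p + length (ce p t e) + 1, blk x ?c m1)"
    using runs_blk[OF code_at_append(2)[OF c], of x m1] by simp
  have "runs P x (te B e) (p, m) (p + length (ce p t e), m1)" using m1 by (simp add: exec_expr_def)
  from runs_trans[OF this r]
  have "runs P x (te B (Inp e)) (p, m) (p + length (ce p t (Inp e)), blk x ?c m1)"
    by (simp add: add.assoc del: blk_simps)
  moreover have "rel \<rho> \<mu> B (blk x ?c m1)" "same_tmp t m (blk x ?c m1)"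
    "blk x ?c m1 (tmp t) = ev x B \<mu> \<rho> (Inp e)"
    using m1 Inp.prems(3) by (auto simp: exec_expr_def rel_def same_tmp_def)
  ultimately show ?case unfolding exec_expr_def by auto
next
  case (Plus e1 e2)
  let ?d = "ce p t e1 @ ce (p + length (ce p t e1)) (t + 1) e2"
  have c: "code_at P p (?d @ [Add (tmp t) (tmp t) (tmp (t + 1))])" using Plus.prems(1) by (simp add: Let_def)
  obtain m1 where m1: "runs P x (te B e1 + te B e2) (p, m) (p + length ?d, m1)" "rel \<rho> \<mu> B m1"
      "m1 (tmp t) = ev x B \<mu> \<rho> e1" "m1 (tmp (t + 1)) = ev x B \<mu> \<rho> e2" "same_tmp t m m1"
    using ce_bin_correct[OF Plus.IH code_at_append(1)[OF c] Plus.prems(2,3)] by blast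
  let ?m = "blk x [Add (tmp t) (tmp t) (tmp (t + 1))] m1"
  have "runs P x (te B (Plus e1 e2)) (p, m) (p + length (ce p t (Plus e1 e2)), ?m)"
    using runs_trans[OF m1(1) runs_blk[OF code_at_append(2)[OF c], of x m1]]
    by (simp add: add.assoc Let_def del: blk_simps)
  moreover have "rel \<rho> \<mu> B ?m" "same_tmp t m ?m" "?m (tmp t) = ev x B \<mu> \<rho> (Plus e1 e2)"
    using m1(2-) Plus.prems(3) by (auto simp: rel_def same_tmp_def)
  ultimately show ?case unfolding exec_expr_def by auto
next
  case (Minus e1 e2)
  let ?d = "ce p t e1 @ ce (p + length (ce p t e1)) (t + 1) e2"
  have c: "code_at P p (?d @ [Sub (tmp t) (tmp t) (tmp (t + 1))])" using Minus.prems(1) by (simp add: Let_def)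
  obtain m1 where m1: "runs P x (te B e1 + te B e2) (p, m) (p + length ?d, m1)" "rel \<rho> \<mu> B m1"
      "m1 (tmp t) = ev x B \<mu> \<rho> e1" "m1 (tmp (t + 1)) = ev x B \<mu> \<rho> e2" "same_tmp t m m1"
    using ce_bin_correct[OF Minus.IH code_at_append(1)[OF c] Minus.prems(2,3)] by blast
  let ?m = "blk x [Sub (tmp t) (tmp t) (tmp (t + 1))] m1"
  have "runs P x (te B (Minus e1 e2)) (p, m) (p + length (ce p t (Minus e1 e2)), ?m)"
    using runs_trans[OF m1(1) runs_blk[OF code_at_append(2)[OF c], of x m1]]
    by (simp add: add.assoc Let_def del: blk_simps)
  moreover have "rel \<rho> \<mu> B ?m" "same_tmp t m ?m" "?m (tmp t) = ev x B \<mu> \<rho> (Minus e1 e2)"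
    using m1(2-) Minus.prems(3) by (auto simp: rel_def same_tmp_def)
  ultimately show ?case unfolding exec_expr_def by auto
next
  case (Ite e e1 e2)
  define q where "q = p + length (ce p t e)"
  define q' where "q' = q + length (ce (q + 1) t e1) + 2"
  define q2 where "q2 = q' + length (ce q' t e2)"
  have len: "p + length (ce p t (Ite e e1 e2)) = q2"
    by (simp add: Let_def q_def q'_def q2_def)
  have c: "code_at P p (ce p t e @ [JumpZero (tmp t) q'] @ ce (q + 1) t e1 @ [JumpZero (tmp 0) q2] @ ce q' t e2)"
    using Ite.prems(1) by (simp add: Let_def q_def q'_def q2_def add.assoc)
  note c0 = code_at_append(1)[OF c] and c1 = code_at_append(2)[OF c, folded q_def]
  note c2 = code_at_append(1)[OF c1] and c3 = code_at_append(2)[OF c1]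
  note c4 = code_at_append(1)[OF c3] and c5 = code_at_append(2)[OF c3]
  note c6 = code_at_append(1)[OF c5] and c7 = code_at_append(2)[OF c5]
  have c4': "code_at P (q + 1) (ce (q + 1) t e1)" using c4 by simp
  have c6': "code_at P (q + 1 + length (ce (q + 1) t e1)) [JumpZero (tmp 0) q2]" using c6 by simp
  have c7': "code_at P q' (ce q' t e2)" using c7 by (simp add: q'_def)
  obtain m1 where m1: "exec_expr P x B \<mu> \<rho> p t e m m1" using Ite.IH(1)[OF c0 Ite.prems(2,3)] by blast
  then have r1: "runs P x (te B e) (p, m) (q, m1)" and rel1: "rel \<rho> \<mu> B m1"
    by (simp_all add: exec_expr_def q_def)
  note r2 = runs_trans[OF r1 runs_jump[OF c2, of x m1]]
  show ?case
  proof (cases "ev x B \<mu> \<rho> e = 0")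
    case True
    then have r3: "runs P x (te B e + 1) (p, m) (q', m1)" using r2 m1 by (simp add: exec_expr_def)
    obtain m2 where m2: "exec_expr P x B \<mu> \<rho> q' t e2 m1 m2" using Ite.IH(3)[OF c7' rel1 Ite.prems(3)] by blast
    then have "runs P x (te B e + 1 + te B e2) (p, m) (q2, m2)"
      using runs_trans[OF r3] by (simp add: exec_expr_def q2_def)
    then have "runs P x (te B (Ite e e1 e2)) (p, m) (q2, m2)" by (rule runs_mono) simp
    then show ?thesis using m1 m2 True len unfolding exec_expr_def
      by (intro exI[of _ m2]) (auto intro: same_tmp_trans)
  next
    case False
    then have r3: "runs P x (te B e + 1) (p, m) (q + 1, m1)" using r2 m1 by (simp add: exec_expr_def)
    obtain m2 where m2: "exec_expr P x B \<mu> \<rho> (q + 1) t e1 m1 m2" using Ite.IH(2)[OF c4' rel1 Ite.prems(3)] by blast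
    then have "runs P x (te B e + 1 + te B e1) (p, m) (q + 1 + length (ce (q + 1) t e1), m2)"
      using runs_trans[OF r3] by (simp add: exec_expr_def)
    moreover have "m2 (tmp 0) = 0" using m2 by (simp add: exec_expr_def rel_def)
    ultimately have "runs P x (te B e + 1 + te B e1 + 1) (p, m) (q2, m2)"
      using runs_trans[OF _ runs_jump[OF c6', of x m2]] by simp
    then have "runs P x (te B (Ite e e1 e2)) (p, m) (q2, m2)" by (rule runs_mono) simp
    then show ?thesis using m1 m2 False len unfolding exec_expr_def
      by (intro exI[of _ m2]) (auto intro: same_tmp_trans)
  qed
next
  case (BSum v e)
  let ?b = "ce (p + 5) (t + 3) e"
  let ?c1 = "[Const (tmp t) 0, Add (tmp (t + 1)) (tmp 1) (tmp 0), Add (tmp (t + 2)) (sc v) (tmp 0), Const (sc v) 0]"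
  let ?c2 = "[Add (tmp t) (tmp t) (tmp (t + 3)), Const (tmp (t + 3)) 1,
          Add (sc v) (sc v) (tmp (t + 3)), Sub (tmp (t + 1)) (tmp (t + 1)) (tmp (t + 3))]"
  define q where "q = p + length ?b + 10"
  have c: "code_at P p (?c1 @ [JumpZero (tmp (t + 1)) q] @ ?b @ ?c2 @ [JumpZero (tmp 0) (p + 4)] @
      [Add (sc v) (tmp (t + 2)) (tmp 0)])"
    using BSum.prems(1) by (simp add: Let_def q_def)
  note c0 = code_at_append(1)[OF c] and c1 = code_at_append(2)[OF c]
  note c2 = code_at_append(1)[OF c1] and c3 = code_at_append(2)[OF c1]
  note c4 = code_at_append(1)[OF c3] and c5 = code_at_append(2)[OF c3]
  note c6 = code_at_append(1)[OF c5] and c7 = code_at_append(2)[OF c5]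
  note c8 = code_at_append(1)[OF c7] and c9 = code_at_append(2)[OF c7]
  have d2: "code_at P (p + 4) [JumpZero (tmp (t + 1)) q]" using c2 by (simp add: eval_nat_numeral)
  have d4: "code_at P (p + 5) ?b" using c4 by (simp add: eval_nat_numeral)
  have d6: "code_at P (p + 5 + length ?b) ?c2" using c6 by (simp add: eval_nat_numeral)
  have d8: "code_at P (p + length ?b + 9) [JumpZero (tmp 0) (p + 4)]" using c8 by (simp add: eval_nat_numeral add.commute)
  have d9: "code_at P q [Add (sc v) (tmp (t + 2)) (tmp 0)]" using c9 by (simp add: q_def eval_nat_numeral add.commute)
  \<comment> \<open>Temporary \<open>t + 1\<close> counts down, because the only test is for zero;
    \<open>t + 2\<close> keeps the outer value of \<open>v\<close>, and \<open>t + 3\<close>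
    receives the summand and then the constant 1.\<close>
  define I where "I i m' \<longleftrightarrow> rel (\<rho>(v := i)) \<mu> B m' \<and> same_tmp t m m' \<and> m' (tmp (t + 1)) = B - i \<and>
      m' (tmp (t + 2)) = \<rho> v \<and> m' (tmp t) = (\<Sum>j<i. ev x B \<mu> (\<rho>(v := j)) e)" for i m'
  have body: "\<exists>m''. runs P x (te B e + 6) (p + 4, m') (p + 4, m'') \<and> I (Suc i) m''"
    if i: "i < B" and I: "I i m'" for i m'
  proof -
    have "runs P x 1 (p + 4, m') (p + 5, m')" using runs_jump[OF d2, of x m'] I i by (simp add: I_def eval_nat_numeral)
    note r1 = this
    obtain m1 where m1: "exec_expr P x B \<mu> (\<rho>(v := i)) (p + 5) (t + 3) e m' m1"
    proof -
      have "rel (\<rho>(v := i)) \<mu> B m'" using I unfolding I_def by blast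
      from BSum.IH[OF d4 this] show ?thesis using that by (auto simp: fun_upd_def)
    qed
    then have r2: "runs P x (te B e) (p + 5, m') (p + 5 + length ?b, m1)" by (simp add: exec_expr_def)
    define m2 where "m2 = blk x ?c2 m1"
    have r3: "runs P x (1 + te B e + 4) (p + 4, m') (p + length ?b + 9, m2)"
      using runs_trans[OF runs_trans[OF r1 r2] runs_blk[OF d6, of x m1]]
      by (simp add: m2_def eval_nat_numeral del: blk_simps)
    have I2: "I (Suc i) m2"
      using m1 I i BSum.prems(3) unfolding m2_def I_def
      by (auto simp: exec_expr_def rel_def same_tmp_def)
    have z: "m2 (tmp 0) = 0" using I2 by (simp add: I_def rel_def)
    have "runs P x (1 + te B e + 4 + 1) (p + 4, m') (p + 4, m2)"
      using runs_trans[OF r3 runs_jump[OF d8, of x m2]] by (simp only: z if_True refl)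
    then have "runs P x (te B e + 6) (p + 4, m') (p + 4, m2)" by (simp add: add.commute)
    then show ?thesis using I2 by blast
  qed
  have loop: "\<exists>m'. runs P x (4 + i * (te B e + 6)) (p, m) (p + 4, m') \<and> I i m'" if "i \<le> B" for i
    using that
  proof (induction i)
    case 0
    have "I 0 (blk x ?c1 m)" using BSum.prems(2,3) by (auto simp: I_def rel_def same_tmp_def)
    moreover have "runs P x (4 + 0 * (te B e + 6)) (p, m) (p + 4, blk x ?c1 m)"
      using runs_blk[OF c0, of x m] by (simp add: eval_nat_numeral del: blk_simps)
    ultimately show ?case by blast
  next
    case (Suc i)
    then obtain m' where m': "runs P x (4 + i * (te B e + 6)) (p, m) (p + 4, m')" "I i m'" by auto
    obtain m'' where m'': "runs P x (te B e + 6) (p + 4, m') (p + 4, m'')" "I (Suc i) m''"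
      using body[of i m'] m'(2) Suc.prems by auto
    show ?case using runs_trans[OF m'(1) m''(1)] m''(2) by (auto simp: algebra_simps)
  qed
  obtain m' where m': "runs P x (4 + B * (te B e + 6)) (p, m) (p + 4, m')" "I B m'"
    using loop[of B] by auto
  have "runs P x 1 (p + 4, m') (q, m')" using runs_jump[OF d2, of x m'] m' by (simp add: I_def)
  from runs_trans[OF runs_trans[OF m'(1) this] runs_blk[OF d9, of x m']]
  have "runs P x (te B (BSum v e)) (p, m) (p + length (ce p t (BSum v e)), m'(sc v := \<rho> v))"
    using m'(2) by (simp add: I_def rel_def Let_def q_def algebra_simps eval_nat_numeral)
  moreover have "rel \<rho> \<mu> B (m'(sc v := \<rho> v))" "same_tmp t m (m'(sc v := \<rho> v))"
    "(m'(sc v := \<rho> v)) (tmp t) = ev x B \<mu> \<rho> (BSum v e)"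
    using m'(2) by (auto simp: I_def rel_def same_tmp_def)
  ultimately show ?case unfolding exec_expr_def by blast
qed

definition exec_cmd :: "instr list \<Rightarrow> nat list \<Rightarrow> nat \<Rightarrow> nat \<Rightarrow> nat \<Rightarrow> cmd \<Rightarrow> store \<times> heap \<Rightarrow> store \<Rightarrow> store \<Rightarrow> bool" where
  "exec_cmd P x B p t c s m m' \<longleftrightarrow>
     runs P x (tc B c) (p, m) (p + length (cc p t c), m') \<and>
     rel (fst (sem x B c s)) (snd (sem x B c s)) B m' \<and> same_tmp t m m'"

lemma cc_correct:
  assumes "code_at P p (cc p t c)" "rel (fst s) (snd s) B m" "2 \<le> t"
  shows "\<exists>m'. exec_cmd P x B p t c s m m'"
  using assms
proof (induction c arbitrary: p t s m)
  case Skip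
  then show ?case by (intro exI[of _ m]) (simp add: exec_cmd_def runs_refl same_tmp_def)
next
  case (Assign v e)
  obtain \<rho> \<mu> where s: "s = (\<rho>, \<mu>)" by fastforce
  have c: "code_at P p (ce p t e @ [Add (sc v) (tmp t) (tmp 0)])" using Assign.prems(1) by simp
  obtain m1 where m1: "exec_expr P x B \<mu> \<rho> p t e m m1"
    using ce_correct[OF code_at_append(1)[OF c]] Assign.prems(2,3) s by fastforce
  then have r: "runs P x (te B e) (p, m) (p + length (ce p t e), m1)" by (simp add: exec_expr_def)
  have b: "blk x [Add (sc v) (tmp t) (tmp 0)] m1 = m1(sc v := ev x B \<mu> \<rho> e)"
    using m1 by (simp add: exec_expr_def rel_def)
  have "runs P x (tc B (Assign v e)) (p, m) (p + length (cc p t (Assign v e)), m1(sc v := ev x B \<mu> \<rho> e))"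
    using runs_trans[OF r runs_blk[OF code_at_append(2)[OF c], of x m1, unfolded b]] by (simp add: add.assoc)
  moreover have "rel (\<rho>(v := ev x B \<mu> \<rho> e)) \<mu> B (m1(sc v := ev x B \<mu> \<rho> e))"
    "same_tmp t m (m1(sc v := ev x B \<mu> \<rho> e))"
    using m1 by (simp_all add: exec_expr_def rel_def same_tmp_def)
  ultimately show ?case unfolding exec_cmd_def s by auto
next
  case (Write a e1 e2)
  obtain \<rho> \<mu> where s: "s = (\<rho>, \<mu>)" by fastforce
  let ?d = "ce p t e1 @ ce (p + length (ce p t e1)) (t + 1) e2"
  let ?c = "[Add (tmp t) (tmp t) (tmp t), Add (tmp t) (tmp t) (tmp t),
      Add (tmp t) (tmp t) (tmp t), Add (tmp t) (tmp t) (tmp t),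
      Const (tmp (t + 2)) (code a), Add (tmp t) (tmp t) (tmp (t + 2)), Store (tmp t) (tmp (t + 1))]"
  have c: "code_at P p (?d @ ?c)" using Write.prems(1) by (simp add: Let_def)
  obtain m1 where m1: "runs P x (te B e1 + te B e2) (p, m) (p + length ?d, m1)" "rel \<rho> \<mu> B m1"
      "m1 (tmp t) = ev x B \<mu> \<rho> e1" "m1 (tmp (t + 1)) = ev x B \<mu> \<rho> e2" "same_tmp t m m1"
    using ce_bin_correct[OF ce_correct ce_correct code_at_append(1)[OF c]] Write.prems(2,3) s by fastforce
  have b: "blk x ?c m1 = m1(tmp t := 16 * ev x B \<mu> \<rho> e1 + code a, tmp (t + 2) := code a,
     cel a (ev x B \<mu> \<rho> e1) := ev x B \<mu> \<rho> e2)"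
    using m1(3,4) by (auto simp: fun_eq_iff cel_def)
  have "runs P x (tc B (Write a e1 e2)) (p, m) (p + length (cc p t (Write a e1 e2)), blk x ?c m1)"
    using runs_trans[OF m1(1) runs_blk[OF code_at_append(2)[OF c], of x m1]]
    by (simp add: Let_def add.assoc eval_nat_numeral del: blk_simps)
  moreover have "rel \<rho> (\<mu>(a := (\<mu> a)(ev x B \<mu> \<rho> e1 := ev x B \<mu> \<rho> e2))) B (blk x ?c m1)"
    "same_tmp t m (blk x ?c m1)"
    using m1(2-) Write.prems(3) unfolding b by (auto simp: rel_def same_tmp_def)
  ultimately show ?case unfolding exec_cmd_def s by auto
next
  case (Seq c1 c2)
  let ?p = "p + length (cc p t c1)"
  have c: "code_at P p (cc p t c1 @ cc ?p t c2)" using Seq.prems(1) by (simp add: Let_def)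
  obtain m1 where m1: "exec_cmd P x B p t c1 s m m1" using Seq.IH(1)[OF code_at_append(1)[OF c] Seq.prems(2,3)] by blast
  obtain m2 where m2: "exec_cmd P x B ?p t c2 (sem x B c1 s) m1 m2"
    using Seq.IH(2)[OF code_at_append(2)[OF c] _ Seq.prems(3), of "sem x B c1 s" m1] m1 by (auto simp: exec_cmd_def)
  show ?case using m1 m2 runs_trans[of P x "tc B c1" "(p, m)" "(?p, m1)" "tc B c2"] unfolding exec_cmd_def
    by (intro exI[of _ m2]) (auto simp: Let_def add.assoc intro: same_tmp_trans)
next
  case (Cond e c1 c2)
  obtain \<rho> \<mu> where s: "s = (\<rho>, \<mu>)" by fastforce
  define q where "q = p + length (ce p t e)"
  define q' where "q' = q + length (cc (q + 1) t c1) + 2"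
  define q2 where "q2 = q' + length (cc q' t c2)"
  have len: "p + length (cc p t (Cond e c1 c2)) = q2"
    by (simp add: Let_def q_def q'_def q2_def)
  have c: "code_at P p (ce p t e @ [JumpZero (tmp t) q'] @ cc (q + 1) t c1 @ [JumpZero (tmp 0) q2] @ cc q' t c2)"
    using Cond.prems(1) by (simp add: Let_def q_def q'_def q2_def add.assoc)
  note c0 = code_at_append(1)[OF c] and c1 = code_at_append(2)[OF c, folded q_def]
  note c2 = code_at_append(1)[OF c1] and c3 = code_at_append(2)[OF c1]
  note c4 = code_at_append(1)[OF c3] and c5 = code_at_append(2)[OF c3]
  note c6 = code_at_append(1)[OF c5] and c7 = code_at_append(2)[OF c5]
  have c4': "code_at P (q + 1) (cc (q + 1) t c1)" using c4 by simp
  have c6': "code_at P (q + 1 + length (cc (q + 1) t c1)) [JumpZero (tmp 0) q2]" using c6 by simp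
  have c7': "code_at P q' (cc q' t c2)" using c7 by (simp add: q'_def)
  obtain m1 where m1: "exec_expr P x B \<mu> \<rho> p t e m m1"
    using ce_correct[OF c0] Cond.prems(2,3) s by fastforce
  then have r1: "runs P x (te B e) (p, m) (q, m1)" and rel1: "rel (fst s) (snd s) B m1"
    by (simp_all add: exec_expr_def q_def s)
  note r2 = runs_trans[OF r1 runs_jump[OF c2, of x m1]]
  show ?case
  proof (cases "ev x B \<mu> \<rho> e = 0")
    case True
    then have r3: "runs P x (te B e + 1) (p, m) (q', m1)" using r2 m1 by (simp add: exec_expr_def)
    obtain m2 where m2: "exec_cmd P x B q' t c2 s m1 m2" using Cond.IH(2)[OF c7' rel1 Cond.prems(3)] by blast
    then have "runs P x (te B e + 1 + tc B c2) (p, m) (q2, m2)"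
      using runs_trans[OF r3] by (simp add: exec_cmd_def q2_def)
    then have "runs P x (tc B (Cond e c1 c2)) (p, m) (q2, m2)" by (rule runs_mono) simp
    then show ?thesis using m1 m2 True len unfolding exec_expr_def exec_cmd_def s
      by (intro exI[of _ m2]) (auto intro: same_tmp_trans)
  next
    case False
    then have r3: "runs P x (te B e + 1) (p, m) (q + 1, m1)" using r2 m1 by (simp add: exec_expr_def)
    obtain m2 where m2: "exec_cmd P x B (q + 1) t c1 s m1 m2" using Cond.IH(1)[OF c4' rel1 Cond.prems(3)] by blast
    then have "runs P x (te B e + 1 + tc B c1) (p, m) (q + 1 + length (cc (q + 1) t c1), m2)"
      using runs_trans[OF r3] by (simp add: exec_cmd_def)
    moreover have "m2 (tmp 0) = 0" using m2 by (simp add: exec_cmd_def rel_def)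
    ultimately have "runs P x (te B e + 1 + tc B c1 + 1) (p, m) (q2, m2)"
      using runs_trans[OF _ runs_jump[OF c6', of x m2]] by simp
    then have "runs P x (tc B (Cond e c1 c2)) (p, m) (q2, m2)" by (rule runs_mono) simp
    then show ?thesis using m1 m2 False len unfolding exec_expr_def exec_cmd_def s
      by (intro exI[of _ m2]) (auto intro: same_tmp_trans)
  qed
next
  case (For v c)
  let ?b = "cc (p + 4) (t + 2) c"
  let ?c1 = "[Add (tmp t) (tmp 1) (tmp 0), Const (tmp (t + 1)) 0]"
  let ?c2 = "[Const (tmp (t + 2)) 1, Add (tmp (t + 1)) (tmp (t + 1)) (tmp (t + 2)), Sub (tmp t) (tmp t) (tmp (t + 2))]"
  let ?a = "[Add (sc v) (tmp (t + 1)) (tmp 0)]"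
  let ?f = "\<lambda>i (\<rho>, \<mu>). sem x B c (\<rho>(v := i), \<mu>)"
  define q where "q = p + length ?b + 8"
  have c: "code_at P p (?c1 @ [JumpZero (tmp t) q] @ ?a @ ?b @ ?c2 @ [JumpZero (tmp 0) (p + 2)])"
    using For.prems(1) by (simp add: Let_def q_def)
  note c0 = code_at_append(1)[OF c] and c1 = code_at_append(2)[OF c]
  note c2 = code_at_append(1)[OF c1] and c3 = code_at_append(2)[OF c1]
  note c4 = code_at_append(1)[OF c3] and c5 = code_at_append(2)[OF c3]
  note c6 = code_at_append(1)[OF c5] and c7 = code_at_append(2)[OF c5]
  note c8 = code_at_append(1)[OF c7] and c9 = code_at_append(2)[OF c7]
  have d2: "code_at P (p + 2) [JumpZero (tmp t) q]" using c2 by simp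
  have d4: "code_at P (p + 3) ?a" using c4 by (simp add: eval_nat_numeral)
  have d6: "code_at P (p + 4) ?b" using c6 by (simp add: eval_nat_numeral)
  have d8: "code_at P (p + 4 + length ?b) ?c2" using c8 by (simp add: eval_nat_numeral)
  have d9: "code_at P (p + length ?b + 7) [JumpZero (tmp 0) (p + 2)]" using c9 by (simp add: eval_nat_numeral add.commute)
  \<comment> \<open>The index is read off temporary \<open>t + 1\<close> and not off the scalar
    \<open>v\<close>, which the body may have changed.\<close>
  define I where "I i m' \<longleftrightarrow> rel (fst (fold ?f [0..<i] s)) (snd (fold ?f [0..<i] s)) B m' \<and> same_tmp t m m' \<and>
      m' (tmp t) = B - i \<and> m' (tmp (t + 1)) = i" for i m'
  have body: "\<exists>m''. runs P x (tc B c + 6) (p + 2, m') (p + 2, m'') \<and> I (Suc i) m''"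
    if i: "i < B" and I: "I i m'" for i m'
  proof -
    obtain \<rho>' \<mu>' where s': "fold ?f [0..<i] s = (\<rho>', \<mu>')" by fastforce
    have r1: "runs P x 1 (p + 2, m') (p + 3, m')" using runs_jump[OF d2, of x m'] I i
      by (simp add: I_def eval_nat_numeral)
    have r2: "runs P x 1 (p + 3, m') (p + 4, m'(sc v := i))" using runs_blk[OF d4, of x m'] I
      by (simp add: I_def rel_def add.commute)
    have "rel (fst (\<rho>'(v := i), \<mu>')) (snd (\<rho>'(v := i), \<mu>')) B (m'(sc v := i))"
      using I by (simp add: I_def s' rel_def)
    then obtain m1 where m1: "exec_cmd P x B (p + 4) (t + 2) c (\<rho>'(v := i), \<mu>') (m'(sc v := i)) m1"
      using For.IH[OF d6] by force
    have f': "fold ?f [0..<Suc i] s = sem x B c (\<rho>'(v := i), \<mu>')" using s' by simp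
    define m2 where "m2 = blk x ?c2 m1"
    have r3: "runs P x (1 + 1 + tc B c + 3) (p + 2, m') (p + length ?b + 7, m2)"
    proof -
      have "runs P x (tc B c) (p + 4, m'(sc v := i)) (p + 4 + length ?b, m1)"
        using m1 by (simp add: exec_cmd_def)
      from runs_trans[OF runs_trans[OF runs_trans[OF r1 r2] this] runs_blk[OF d8, of x m1]]
      show ?thesis by (simp add: m2_def eval_nat_numeral del: blk_simps)
    qed
    have I2: "I (Suc i) m2"
      using m1 I i For.prems(3) unfolding m2_def I_def f'
      by (auto simp: exec_cmd_def rel_def same_tmp_def)
    have z: "m2 (tmp 0) = 0" using I2 by (simp add: I_def rel_def)
    have "runs P x (1 + 1 + tc B c + 3 + 1) (p + 2, m') (p + 2, m2)"
      using runs_trans[OF r3 runs_jump[OF d9, of x m2]] by (simp only: z if_True refl)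
    then have "runs P x (tc B c + 6) (p + 2, m') (p + 2, m2)" by (simp add: add.commute)
    then show ?thesis using I2 by blast
  qed
  have loop: "\<exists>m'. runs P x (2 + i * (tc B c + 6)) (p, m) (p + 2, m') \<and> I i m'" if "i \<le> B" for i
    using that
  proof (induction i)
    case 0
    have "I 0 (blk x ?c1 m)" using For.prems(2,3) by (auto simp: I_def rel_def same_tmp_def)
    moreover have "runs P x (2 + 0 * (tc B c + 6)) (p, m) (p + 2, blk x ?c1 m)"
      using runs_blk[OF c0, of x m] by (simp add: eval_nat_numeral del: blk_simps)
    ultimately show ?case by blast
  next
    case (Suc i)
    then obtain m' where m': "runs P x (2 + i * (tc B c + 6)) (p, m) (p + 2, m')" "I i m'" by auto
    obtain m'' where m'': "runs P x (tc B c + 6) (p + 2, m') (p + 2, m'')" "I (Suc i) m''"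
      using body[of i m'] m'(2) Suc.prems by auto
    show ?case using runs_trans[OF m'(1) m''(1)] m''(2) by (auto simp: algebra_simps)
  qed
  obtain m' where m': "runs P x (2 + B * (tc B c + 6)) (p, m) (p + 2, m')" "I B m'"
    using loop[of B] by auto
  have "runs P x 1 (p + 2, m') (q, m')" using runs_jump[OF d2, of x m'] m' by (simp add: I_def)
  from runs_trans[OF m'(1) this]
  have "runs P x (tc B (For v c)) (p, m) (p + length (cc p t (For v c)), m')"
    by (simp add: Let_def q_def algebra_simps eval_nat_numeral)
  then show ?case using m'(2) by (intro exI[of _ m']) (simp add: exec_cmd_def I_def)
qed

text \<open>
  Apart from the input length, nothing is assumed about the memory that a round leaves to the next one.
\<close>

definition search_program :: "cmd \<Rightarrow> nat \<Rightarrow> nat \<Rightarrow> instr list" where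
  "search_program c d a =
     [Const (tmp 2) 1, Add (tmp 1) (tmp 1) (tmp 2)] @ cc 2 2 c @
     [JumpZero (sc d) 0] @ [Add (sc 0) (sc a) (tmp 0)]"

text \<open>At most \<open>M\<close> rounds are made, each no more expensive than the bound for
  round \<open>M\<close>. An earlier round may end the search, and soundness makes its answer
  correct. Scalar 0 is register 0, which holds the input length at the start and must hold the
  answer at the end; this is why every round has to preserve it.\<close>

lemma search_program_answers:
  assumes inv: "\<And>B \<rho> \<mu>. \<rho> 0 = length x \<Longrightarrow> fst (sem x B c (\<rho>, \<mu>)) 0 = length x"
    and sound: "\<And>B \<rho> \<mu>. \<rho> 0 = length x \<Longrightarrow> fst (sem x B c (\<rho>, \<mu>)) d \<noteq> 0 \<Longrightarrow>
      fst (sem x B c (\<rho>, \<mu>)) a = (if b then 1 else 0)"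
    and complete: "\<And>\<rho> \<mu>. \<rho> 0 = length x \<Longrightarrow> fst (sem x M c (\<rho>, \<mu>)) d \<noteq> 0"
    and bound: "\<And>B. tc B c \<le> K * (B + 1) ^ D"
    and M: "1 \<le> M"
  shows "answers_within (search_program c d a) x b (real ((K + 4) * (M + 1) ^ (D + 1)))"
proof -
  define P where "P = search_program c d a"
  define q where "q = 2 + length (cc 2 2 c)"
  let ?c1 = "[Const (tmp 2) 1, Add (tmp 1) (tmp 1) (tmp 2)]"
  let ?c2 = "[Add (sc 0) (sc a) (tmp 0)]"
  have c: "code_at P 0 (?c1 @ cc 2 2 c @ [JumpZero (sc d) 0] @ ?c2)"
    unfolding code_at_def P_def search_program_def by (intro exI[of _ "[]"]) simp
  note c0 = code_at_append(1)[OF c] and c1 = code_at_append(2)[OF c]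
  note c2 = code_at_append(1)[OF c1] and c3 = code_at_append(2)[OF c1]
  note c4 = code_at_append(1)[OF c3] and c5 = code_at_append(2)[OF c3]
  have d2: "code_at P 2 (cc 2 2 c)" using c2 by (simp add: eval_nat_numeral)
  have d4: "code_at P q [JumpZero (sc d) 0]" using c4 by (simp add: q_def eval_nat_numeral)
  have d5: "code_at P (q + 1) ?c2" using c5 by (simp add: q_def eval_nat_numeral)
  have lenP: "length P = q + 2" by (simp add: P_def search_program_def q_def)
  define C where "C = K * (M + 1) ^ D + 3"
  have round: "\<exists>m'. runs P x C (0, m) ((if m' (sc d) = 0 then 0 else q + 1), m') \<and>
      (\<exists>\<rho>' \<mu>'. (\<rho>', \<mu>') = sem x (B + 1) c (\<rho>, \<mu>) \<and> rel \<rho>' \<mu>' (B + 1) m')"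
    if B: "B < M" and m: "rel \<rho> \<mu> B m" for B \<rho> \<mu> m
  proof -
    let ?m = "blk x ?c1 m"
    have r1: "runs P x 2 (0, m) (2, ?m)" using runs_blk[OF c0, of x m] by (simp add: eval_nat_numeral)
    have "rel \<rho> \<mu> (B + 1) ?m" using m by (auto simp: rel_def)
    then obtain m' where m': "exec_cmd P x (B + 1) 2 2 c (\<rho>, \<mu>) ?m m'"
      using cc_correct[OF d2, of "(\<rho>, \<mu>)" "B + 1" ?m x] by auto
    have "runs P x (2 + tc (B + 1) c) (0, m) (q, m')"
      using runs_trans[OF r1] m' by (simp add: exec_cmd_def q_def)
    from runs_trans[OF this runs_jump[OF d4, of x m']]
    have "runs P x (2 + tc (B + 1) c + 1) (0, m) (if m' (sc d) = 0 then 0 else q + 1, m')" .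
    moreover have "2 + tc (B + 1) c + 1 \<le> C"
    proof -
      have "(B + 1 + 1) ^ D \<le> (M + 1) ^ D" using B by (intro power_mono) auto
      then have "K * (B + 1 + 1) ^ D \<le> K * (M + 1) ^ D" by (rule mult_le_mono2)
      then have "tc (B + 1) c \<le> K * (M + 1) ^ D" using bound[of "B + 1"] by (rule order_trans[rotated])
      then show ?thesis unfolding C_def by linarith
    qed
    ultimately have "runs P x C (0, m) (if m' (sc d) = 0 then 0 else q + 1, m')" by (rule runs_mono)
    then show ?thesis using m' unfolding exec_cmd_def by (metis prod.collapse)
  qed
  \<comment> \<open>\<open>B\<close> rounds are over and at most \<open>j\<close> remain; when only
    one is left, it is round \<open>M\<close>, which cannot fail.\<close>
  have finish: "\<exists>m'. runs P x (j * C + 1) (0, m) (q + 2, m') \<and> m' 0 = (if b then 1 else 0)"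
    if "M = B + j" "0 < j" "rel \<rho> \<mu> B m" "\<rho> 0 = length x" for j B \<rho> \<mu> m
    using that
  proof (induction j arbitrary: B \<rho> \<mu> m)
    case 0
    then show ?case by simp
  next
    case (Suc j)
    obtain m' \<rho>' \<mu>' where m': "runs P x C (0, m) ((if m' (sc d) = 0 then 0 else q + 1), m')"
      and s: "(\<rho>', \<mu>') = sem x (B + 1) c (\<rho>, \<mu>)" and r: "rel \<rho>' \<mu>' (B + 1) m'"
      using round[of B \<rho> \<mu> m] Suc.prems by auto
    have \<rho>': "\<rho>' = fst (sem x (B + 1) c (\<rho>, \<mu>))" using s by (metis fst_conv)
    have len': "\<rho>' 0 = length x" using inv[where \<rho> = \<rho>, OF Suc.prems(4)] \<rho>' by simp
    show ?case
    proof (cases "m' (sc d) = 0")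
      case True
      then have "\<rho>' d = 0" using r by (simp add: rel_def)
      then have "B + 1 \<noteq> M" using complete[where \<rho> = \<rho> and \<mu> = \<mu>, OF Suc.prems(4)] \<rho>' by auto
      then have "0 < j" using Suc.prems(1) by (cases j) auto
      then obtain m2 where m2: "runs P x (j * C + 1) (0, m') (q + 2, m2)" "m2 0 = (if b then 1 else 0)"
        using Suc.IH[of "B + 1" \<rho>' \<mu>' m'] Suc.prems(1) r len' by auto
      have "runs P x C (0, m) (0, m')" using m' True by simp
      from runs_trans[OF this m2(1)] show ?thesis using m2(2) by (auto simp: algebra_simps)
    next
      case False
      then have "\<rho>' d \<noteq> 0" using r by (simp add: rel_def)
      then have "\<rho>' a = (if b then 1 else 0)" using sound[where \<rho> = \<rho> and \<mu> = \<mu> and B = "B + 1", OF Suc.prems(4)] \<rho>' by auto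
      then have "blk x ?c2 m' 0 = (if b then 1 else 0)" using r by (simp add: rel_def sc_def)
      moreover have "runs P x C (0, m) (q + 1, m')" using m' False by simp
      from runs_trans[OF this runs_blk[OF d5, of x m']]
      have "runs P x (C + 1) (0, m) (q + 2, blk x ?c2 m')" by simp
      then have "runs P x (Suc j * C + 1) (0, m) (q + 2, blk x ?c2 m')" by (rule runs_mono) simp
      ultimately show ?thesis by blast
    qed
  qed
  have "rel ((\<lambda>_. 0)(0 := length x)) (\<lambda>_ _. 0) 0 ((\<lambda>_. 0)(0 := length x))"
  proof -
    have z: "sc v = 0 \<longleftrightarrow> v = 0" "cel a i \<noteq> 0" "tmp v \<noteq> 0" for v a i
      using code_bounds[of a] by (auto simp: sc_def cel_def tmp_def)
    show ?thesis by (simp add: rel_def z)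
  qed
  then obtain m' where m': "runs P x (M * C + 1) (0, (\<lambda>_. 0)(0 := length x)) (q + 2, m')"
      "m' 0 = (if b then 1 else 0)"
    using finish[of 0 M] M by fastforce
  then obtain j where j: "j \<le> M * C + 1" "config_after P x j = (q + 2, m')"
    unfolding runs_def config_after_def init_config_def by blast
  have "M * C + 1 \<le> (K + 4) * (M + 1) ^ (D + 1)"
  proof -
    have p: "1 \<le> (M + 1) ^ D" by simp
    then have "C \<le> K * (M + 1) ^ D + 3 * (M + 1) ^ D" unfolding C_def by linarith
    then have "C + 1 \<le> (K + 4) * (M + 1) ^ D" using p unfolding add_mult_distrib by linarith
    then have "(M + 1) * (C + 1) \<le> (M + 1) * ((K + 4) * (M + 1) ^ D)" by (rule mult_le_mono2)
    then show ?thesis by (simp add: algebra_simps)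
  qed
  then have "real j \<le> real ((K + 4) * (M + 1) ^ (D + 1))" using j(1) by linarith
  then show ?thesis unfolding answers_within_def P_def[symmetric]
    using j(2) m'(2) lenP by (intro exI[of _ j]) (auto simp: halted_def)
qed

subsection \<open>Formulas\<close>

definition tr :: "nat list \<Rightarrow> nat \<Rightarrow> heap \<Rightarrow> store \<Rightarrow> expr \<Rightarrow> bool" where
  "tr x B \<mu> \<rho> e \<longleftrightarrow> ev x B \<mu> \<rho> e \<noteq> 0"

definition fNot :: "expr \<Rightarrow> expr" where "fNot e = Ite e (Num 0) (Num 1)"
definition fAnd :: "expr \<Rightarrow> expr \<Rightarrow> expr" where "fAnd e f = Ite e f (Num 0)"
definition fOr :: "expr \<Rightarrow> expr \<Rightarrow> expr" where "fOr e f = Ite e (Num 1) f"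
definition fLess :: "expr \<Rightarrow> expr \<Rightarrow> expr" where "fLess e f = Minus f e"
definition fEq :: "expr \<Rightarrow> expr \<Rightarrow> expr" where "fEq e f = fNot (Plus (Minus e f) (Minus f e))"
definition fEx :: "nat \<Rightarrow> expr \<Rightarrow> expr" where "fEx v e = BSum v e"
definition fCount :: "nat \<Rightarrow> expr \<Rightarrow> expr" where "fCount v e = BSum v (Ite e (Num 1) (Num 0))"
definition fCount2 :: "nat \<Rightarrow> nat \<Rightarrow> expr \<Rightarrow> expr" where "fCount2 v w e = BSum v (fCount w e)"
text \<open>Adds \<open>f\<close> once for each index below \<open>e\<close>, which is the product
  as long as the first factor does not exceed the bound. The variable \<open>w\<close> has to be
  fresh for both factors.\<close>

definition fMul :: "nat \<Rightarrow> expr \<Rightarrow> expr \<Rightarrow> expr" where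
  "fMul w e f = BSum w (Ite (fLess (Var w) e) f (Num 0))"
text \<open>Counts the indices up to which there is no witness; this number is the least witness if
  there is one below the bound.\<close>

definition fLeast :: "nat \<Rightarrow> nat \<Rightarrow> expr \<Rightarrow> expr" where
  "fLeast v w e = BSum v (fNot (fEx w (fAnd (fNot (fLess (Var v) (Var w))) e)))"

lemma tr_simps [simp]:
  "tr x B \<mu> \<rho> (fNot e) \<longleftrightarrow> \<not> tr x B \<mu> \<rho> e"
  "tr x B \<mu> \<rho> (fAnd e f) \<longleftrightarrow> tr x B \<mu> \<rho> e \<and> tr x B \<mu> \<rho> f"
  "tr x B \<mu> \<rho> (fOr e f) \<longleftrightarrow> tr x B \<mu> \<rho> e \<or> tr x B \<mu> \<rho> f"
  "tr x B \<mu> \<rho> (fLess e f) \<longleftrightarrow> ev x B \<mu> \<rho> e < ev x B \<mu> \<rho> f"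
  "tr x B \<mu> \<rho> (fEq e f) \<longleftrightarrow> ev x B \<mu> \<rho> e = ev x B \<mu> \<rho> f"
  "tr x B \<mu> \<rho> (fEx v e) \<longleftrightarrow> (\<exists>i<B. tr x B \<mu> (\<rho>(v := i)) e)"
  by (auto simp: tr_def fNot_def fAnd_def fOr_def fLess_def fEq_def fEx_def)

lemma ev_Ite_tr: "ev x B \<mu> \<rho> (Ite e f g) = (if tr x B \<mu> \<rho> e then ev x B \<mu> \<rho> f else ev x B \<mu> \<rho> g)"
  by (simp add: tr_def)

lemma ev_fCount: "ev x B \<mu> \<rho> (fCount v e) = card {i. i < B \<and> tr x B \<mu> (\<rho>(v := i)) e}"
proof -
  have "{i. i < B \<and> tr x B \<mu> (\<rho>(v := i)) e} = {i \<in> {..<B}. tr x B \<mu> (\<rho>(v := i)) e}" by auto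
  then show ?thesis by (simp add: fCount_def ev_Ite_tr sum.If_cases Int_def del: ev.simps(8))
qed

lemma ev_fCount2:
  "ev x B \<mu> \<rho> (fCount2 v w e) = card {(i, j). i < B \<and> j < B \<and> tr x B \<mu> (\<rho>(v := i, w := j)) e}"
proof -
  have "{(i, j). i < B \<and> j < B \<and> tr x B \<mu> (\<rho>(v := i, w := j)) e} =
      (SIGMA i:{..<B}. {j. j < B \<and> tr x B \<mu> (\<rho>(v := i, w := j)) e})" by auto
  then show ?thesis by (simp add: fCount2_def ev_fCount)
qed

lemma ev_fMul:
  assumes "\<And>i. ev x B \<mu> (\<rho>(w := i)) e = a" "\<And>i. ev x B \<mu> (\<rho>(w := i)) f = b" "a \<le> B"
  shows "ev x B \<mu> \<rho> (fMul w e f) = a * b"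
proof -
  have "ev x B \<mu> \<rho> (fMul w e f) = (\<Sum>i<B. if i < a then b else 0)"
    using assms(1,2) by (simp add: fMul_def ev_Ite_tr del: ev.simps(8) cong: if_cong)
  also have "\<dots> = a * b"
    using assms(3) by (simp add: sum.If_cases Int_def) (metis (no_types, lifting) card_lessThan lessThan_def order_less_le_trans Collect_cong)
  finally show ?thesis .
qed

lemma ev_fLeast:
  assumes "\<And>i j. i < B \<Longrightarrow> j < B \<Longrightarrow> tr x B \<mu> (\<rho>(v := i, w := j)) e \<longleftrightarrow> Q j" "v \<noteq> w" "j < B" "Q j"
  shows "ev x B \<mu> \<rho> (fLeast v w e) < B" "Q (ev x B \<mu> \<rho> (fLeast v w e))"
proof -
  define m where "m = (LEAST j. Q j)"
  have m: "Q m" "m \<le> j" unfolding m_def using assms(4) by (auto intro: LeastI Least_le)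
  have nQ: "\<not> Q i" if "i < m" for i using that not_less_Least unfolding m_def by blast
  have "ev x B \<mu> \<rho> (fLeast v w e) = (\<Sum>i<B. if i < m then 1 else 0)"
    unfolding fLeast_def ev.simps
  proof (rule sum.cong[OF refl])
    fix i assume "i \<in> {..<B}"
    then have i: "i < B" by simp
    let ?e = "fEx w (fAnd (fNot (fLess (Var v) (Var w))) e)"
    have "tr x B \<mu> (\<rho>(v := i)) ?e \<longleftrightarrow> (\<exists>j<B. j \<le> i \<and> Q j)"
      using assms(1)[OF i] assms(2) by (auto simp: not_less)
    also have "\<dots> \<longleftrightarrow> \<not> i < m" using m assms(3) nQ i by (metis le_less_trans not_less)
    finally show "ev x B \<mu> (\<rho>(v := i)) (fNot ?e) = (if i < m then 1 else 0)"
      by (auto simp: fNot_def tr_def)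
  qed
  also have "\<dots> = m"
  proof -
    have "{..<B} \<inter> {i. i < m} = {..<m}" using m(2) assms(3) by auto
    then show ?thesis by (simp add: sum.If_cases)
  qed
  finally show "ev x B \<mu> \<rho> (fLeast v w e) < B" "Q (ev x B \<mu> \<rho> (fLeast v w e))"
    using m assms(3) by auto
qed

subsection \<open>Loops and frames\<close>

lemma sem_Cond_tr:
  "sem x B (Cond e c1 c2) (\<rho>, \<mu>) = (if tr x B \<mu> \<rho> e then sem x B c1 (\<rho>, \<mu>) else sem x B c2 (\<rho>, \<mu>))"
  by (simp add: tr_def)

lemma sem_For_inv:
  assumes "I 0 s" "\<And>i s. i < B \<Longrightarrow> I i s \<Longrightarrow> I (Suc i) (sem x B c ((fst s)(v := i), snd s))"
  shows "I B (sem x B (For v c) s)"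
proof -
  let ?f = "\<lambda>i (\<rho>, \<mu>). sem x B c (\<rho>(v := i), \<mu>)"
  have "I j (fold ?f [0..<j] s)" if "j \<le> B" for j
    using that
  proof (induction j)
    case 0
    then show ?case using assms(1) by simp
  next
    case (Suc j)
    define s' where "s' = fold ?f [0..<j] s"
    have "fold ?f [0..<Suc j] s = sem x B c ((fst s')(v := j), snd s')"
      by (simp add: s'_def[symmetric]) (cases s', simp)
    moreover have "I j s'" unfolding s'_def by (rule Suc.IH) (use Suc.prems in simp)
    then have "I (Suc j) (sem x B c ((fst s')(v := j), snd s'))" by (rule assms(2)[rotated]) (use Suc.prems in simp)
    ultimately show ?case by (simp only:)
  qed
  then show ?thesis by simp
qed

fun mv :: "cmd \<Rightarrow> nat set" where
  "mv Skip = {}" | "mv (Assign v e) = {v}" | "mv (Write a e f) = {}"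
| "mv (Seq c d) = mv c \<union> mv d" | "mv (Cond e c d) = mv c \<union> mv d" | "mv (For v c) = insert v (mv c)"

fun ma :: "cmd \<Rightarrow> arr set" where
  "ma Skip = {}" | "ma (Assign v e) = {}" | "ma (Write a e f) = {a}"
| "ma (Seq c d) = ma c \<union> ma d" | "ma (Cond e c d) = ma c \<union> ma d" | "ma (For v c) = ma c"

lemma sem_frame_var: "u \<notin> mv c \<Longrightarrow> fst (sem x B c s) u = fst s u"
proof (induction c arbitrary: s)
  case (Assign v e)
  then show ?case by (cases s) auto
next
  case (Write a e f)
  then show ?case by (cases s) auto
next
  case (Cond e c d)
  then show ?case by (cases s) auto
next
  case (For v c)
  show ?case by (rule sem_For_inv[where I = "\<lambda>_ s'. fst s' u = fst s u"]) (use For in auto)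
qed auto

lemma sem_frame_arr: "a \<notin> ma c \<Longrightarrow> snd (sem x B c s) a = snd s a"
proof (induction c arbitrary: s)
  case (Assign v e)
  then show ?case by (cases s) auto
next
  case (Write a e f)
  then show ?case by (cases s) auto
next
  case (Cond e c d)
  then show ?case by (cases s) auto
next
  case (For v c)
  show ?case by (rule sem_For_inv[where I = "\<lambda>_ s'. snd s' a = snd s a"]) (use For in auto)
qed auto

text \<open>The states \<open>\<rho>'\<close> and \<open>\<mu>'\<close> stand for any moment during
  the loop. As nothing is known of \<open>\<mu>' a\<close>, the first hypothesis says that index and
  value do not read the array being filled; injectivity of \<open>p\<close> keeps later writes from
  destroying earlier ones, and \<open>THE\<close> inverts it.\<close>

lemma sem_fill:
  assumes idx: "\<And>i \<rho>' \<mu>'. i < B \<Longrightarrow> (\<And>u. u \<noteq> v \<Longrightarrow> \<rho>' u = \<rho> u) \<Longrightarrow> (\<And>a'. a' \<noteq> a \<Longrightarrow> \<mu>' a' = \<mu> a') \<Longrightarrow>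
      \<rho>' v = i \<Longrightarrow> ev x B \<mu>' \<rho>' e = p i \<and> ev x B \<mu>' \<rho>' f = q i"
    and inj: "\<And>i j. i < B \<Longrightarrow> j < B \<Longrightarrow> p i = p j \<Longrightarrow> i = j"
  shows "snd (sem x B (For v (Write a e f)) (\<rho>, \<mu>)) =
    \<mu>(a := \<lambda>m. if \<exists>i<B. m = p i then q (THE i. i < B \<and> m = p i) else \<mu> a m)"
proof -
  define I where "I j s \<longleftrightarrow> (\<forall>u. u \<noteq> v \<longrightarrow> fst s u = \<rho> u) \<and>
    snd s = \<mu>(a := \<lambda>m. if \<exists>i<j. m = p i then q (THE i. i < B \<and> m = p i) else \<mu> a m)" for j s
  have the: "(THE i'. i' < B \<and> p i = p i') = i" if "i < B" for i using that inj by (intro the_equality) auto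
  have "I B (sem x B (For v (Write a e f)) (\<rho>, \<mu>))"
  proof (rule sem_For_inv[where I = I])
    show "I 0 (\<rho>, \<mu>)" by (simp add: I_def)
    fix i s assume i: "i < B" and I: "I i s"
    have e: "ev x B (snd s) ((fst s)(v := i)) e = p i \<and> ev x B (snd s) ((fst s)(v := i)) f = q i"
      by (rule idx[OF i]) (use I in \<open>auto simp: I_def\<close>)
    show "I (Suc i) (sem x B (Write a e f) ((fst s)(v := i), snd s))"
      using I e the[OF i] by (auto simp: I_def fun_eq_iff less_Suc_eq)
  qed
  then show ?thesis by (simp add: I_def)
qed

lemma sem_fill_at:
  assumes "\<And>i \<rho>' \<mu>'. i < B \<Longrightarrow> (\<And>u. u \<noteq> v \<Longrightarrow> \<rho>' u = \<rho> u) \<Longrightarrow> (\<And>a'. a' \<noteq> a \<Longrightarrow> \<mu>' a' = \<mu> a') \<Longrightarrow>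
      \<rho>' v = i \<Longrightarrow> ev x B \<mu>' \<rho>' e = p i \<and> ev x B \<mu>' \<rho>' f = q i"
    and "\<And>i j. i < B \<Longrightarrow> j < B \<Longrightarrow> p i = p j \<Longrightarrow> i = j"
  shows "i < B \<Longrightarrow> snd (sem x B (For v (Write a e f)) (\<rho>, \<mu>)) a (p i) = q i"
    and "(\<And>i. i < B \<Longrightarrow> m \<noteq> p i) \<Longrightarrow> snd (sem x B (For v (Write a e f)) (\<rho>, \<mu>)) a m = \<mu> a m"
proof -
  have g: "snd (sem x B (For v (Write a e f)) (\<rho>, \<mu>)) =
      \<mu>(a := \<lambda>m. if \<exists>i<B. m = p i then q (THE i. i < B \<and> m = p i) else \<mu> a m)"
    by (rule sem_fill[where p = p and q = q]) (use assms in blast)+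
  show "snd (sem x B (For v (Write a e f)) (\<rho>, \<mu>)) a (p i) = q i" if i: "i < B"
  proof -
    have "(THE i'. i' < B \<and> p i = p i') = i" using i assms(2) by (intro the_equality) auto
    then show ?thesis using i unfolding g by auto
  qed
  show "snd (sem x B (For v (Write a e f)) (\<rho>, \<mu>)) a m = \<mu> a m" if "\<And>i. i < B \<Longrightarrow> m \<noteq> p i"
    using that unfolding g by auto
qed

lemma sem_fill2:
  assumes idx: "\<And>i j \<rho>' \<mu>'. i < B \<Longrightarrow> j < B \<Longrightarrow> (\<And>u. u \<noteq> v \<Longrightarrow> u \<noteq> w \<Longrightarrow> \<rho>' u = \<rho> u) \<Longrightarrow>
      (\<And>a'. a' \<noteq> a \<Longrightarrow> \<mu>' a' = \<mu> a') \<Longrightarrow> \<rho>' v = i \<Longrightarrow> \<rho>' w = j \<Longrightarrow>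
      ev x B \<mu>' \<rho>' e = p i j \<and> ev x B \<mu>' \<rho>' f = q i j"
    and inj: "\<And>i j i' j'. i < B \<Longrightarrow> j < B \<Longrightarrow> i' < B \<Longrightarrow> j' < B \<Longrightarrow> p i j = p i' j' \<Longrightarrow> i = i' \<and> j = j'"
    and vw: "v \<noteq> w"
  shows "\<And>i j. i < B \<Longrightarrow> j < B \<Longrightarrow> snd (sem x B (For v (For w (Write a e f))) (\<rho>, \<mu>)) a (p i j) = q i j"
    and "(\<And>i j. i < B \<Longrightarrow> j < B \<Longrightarrow> m \<noteq> p i j) \<Longrightarrow>
      snd (sem x B (For v (For w (Write a e f))) (\<rho>, \<mu>)) a m = \<mu> a m"
proof -
  define c where "c = For w (Write a e f)"
  define I where "I n s \<longleftrightarrow> (\<forall>u. u \<noteq> v \<and> u \<noteq> w \<longrightarrow> fst s u = \<rho> u) \<and> (\<forall>a'. a' \<noteq> a \<longrightarrow> snd s a' = \<mu> a') \<and>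
    (\<forall>i<n. \<forall>j<B. snd s a (p i j) = q i j) \<and>
    (\<forall>m. (\<forall>i<B. \<forall>j<B. m \<noteq> p i j) \<longrightarrow> snd s a m = \<mu> a m)" for n s
  have "I B (sem x B (For v c) (\<rho>, \<mu>))"
  proof (rule sem_For_inv[where I = I])
    show "I 0 (\<rho>, \<mu>)" by (simp add: I_def)
    fix i s assume i: "i < B" and I: "I i s"
    let ?\<rho> = "(fst s)(v := i)"
    let ?s = "sem x B c (?\<rho>, snd s)"
    have 1: "snd ?s a (p i j) = q i j" if "j < B" for j
      unfolding c_def
    proof (rule sem_fill_at(1)[where p = "p i" and q = "q i", OF _ _ that])
      fix j \<rho>' \<mu>' assume j: "j < B" "\<And>u. u \<noteq> w \<Longrightarrow> \<rho>' u = ?\<rho> u" "\<And>a'. a' \<noteq> a \<Longrightarrow> \<mu>' a' = snd s a'" "\<rho>' w = j"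
      show "ev x B \<mu>' \<rho>' e = p i j \<and> ev x B \<mu>' \<rho>' f = q i j"
        by (rule idx[OF i j(1)]) (use j I vw in \<open>auto simp: I_def\<close>)
    qed (use inj i in blast)
    have 2: "snd ?s a m = snd s a m" if "\<And>j. j < B \<Longrightarrow> m \<noteq> p i j" for m
      unfolding c_def
    proof (rule sem_fill_at(2)[where p = "p i" and q = "q i"])
      fix j \<rho>' \<mu>' assume j: "j < B" "\<And>u. u \<noteq> w \<Longrightarrow> \<rho>' u = ?\<rho> u" "\<And>a'. a' \<noteq> a \<Longrightarrow> \<mu>' a' = snd s a'" "\<rho>' w = j"
      show "ev x B \<mu>' \<rho>' e = p i j \<and> ev x B \<mu>' \<rho>' f = q i j"
        by (rule idx[OF i j(1)]) (use j I vw in \<open>auto simp: I_def\<close>)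
    qed (use inj i that in blast)+
    have 3: "fst ?s u = fst s u" if "u \<noteq> v" "u \<noteq> w" for u
      using sem_frame_var[of u c x B "(?\<rho>, snd s)"] that by (simp add: c_def)
    have 4: "snd ?s a' = snd s a'" if "a' \<noteq> a" for a'
      using sem_frame_arr[of a' c x B "(?\<rho>, snd s)"] that by (simp add: c_def)
    have "snd ?s a (p i' j') = q i' j'" if "i' < Suc i" "j' < B" for i' j'
    proof (cases "i' = i")
      case True
      then show ?thesis using 1 that by simp
    next
      case False
      then have "p i' j' \<noteq> p i j" if "j < B" for j using inj[of i' j' i j] that \<open>i' < Suc i\<close> \<open>j' < B\<close> i by auto
      then have "snd ?s a (p i' j') = snd s a (p i' j')" by (rule 2)
      then show ?thesis using I False that by (simp add: I_def)
    qed
    moreover have "snd ?s a m = \<mu> a m" if "\<forall>i<B. \<forall>j<B. m \<noteq> p i j" for m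
      using 2[of m] that i I by (simp add: I_def)
    ultimately show "I (Suc i) ?s" using 3 4 I unfolding I_def by auto
  qed
  then show "\<And>i j. i < B \<Longrightarrow> j < B \<Longrightarrow> snd (sem x B (For v (For w (Write a e f))) (\<rho>, \<mu>)) a (p i j) = q i j"
    and "(\<And>i j. i < B \<Longrightarrow> j < B \<Longrightarrow> m \<noteq> p i j) \<Longrightarrow>
      snd (sem x B (For v (For w (Write a e f))) (\<rho>, \<mu>)) a m = \<mu> a m"
    unfolding I_def c_def by auto
qed

subsection \<open>Simulating a fixed program on a constructed input\<close>

text \<open>
  A simulated run must start with empty memory, although the simulated program may have touched
  arbitrary addresses in earlier runs. A cell counts as written if its slot points into the part
  of the log in use, and the log entry there points back to it.
\<close>

abbreviation (input) "vPc \<equiv> 18::nat"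
abbreviation (input) "vCnt \<equiv> 19::nat"
abbreviation (input) "vAddr \<equiv> 20::nat"
abbreviation (input) "vVal \<equiv> 21::nat"
abbreviation (input) "vLen \<equiv> 22::nat"
abbreviation (input) "vTick \<equiv> 24::nat"

definition mem_of :: "heap \<Rightarrow> nat \<Rightarrow> nat \<Rightarrow> nat" where
  "mem_of \<mu> c r = (if \<mu> Slot r < c \<and> \<mu> Log (\<mu> Slot r) = r then \<mu> Mem r else 0)"

definition written :: "expr \<Rightarrow> expr" where
  "written e = fAnd (fLess (Cell Slot e) (Var vCnt)) (fEq (Cell Log (Cell Slot e)) e)"

definition rd :: "expr \<Rightarrow> expr" where
  "rd e = Ite (written e) (Cell Mem e) (Num 0)"

text \<open>Address and value are evaluated before the first write, since both may read the
  simulated memory.\<close>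

definition wr :: "expr \<Rightarrow> expr \<Rightarrow> cmd" where
  "wr e f = Assign vAddr e ;; Assign vVal f ;;
     Cond (written (Var vAddr)) Skip
       (Write Slot (Var vAddr) (Var vCnt) ;; Write Log (Var vCnt) (Var vAddr) ;;
        Assign vCnt (Plus (Var vCnt) (Num 1))) ;;
     Write Mem (Var vAddr) (Var vVal)"

lemma ev_rd [simp]: "ev x B \<mu> \<rho> (rd e) = mem_of \<mu> (\<rho> vCnt) (ev x B \<mu> \<rho> e)"
  by (simp add: rd_def written_def ev_Ite_tr mem_of_def del: ev.simps(8))

text \<open>A fresh write extends the used part of the log by the entry \<open>vCnt\<close>. Another
  cell whose stale slot happens to be this entry does not become written, because the entry points
  back to the new address; the log value overwritten there lay outside the used part.\<close>

lemma sem_wr: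
  assumes "\<And>a. ev x B \<mu> (\<rho>(vAddr := a)) f = b"
  shows "mem_of (snd (sem x B (wr e f) (\<rho>, \<mu>))) (fst (sem x B (wr e f) (\<rho>, \<mu>)) vCnt) =
    (mem_of \<mu> (\<rho> vCnt))(ev x B \<mu> \<rho> e := b)"
  using assms by (auto simp: wr_def sem_Cond_tr written_def mem_of_def fun_eq_iff simp del: sem.simps(5))

fun sim_instr :: "instr \<Rightarrow> cmd" where
  "sim_instr (Const i a) = wr (Num i) (Num a) ;; Assign vPc (Plus (Var vPc) (Num 1))"
| "sim_instr (Add i j l) = wr (Num i) (Plus (rd (Num j)) (rd (Num l))) ;; Assign vPc (Plus (Var vPc) (Num 1))"
| "sim_instr (Sub i j l) = wr (Num i) (Minus (rd (Num j)) (rd (Num l))) ;; Assign vPc (Plus (Var vPc) (Num 1))"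
| "sim_instr (Load i j) = wr (Num i) (rd (rd (Num j))) ;; Assign vPc (Plus (Var vPc) (Num 1))"
| "sim_instr (Store i j) = wr (rd (Num i)) (rd (Num j)) ;; Assign vPc (Plus (Var vPc) (Num 1))"
| "sim_instr (Input i j) = wr (Num i) (Ite (fLess (rd (Num j)) (Var vLen)) (Cell Graph (rd (Num j))) (Num 0)) ;;
     Assign vPc (Plus (Var vPc) (Num 1))"
| "sim_instr (JumpZero i p) = Cond (rd (Num i)) (Assign vPc (Plus (Var vPc) (Num 1))) (Assign vPc (Num p))"

text \<open>The tests sit in nested else branches, so that no second instruction is executed after
  the first has moved \<open>vPc\<close>. A counter beyond the program matches no test, just as a
  halted machine does nothing.\<close>

fun sim_step :: "nat \<Rightarrow> instr list \<Rightarrow> cmd" where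
  "sim_step j [] = Skip"
| "sim_step j (i # P) = Cond (fEq (Var vPc) (Num j)) (sim_instr i) (sim_step (Suc j) P)"

text \<open>Resetting \<open>vCnt\<close> empties the whole simulated memory at once, whatever the
  arrays contain. The loop makes as many steps as the bound allows, halted or not.\<close>

definition sim_run :: "instr list \<Rightarrow> cmd" where
  "sim_run P = Assign vPc (Num 0) ;; Assign vCnt (Num 0) ;; wr (Num 0) (Var vLen) ;; For vTick (sim_step 0 P)"

definition sim_config :: "store \<times> heap \<Rightarrow> config" where
  "sim_config s = (fst s vPc, mem_of (snd s) (fst s vCnt))"

lemma mv_wr: "mv (wr e f) = {vAddr, vVal, vCnt}" and ma_wr: "ma (wr e f) = {Slot, Log, Mem}"
  by (auto simp: wr_def)

lemma mv_sim_instr: "mv (sim_instr i) \<subseteq> {vPc, vCnt, vAddr, vVal}"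
  and ma_sim_instr: "ma (sim_instr i) \<subseteq> {Slot, Log, Mem}"
  by (cases i; simp add: mv_wr ma_wr)+

lemma mv_sim_step: "mv (sim_step j P) \<subseteq> {vPc, vCnt, vAddr, vVal}"
  and ma_sim_step: "ma (sim_step j P) \<subseteq> {Slot, Log, Mem}"
  using mv_sim_instr ma_sim_instr by (induction P arbitrary: j) auto

lemma mv_sim_run: "mv (sim_run P) \<subseteq> {vPc, vCnt, vAddr, vVal, vTick}"
  and ma_sim_run: "ma (sim_run P) \<subseteq> {Slot, Log, Mem}"
  using mv_sim_step[of 0 P] ma_sim_step[of 0 P] by (auto simp: sim_run_def mv_wr ma_wr)

definition holds_input :: "nat list \<Rightarrow> store \<times> heap \<Rightarrow> bool" where
  "holds_input y s \<longleftrightarrow> fst s vLen = length y \<and> (\<forall>r<length y. snd s Graph r = y ! r)"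

lemma sem_sim_instr:
  assumes "holds_input y s"
  shows "sim_config (sem x B (sim_instr i) s) = exec y i (sim_config s)"
proof -
  obtain \<rho> \<mu> where s: "s = (\<rho>, \<mu>)" by fastforce
  have w: "sim_config (sem x B (wr e f ;; Assign vPc (Plus (Var vPc) (Num 1))) (\<rho>, \<mu>)) =
      (\<rho> vPc + 1, (mem_of \<mu> (\<rho> vCnt))(ev x B \<mu> \<rho> e := b))"
    if "\<And>a. ev x B \<mu> (\<rho>(vAddr := a)) f = b" for e f b
  proof -
    let ?s = "sem x B (wr e f) (\<rho>, \<mu>)"
    have "fst ?s vPc = \<rho> vPc" using sem_frame_var[of vPc "wr e f"] by (simp add: mv_wr)
    moreover have "mem_of (snd ?s) (fst ?s vCnt) = (mem_of \<mu> (\<rho> vCnt))(ev x B \<mu> \<rho> e := b)"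
      by (rule sem_wr[OF that])
    moreover have "sem x B (wr e f ;; Assign vPc (Plus (Var vPc) (Num 1))) (\<rho>, \<mu>) =
        ((fst ?s)(vPc := fst ?s vPc + 1), snd ?s)" by (cases ?s) simp
    ultimately show ?thesis by (simp add: sim_config_def)
  qed
  have c: "sim_config (\<rho>', \<mu>') = (\<rho>' vPc, mem_of \<mu>' (\<rho>' vCnt))" for \<rho>' \<mu>' by (simp add: sim_config_def)
  have inp: "\<rho> vLen = length y" "\<And>r. r < length y \<Longrightarrow> \<mu> Graph r = y ! r"
    using assms by (auto simp: s holds_input_def)
  have rd_input: "ev x B \<mu> (\<rho>(vAddr := a)) (Ite (fLess (rd (Num j)) (Var vLen)) (Cell Graph (rd (Num j))) (Num 0)) =
      (if mem_of \<mu> (\<rho> vCnt) j < length y then y ! mem_of \<mu> (\<rho> vCnt) j else 0)" for a j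
    using inp by (simp add: ev_Ite_tr del: ev.simps(8))
  show ?thesis
    unfolding s
    by (cases i)
      (simp_all add: w[OF rd_input] del: ev.simps(8) sem.simps(4,5) One_nat_def, simp_all add: w c inp ev_Ite_tr sem_Cond_tr tr_def del: ev.simps(8) sem.simps(4,5) One_nat_def)
qed

lemma sem_sim_step:
  "j \<le> fst s vPc \<Longrightarrow> sem x B (sim_step j P) s =
    (if fst s vPc < j + length P then sem x B (sim_instr (P ! (fst s vPc - j))) s else s)"
proof (induction P arbitrary: j)
  case (Cons i P)
  obtain \<rho> \<mu> where s: "s = (\<rho>, \<mu>)" by fastforce
  show ?case
  proof (cases "fst s vPc = j")
    case True
    then show ?thesis by (simp add: s sem_Cond_tr del: sem.simps(5))
  next
    case False
    then have "fst s vPc - j = Suc (fst s vPc - Suc j)" using Cons.prems by simp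
    then show ?thesis using Cons.IH[of "Suc j"] Cons.prems False
      by (auto simp add: s sem_Cond_tr simp del: sem.simps(5))
  qed
qed simp

lemma sem_sim_run:
  assumes "holds_input y s"
  shows "sim_config (sem x B (sim_run P) s) = config_after P y B"
proof -
  define s0 where "s0 = sem x B (Assign vPc (Num 0) ;; Assign vCnt (Num 0) ;; wr (Num 0) (Var vLen)) s"
  obtain \<rho> \<mu> where s: "s = (\<rho>, \<mu>)" by fastforce
  let ?\<rho> = "\<rho>(vPc := 0, vCnt := 0)"
  have s0: "s0 = sem x B (wr (Num 0) (Var vLen)) (?\<rho>, \<mu>)" by (simp add: s0_def s)
  have run: "sem x B (sim_run P) s = sem x B (For vTick (sim_step 0 P)) s0" by (simp add: sim_run_def s0_def)
  have inp: "holds_input y s0" unfolding holds_input_def s0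
    using assms sem_frame_var[of vLen "wr (Num 0) (Var vLen)" x B "(?\<rho>, \<mu>)"]
      sem_frame_arr[of Graph "wr (Num 0) (Var vLen)" x B "(?\<rho>, \<mu>)"]
    by (simp add: mv_wr ma_wr holds_input_def s)
  have "mem_of \<mu> (?\<rho> vCnt) = (\<lambda>_. 0)" by (simp add: mem_of_def fun_eq_iff)
  moreover have "?\<rho> vLen = length y" using assms by (simp add: s holds_input_def)
  moreover have "fst s0 vPc = 0" unfolding s0
    using sem_frame_var[of vPc "wr (Num 0) (Var vLen)" x B "(?\<rho>, \<mu>)"] by (simp add: mv_wr)
  moreover have "mem_of (snd s0) (fst s0 vCnt) = (mem_of \<mu> (?\<rho> vCnt))(ev x B \<mu> ?\<rho> (Num 0) := \<rho> vLen)"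
    unfolding s0 by (rule sem_wr) simp
  ultimately have conf: "sim_config s0 = init_config y" by (simp add: sim_config_def init_config_def)
  have "holds_input y (sem x B (For vTick (sim_step 0 P)) s0) \<and>
      sim_config (sem x B (For vTick (sim_step 0 P)) s0) = config_after P y B"
  proof (rule sem_For_inv[where I = "\<lambda>i s. holds_input y s \<and> sim_config s = config_after P y i"])
    show "holds_input y s0 \<and> sim_config s0 = config_after P y 0" using inp conf by (simp add: config_after_def)
    fix i s assume h: "holds_input y s \<and> sim_config s = config_after P y i"
    let ?s = "((fst s)(vTick := i), snd s)"
    have c: "sim_config ?s = config_after P y i" "holds_input y ?s" using h by (auto simp: sim_config_def holds_input_def)
    have n: "vLen \<notin> mv (sim_step 0 P)" "Graph \<notin> ma (sim_step 0 P)" using mv_sim_step[of 0 P] ma_sim_step[of 0 P] by auto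
    have "holds_input y (sem x B (sim_step 0 P) ?s)"
      using sem_frame_var[OF n(1), of x B ?s] sem_frame_arr[OF n(2), of x B ?s] h by (simp add: holds_input_def)
    moreover have "sim_config (sem x B (sim_step 0 P) ?s) = step P y (sim_config ?s)"
      using sem_sim_instr[OF c(2), of x B] by (auto simp: sem_sim_step step_def halted_def sim_config_def)
    ultimately show "holds_input y (sem x B (sim_step 0 P) ?s) \<and>
        sim_config (sem x B (sim_step 0 P) ?s) = config_after P y (Suc i)"
      using c by (simp add: config_after_def)
  qed
  then show ?thesis using run by simp
qed

section \<open>Sparsification\<close>

text \<open>
  A clause is an ordered triple of literals, the set \<open>E\<close> of clauses is closed under permutations,
  and repeated literals in a clause need no special treatment. A node of the branching tree adds
  unit clauses \<open>U\<close> and binary clauses \<open>D\<close> to \<open>E\<close>.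
\<close>

definition models :: "(nat \<times> nat \<times> nat) set \<Rightarrow> (nat \<Rightarrow> bool) \<Rightarrow> nat set \<Rightarrow> (nat \<times> nat) set \<Rightarrow> bool" where
  "models E T U D \<longleftrightarrow> (\<forall>(a, b, c)\<in>E. T a \<or> T b \<or> T c) \<and> (\<forall>a\<in>U. T a) \<and> (\<forall>(a, b)\<in>D. T a \<or> T b)"

text \<open>The clauses not subsumed by a shorter clause of the node. Since \<open>D\<close> will be
  symmetric, three of the six ordered pairs are enough.\<close>

definition act :: "(nat \<times> nat \<times> nat) set \<Rightarrow> nat set \<Rightarrow> (nat \<times> nat) set \<Rightarrow> (nat \<times> nat \<times> nat) set" where
  "act E U D = {(a, b, c). (a, b, c) \<in> E \<and> a \<notin> U \<and> b \<notin> U \<and> c \<notin> U \<and>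
     (a, b) \<notin> D \<and> (a, c) \<notin> D \<and> (b, c) \<notin> D}"

definition nbr :: "nat set \<Rightarrow> (nat \<times> nat) set \<Rightarrow> nat \<Rightarrow> nat set" where
  "nbr U D a = {b. b \<notin> U \<and> (a, b) \<in> D}"

definition free_pairs :: "nat set \<Rightarrow> (nat \<times> nat) set \<Rightarrow> (nat \<times> nat) set" where
  "free_pairs U D = {(a, b). (a, b) \<in> D \<and> a \<notin> U \<and> b \<notin> U}"

definition leaf_clauses :: "(nat \<times> nat \<times> nat) set \<Rightarrow> nat set \<Rightarrow> (nat \<times> nat) set \<Rightarrow> (nat \<times> nat \<times> nat) set" where
  "leaf_clauses E U D = (\<lambda>a. (a, a, a)) ` U \<union> (\<lambda>(a, b). (a, b, b)) ` free_pairs U D \<union> act E U D"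

text \<open>What \<open>act\<close> and \<open>free_pairs\<close> leave out is subsumed by a shorter
  clause that is kept.\<close>

lemma leaf_clauses_models:
  "(\<forall>(a, b, c)\<in>leaf_clauses E U D. T a \<or> T b \<or> T c) \<longleftrightarrow> models E T U D"
proof
  assume h: "\<forall>(a, b, c)\<in>leaf_clauses E U D. T a \<or> T b \<or> T c"
  have u: "T a" if "a \<in> U" for a using h that unfolding leaf_clauses_def by fastforce
  have d: "T a \<or> T b" if "(a, b) \<in> D" for a b
    using h u that unfolding leaf_clauses_def free_pairs_def by fastforce
  have e: "T a \<or> T b \<or> T c" if "(a, b, c) \<in> E" for a b c
  proof (cases "(a, b, c) \<in> act E U D")
    case True
    then show ?thesis using h unfolding leaf_clauses_def by fastforce
  next
    case False
    then show ?thesis using that u d unfolding act_def by blast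
  qed
  show "models E T U D"
    unfolding models_def by (intro conjI) (auto dest: e d u)
next
  assume "models E T U D"
  then show "\<forall>(a, b, c)\<in>leaf_clauses E U D. T a \<or> T b \<or> T c"
    unfolding models_def leaf_clauses_def act_def free_pairs_def by auto
qed

section \<open>Branching on sunflowers\<close>

locale sparsification =
  fixes L \<theta>1 \<theta>2 \<theta>3 :: nat and E :: "(nat \<times> nat \<times> nat) set"
  assumes E_sub: "E \<subseteq> {..<L} \<times> {..<L} \<times> {..<L}"
    and E_swap12: "(a, b, c) \<in> E \<Longrightarrow> (b, a, c) \<in> E"
    and E_swap23: "(a, b, c) \<in> E \<Longrightarrow> (a, c, b) \<in> E"
begin

definition flower1 :: "nat set \<Rightarrow> (nat \<times> nat) set \<Rightarrow> nat \<Rightarrow> bool" where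
  "flower1 U D a \<longleftrightarrow> a < L \<and> a \<notin> U \<and> \<theta>1 \<le> card (nbr U D a)"

definition flower2 :: "nat set \<Rightarrow> (nat \<times> nat) set \<Rightarrow> nat \<Rightarrow> nat \<Rightarrow> bool" where
  "flower2 U D a b \<longleftrightarrow> a < L \<and> b < L \<and> \<theta>2 \<le> card {c. (a, b, c) \<in> act E U D}"

definition flower3 :: "nat set \<Rightarrow> (nat \<times> nat) set \<Rightarrow> nat \<Rightarrow> bool" where
  "flower3 U D a \<longleftrightarrow> a < L \<and> \<theta>3 \<le> card {(b, c). (a, b, c) \<in> act E U D}"

definition is_leaf :: "nat set \<Rightarrow> (nat \<times> nat) set \<Rightarrow> bool" where
  "is_leaf U D \<longleftrightarrow> (\<forall>a. \<not> flower1 U D a) \<and> (\<forall>a b. \<not> flower2 U D a b) \<and> (\<forall>a. \<not> flower3 U D a)"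

text \<open>The clauses counted by a flower share a heart, and either the heart holds or all petals
  do. The priority of the three kinds controls the degrees in \<open>D\<close>: pairs are added only
  when no literal has \<open>\<theta>1\<close> neighbours left, and the petals of the third kind
  give each literal at most \<open>\<theta>2\<close> new partners because no flower of the second
  kind exists.\<close>

definition branch :: "nat set \<Rightarrow> (nat \<times> nat) set \<Rightarrow> nat set \<Rightarrow> (nat \<times> nat) set \<Rightarrow> nat set \<Rightarrow> (nat \<times> nat) set \<Rightarrow> bool" where
  "branch U D U1 D1 U2 D2 \<longleftrightarrow>
     (\<exists>a. flower1 U D a \<and> U1 = insert a U \<and> D1 = D \<and> U2 = U \<union> nbr U D a \<and> D2 = D) \<or>
     (\<forall>a. \<not> flower1 U D a) \<and>
       (\<exists>a b. flower2 U D a b \<and> U1 = U \<and> D1 = D \<union> {(a, b), (b, a)} \<and>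
          U2 = U \<union> {c. (a, b, c) \<in> act E U D} \<and> D2 = D) \<or>
     (\<forall>a. \<not> flower1 U D a) \<and> (\<forall>a b. \<not> flower2 U D a b) \<and>
       (\<exists>a. flower3 U D a \<and> U1 = insert a U \<and> D1 = D \<and>
          U2 = U \<and> D2 = D \<union> {(b, c). (a, b, c) \<in> act E U D})"

lemma branch_models:
  assumes "branch U D U1 D1 U2 D2"
  shows "models E T U D \<longleftrightarrow> models E T U1 D1 \<or> models E T U2 D2"
proof -
  have mono: "models E T U' D' \<Longrightarrow> U \<subseteq> U' \<Longrightarrow> D \<subseteq> D' \<Longrightarrow> models E T U D" for U' D'
    unfolding models_def by blast
  have more: "models E T (U \<union> V) (D \<union> Q)"
    if "models E T U D" "\<And>a. a \<in> V \<Longrightarrow> T a" "\<And>a b. (a, b) \<in> Q \<Longrightarrow> T a \<or> T b" for V Q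
    using that unfolding models_def by blast
  have cl: "T a \<or> T b \<or> T c" if "models E T U D" "(a, b, c) \<in> act E U D" for a b c
    using that unfolding models_def act_def by blast
  have nb: "T a \<or> T b" if "models E T U D" "b \<in> nbr U D a" for a b
    using that unfolding models_def nbr_def by blast
  have "models E T U1 D1 \<or> models E T U2 D2" if m: "models E T U D"
    using assms unfolding branch_def
  proof (elim disjE conjE exE)
    fix a assume h: "U1 = insert a U" "D1 = D" "U2 = U \<union> nbr U D a" "D2 = D"
    show ?thesis
    proof (cases "T a")
      case True
      then show ?thesis using more[OF m, of "{a}" "{}"] h by simp
    next
      case False
      then show ?thesis using more[OF m, of "nbr U D a" "{}"] nb[OF m] h by auto
    qed
  next
    fix a b assume h: "U1 = U" "D1 = D \<union> {(a, b), (b, a)}" "U2 = U \<union> {c. (a, b, c) \<in> act E U D}" "D2 = D"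
    show ?thesis
    proof (cases "T a \<or> T b")
      case True
      then have "models E T (U \<union> {}) (D \<union> {(a, b), (b, a)})" by (intro more[OF m]) auto
      then show ?thesis using h by simp
    next
      case False
      then have "models E T (U \<union> {c. (a, b, c) \<in> act E U D}) (D \<union> {})" using cl[OF m] by (intro more[OF m]) auto
      then show ?thesis using h by simp
    qed
  next
    fix a assume h: "U1 = insert a U" "D1 = D" "U2 = U" "D2 = D \<union> {(b, c). (a, b, c) \<in> act E U D}"
    show ?thesis
    proof (cases "T a")
      case True
      then show ?thesis using more[OF m, of "{a}" "{}"] h by simp
    next
      case False
      then have "models E T (U \<union> {}) (D \<union> {(b, c). (a, b, c) \<in> act E U D})" using cl[OF m] by (intro more[OF m]) auto
      then show ?thesis using h by simp
    qed
  qed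
  moreover have "U \<subseteq> U1" "D \<subseteq> D1" "U \<subseteq> U2" "D \<subseteq> D2" using assms unfolding branch_def by auto
  ultimately show ?thesis using mono by blast
qed

section \<open>Degree bounds and the potential of a node\<close>

definition good :: "nat set \<Rightarrow> (nat \<times> nat) set \<Rightarrow> bool" where
  "good U D \<longleftrightarrow> U \<subseteq> {..<L} \<and> D \<subseteq> {..<L} \<times> {..<L} \<and> (\<forall>a b. (a, b) \<in> D \<longrightarrow> (b, a) \<in> D)"

definition slim :: "nat set \<Rightarrow> (nat \<times> nat) set \<Rightarrow> bool" where
  "slim U D \<longleftrightarrow> (\<forall>a. a \<notin> U \<longrightarrow> card (nbr U D a) \<le> \<theta>1 + \<theta>2)"

lemma act_sub: "act E U D \<subseteq> E"
  unfolding act_def by auto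

lemma act_lt: "(a, b, c) \<in> act E U D \<Longrightarrow> a < L \<and> b < L \<and> c < L"
  using act_sub E_sub by blast

lemma act_swap:
  assumes "good U D" "(a, b, c) \<in> act E U D"
  shows "(b, a, c) \<in> act E U D" "(a, c, b) \<in> act E U D"
proof -
  have "(b, a, c) \<in> E" "(a, c, b) \<in> E" using assms(2) act_sub E_swap12 E_swap23 by blast+
  then show "(b, a, c) \<in> act E U D" "(a, c, b) \<in> act E U D"
    using assms unfolding act_def good_def by blast+
qed

lemma finite_act1: "finite {c. (a, b, c) \<in> act E U D}"
  by (rule finite_subset[of _ "{..<L}"]) (use act_lt in auto)

lemma finite_act2: "finite {(b, c). (a, b, c) \<in> act E U D}"
  by (rule finite_subset[of _ "{..<L} \<times> {..<L}"]) (use act_lt in auto)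

lemma finite_nbr: "good U D \<Longrightarrow> finite (nbr U D a)"
  by (rule finite_subset[of _ "{..<L}"]) (auto simp: nbr_def good_def)

lemma finite_free_pairs: "good U D \<Longrightarrow> finite (free_pairs U D)"
  by (rule finite_subset[of _ "{..<L} \<times> {..<L}"]) (auto simp: free_pairs_def good_def)

lemma branch_good:
  assumes "good U D" "branch U D U1 D1 U2 D2"
  shows "good U1 D1" "good U2 D2"
proof -
  have sw: "(c, b) \<in> {(b, c). (a, b, c) \<in> act E U D}" if "(b, c) \<in> {(b, c). (a, b, c) \<in> act E U D}" for a b c
    using act_swap(2)[OF assms(1)] that by auto
  have lt: "{(b, c). (a, b, c) \<in> act E U D} \<subseteq> {..<L} \<times> {..<L}" "{c. (a, b, c) \<in> act E U D} \<subseteq> {..<L}" for a b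
    using act_lt by blast+
  have nb: "nbr U D a \<subseteq> {..<L}" for a using assms(1) unfolding nbr_def good_def by auto
  show "good U1 D1"
    using assms unfolding branch_def good_def flower1_def flower2_def flower3_def by auto
  show "good U2 D2"
    using assms(2) unfolding branch_def
  proof (elim disjE conjE exE)
    fix a assume "U2 = U \<union> nbr U D a" "D2 = D"
    then show ?thesis using assms(1) nb[of a] by (simp add: good_def)
  next
    fix a b assume "U2 = U \<union> {c. (a, b, c) \<in> act E U D}" "D2 = D"
    then show ?thesis using assms(1) lt(2)[of a b] by (simp add: good_def)
  next
    fix a assume h: "U2 = U" "D2 = D \<union> {(b, c). (a, b, c) \<in> act E U D}"
    show ?thesis using assms(1) lt(1)[of a] sw[of _ _ a] unfolding h good_def by blast
  qed
qed

lemma slim_more_units: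
  assumes "good U D" "slim U D" "U \<subseteq> U'"
  shows "slim U' D"
  unfolding slim_def
proof (intro allI impI)
  fix a assume "a \<notin> U'"
  then have "card (nbr U D a) \<le> \<theta>1 + \<theta>2" using assms unfolding slim_def by auto
  moreover have "card (nbr U' D a) \<le> card (nbr U D a)"
    by (rule card_mono[OF finite_nbr[OF assms(1)]]) (use assms(3) in \<open>auto simp: nbr_def\<close>)
  ultimately show "card (nbr U' D a) \<le> \<theta>1 + \<theta>2" by linarith
qed

lemma branch_slim:
  assumes g: "good U D" and s: "slim U D" and \<theta>: "1 \<le> \<theta>2" and b: "branch U D U1 D1 U2 D2"
  shows "slim U1 D1" "slim U2 D2"
proof -
  \<comment> \<open>Without a flower of the first kind all degrees are at most
    \<open>\<theta>1\<close>, and \<open>Q\<close> contributes at most \<open>\<theta>2\<close>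
    further neighbours. The other branches only add units, which lowers degrees.\<close>
  have add: "slim U (D \<union> Q)"
    if n1: "\<forall>a. \<not> flower1 U D a" and Q: "Q \<subseteq> {..<L} \<times> {..<L}"
      and q: "\<And>x. \<exists>V. finite V \<and> card V \<le> \<theta>2 \<and> {y. (x, y) \<in> Q} \<subseteq> V" for Q
    unfolding slim_def
  proof (intro allI impI)
    fix x assume x: "x \<notin> U"
    obtain V where V: "finite V" "card V \<le> \<theta>2" "{y. (x, y) \<in> Q} \<subseteq> V" using q by blast
    have "nbr U (D \<union> Q) x \<subseteq> nbr U D x \<union> V" using V(3) unfolding nbr_def by auto
    then have "card (nbr U (D \<union> Q) x) \<le> card (nbr U D x \<union> V)"
      by (rule card_mono[rotated]) (use V finite_nbr[OF g] in auto)
    also have "\<dots> \<le> card (nbr U D x) + card V" by (rule card_Un_le)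
    also have "card (nbr U D x) \<le> \<theta>1"
    proof (cases "x < L")
      case True
      then show ?thesis using n1 x unfolding flower1_def by (meson nat_le_linear)
    next
      case False
      then have "nbr U D x = {}" using g unfolding nbr_def good_def by auto
      then show ?thesis by simp
    qed
    finally show "card (nbr U (D \<union> Q) x) \<le> \<theta>1 + \<theta>2" using V(2) by linarith
  qed
  show "slim U1 D1"
    using b unfolding branch_def
  proof (elim disjE conjE exE)
    fix a assume "U1 = insert a U" "D1 = D"
    then show ?thesis using slim_more_units[OF g s] by auto
  next
    fix a assume "U1 = insert a U" "D1 = D"
    then show ?thesis using slim_more_units[OF g s] by auto
  next
    fix a c assume h: "\<forall>a. \<not> flower1 U D a" "flower2 U D a c" "U1 = U" "D1 = D \<union> {(a, c), (c, a)}"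
    have "\<exists>V. finite V \<and> card V \<le> \<theta>2 \<and> {y. (x, y) \<in> {(a, c), (c, a)}} \<subseteq> V" for x
      by (rule exI[of _ "{if x = a then c else a}"]) (use \<theta> in auto)
    moreover have "{(a, c), (c, a)} \<subseteq> {..<L} \<times> {..<L}" using h(2) by (auto simp: flower2_def)
    ultimately show ?thesis using add[OF h(1), of "{(a, c), (c, a)}"] unfolding h(3,4) by blast
  qed
  show "slim U2 D2"
    using b unfolding branch_def
  proof (elim disjE conjE exE)
    fix a assume "U2 = U \<union> nbr U D a" "D2 = D"
    then show ?thesis using slim_more_units[OF g s] by auto
  next
    fix a c assume "U2 = U \<union> {d. (a, c, d) \<in> act E U D}" "D2 = D"
    then show ?thesis using slim_more_units[OF g s] by auto
  next
    fix a assume h: "\<forall>a. \<not> flower1 U D a" "\<forall>a b. \<not> flower2 U D a b" "flower3 U D a"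
      "U2 = U" "D2 = D \<union> {(b, c). (a, b, c) \<in> act E U D}"
    have "\<exists>V. finite V \<and> card V \<le> \<theta>2 \<and> {y. (x, y) \<in> {(b, c). (a, b, c) \<in> act E U D}} \<subseteq> V" for x
    proof (cases "x < L")
      case True
      then have "card {y. (a, x, y) \<in> act E U D} \<le> \<theta>2"
        using h(2,3) unfolding flower2_def flower3_def by (meson nat_le_linear)
      then show ?thesis using finite_act1 by (intro exI[of _ "{y. (a, x, y) \<in> act E U D}"]) auto
    next
      case False
      then have "{y. (x, y) \<in> {(b, c). (a, b, c) \<in> act E U D}} = {}" using act_lt by auto
      then show ?thesis by (intro exI[of _ "{}"]) auto
    qed
    moreover have "{(b, c). (a, b, c) \<in> act E U D} \<subseteq> {..<L} \<times> {..<L}" using act_lt by auto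
    ultimately show ?thesis
      using add[OF h(1), of "{(b, c). (a, b, c) \<in> act E U D}"] unfolding h(4,5) by blast
  qed
qed

text \<open>
  An unassigned literal is worth three times the bound on its degree in \<open>D\<close>: adding a unit clause
  destroys at most twice this bound of ordered pairs, so that every branch lowers the potential.
\<close>

definition pot :: "nat set \<Rightarrow> (nat \<times> nat) set \<Rightarrow> real" where
  "pot U D = 3 * real (\<theta>1 + \<theta>2) * real (card ({..<L} - U)) - real (card (free_pairs U D))"

lemma pot_nonneg:
  assumes g: "good U D" and s: "slim U D"
  shows "0 \<le> pot U D"
proof -
  have "free_pairs U D \<subseteq> (SIGMA a:{..<L} - U. nbr U D a)"
    using g unfolding free_pairs_def nbr_def good_def by auto
  then have "card (free_pairs U D) \<le> card (SIGMA a:{..<L} - U. nbr U D a)"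
    by (rule card_mono[rotated]) (use finite_nbr[OF g] in auto)
  also have "\<dots> = (\<Sum>a\<in>{..<L} - U. card (nbr U D a))" by (rule card_SigmaI) (use finite_nbr[OF g] in auto)
  also have "\<dots> \<le> (\<Sum>a\<in>{..<L} - U. \<theta>1 + \<theta>2)" by (rule sum_mono) (use s in \<open>auto simp: slim_def\<close>)
  also have "\<dots> = (\<theta>1 + \<theta>2) * card ({..<L} - U)" by simp
  finally have "real (card (free_pairs U D)) \<le> real (\<theta>1 + \<theta>2) * real (card ({..<L} - U))"
    by (metis of_nat_le_iff of_nat_mult)
  moreover have "0 \<le> real (\<theta>1 + \<theta>2) * real (card ({..<L} - U))" by simp
  ultimately show ?thesis unfolding pot_def by linarith
qed

lemma pot_more_units:
  assumes g: "good U D" and s: "slim U D" and V: "V \<subseteq> {..<L}" "V \<inter> U = {}" "v \<le> card V"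
  shows "pot (U \<union> V) D \<le> pot U D - real (\<theta>1 + \<theta>2) * real v"
proof -
  have fV: "finite V" using V(1) finite_subset by blast
  have "free_pairs U D \<subseteq> free_pairs (U \<union> V) D \<union> (SIGMA a:V. nbr U D a) \<union> prod.swap ` (SIGMA a:V. nbr U D a)"
    using g unfolding free_pairs_def nbr_def good_def by (auto simp: image_iff)
  then have "card (free_pairs U D) \<le> card (free_pairs (U \<union> V) D \<union> (SIGMA a:V. nbr U D a) \<union> prod.swap ` (SIGMA a:V. nbr U D a))"
    by (rule card_mono[rotated])
      (use finite_nbr[OF g] fV finite_subset[OF _ finite_free_pairs[OF g], of "free_pairs (U \<union> V) D"]
        in \<open>auto simp: free_pairs_def\<close>)
  also have "\<dots> \<le> card (free_pairs (U \<union> V) D) + card (SIGMA a:V. nbr U D a) + card (prod.swap ` (SIGMA a:V. nbr U D a))"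
    by (intro order_trans[OF card_Un_le] add_mono card_Un_le order_refl)
  also have "card (prod.swap ` (SIGMA a:V. nbr U D a)) \<le> card (SIGMA a:V. nbr U D a)"
    by (rule card_image_le) (use finite_nbr[OF g] fV in auto)
  also have "card (SIGMA a:V. nbr U D a) = (\<Sum>a\<in>V. card (nbr U D a))"
    by (rule card_SigmaI) (use finite_nbr[OF g] fV in auto)
  also have "\<dots> \<le> (\<Sum>a\<in>V. \<theta>1 + \<theta>2)" by (rule sum_mono) (use s V(2) in \<open>auto simp: slim_def\<close>)
  also have "\<dots> = (\<theta>1 + \<theta>2) * card V" by simp
  finally have "card (free_pairs U D) \<le> card (free_pairs (U \<union> V) D) + 2 * ((\<theta>1 + \<theta>2) * card V)" by simp
  from of_nat_mono[OF this, where ?'a = real]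
  have p: "real (card (free_pairs U D)) \<le> real (card (free_pairs (U \<union> V) D)) + 2 * (real (\<theta>1 + \<theta>2) * real (card V))"
    by (simp only: of_nat_add of_nat_mult of_nat_numeral)
  have "{..<L} - (U \<union> V) = ({..<L} - U) - V" by auto
  moreover have "V \<subseteq> {..<L} - U" using V by auto
  ultimately have "card ({..<L} - U) = card ({..<L} - (U \<union> V)) + card V"
    using card_Diff_subset[OF fV, of "{..<L} - U"] card_mono[of "{..<L} - U" V] by simp
  then have c: "real (card ({..<L} - U)) = real (card ({..<L} - (U \<union> V))) + real (card V)" by simp
  have "real (\<theta>1 + \<theta>2) * real v \<le> real (\<theta>1 + \<theta>2) * real (card V)" using V(3) by (intro mult_left_mono) auto
  then show ?thesis using p unfolding pot_def c by (simp only: distrib_left)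
qed

lemma pot_more_pairs:
  assumes g: "good U D" and Q: "finite Q" "Q \<inter> D = {}" "\<And>a b. (a, b) \<in> Q \<Longrightarrow> a \<notin> U \<and> b \<notin> U"
    and v: "v \<le> card Q"
  shows "pot U (D \<union> Q) \<le> pot U D - real v"
proof -
  have "free_pairs U (D \<union> Q) = free_pairs U D \<union> Q" using Q(3) unfolding free_pairs_def by auto
  moreover have "card (free_pairs U D \<union> Q) = card (free_pairs U D) + card Q"
    by (rule card_Un_disjoint) (use finite_free_pairs[OF g] Q in \<open>auto simp: free_pairs_def\<close>)
  ultimately show ?thesis using v unfolding pot_def by simp
qed

text \<open>One alternative for each kind of flower: a new unit gains
  \<open>\<theta>1 + \<theta>2\<close>, a new ordered pair gains 1. The heart of the second kind is
  credited with a single pair, since its two literals may coincide.\<close>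

lemma branch_pot:
  assumes g: "good U D" and s: "slim U D" and b: "branch U D U1 D1 U2 D2"
    and \<theta>: "1 \<le> \<theta>1" "1 \<le> \<theta>2" "1 \<le> \<theta>3"
  shows "pot U1 D1 \<le> pot U D - real (\<theta>1 + \<theta>2) \<and> pot U2 D2 \<le> pot U D - real (\<theta>1 * (\<theta>1 + \<theta>2)) \<or>
    pot U1 D1 \<le> pot U D - real 1 \<and> pot U2 D2 \<le> pot U D - real (\<theta>2 * (\<theta>1 + \<theta>2)) \<or>
    pot U1 D1 \<le> pot U D - real (\<theta>1 + \<theta>2) \<and> pot U2 D2 \<le> pot U D - real \<theta>3"
  using b unfolding branch_def
proof (elim disjE conjE exE)
  fix a assume h: "flower1 U D a" "U1 = insert a U" "D1 = D" "U2 = U \<union> nbr U D a" "D2 = D"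
  have "pot U1 D1 \<le> pot U D - real (\<theta>1 + \<theta>2) * real 1"
    using pot_more_units[OF g s, of "{a}" 1] h by (auto simp: flower1_def)
  moreover have "pot U2 D2 \<le> pot U D - real (\<theta>1 + \<theta>2) * real \<theta>1"
    unfolding h by (rule pot_more_units[OF g s]) (use h(1) g in \<open>auto simp: flower1_def nbr_def good_def\<close>)
  ultimately show ?thesis by (auto simp: mult.commute)
next
  fix a c assume h: "flower2 U D a c" "U1 = U" "D1 = D \<union> {(a, c), (c, a)}"
    "U2 = U \<union> {d. (a, c, d) \<in> act E U D}" "D2 = D"
  have "{d. (a, c, d) \<in> act E U D} \<noteq> {}" using h(1) \<theta> unfolding flower2_def
    by (metis card.empty not_one_le_zero order_trans)
  then obtain d where d: "(a, c, d) \<in> act E U D" by auto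
  \<comment> \<open>The heart lies in an active clause, which no present pair subsumes; hence it is
    really new.\<close>
  have "(c, a) \<notin> D" "(a, c) \<notin> D" using d g unfolding act_def good_def by auto
  moreover have "card {(a, c), (c, a)} \<ge> 1" by (simp add: Suc_leI card_gt_0_iff)
  ultimately have "pot U1 D1 \<le> pot U D - real 1"
    unfolding h by (intro pot_more_pairs[OF g]) (use d in \<open>auto simp: act_def\<close>)
  moreover have "pot U2 D2 \<le> pot U D - real (\<theta>1 + \<theta>2) * real \<theta>2"
    unfolding h by (rule pot_more_units[OF g s])
      (use h(1) act_lt in \<open>auto simp: flower2_def act_def\<close>)
  ultimately show ?thesis by (auto simp: mult.commute)
next
  fix a assume h: "flower3 U D a" "U1 = insert a U" "D1 = D"
    "U2 = U" "D2 = D \<union> {(b, c). (a, b, c) \<in> act E U D}"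
  have "{(b, c). (a, b, c) \<in> act E U D} \<noteq> {}" using h(1) \<theta> unfolding flower3_def
    by (metis card.empty not_one_le_zero order_trans)
  then have "a \<notin> U" "a < L" using act_lt by (auto simp: act_def)
  then have "pot U1 D1 \<le> pot U D - real (\<theta>1 + \<theta>2) * real 1"
    using pot_more_units[OF g s, of "{a}" 1] h by auto
  moreover have "pot U2 D2 \<le> pot U D - real \<theta>3"
    unfolding h by (rule pot_more_pairs[OF g finite_act2]) (use h(1) in \<open>auto simp: flower3_def act_def\<close>)
  ultimately show ?thesis by auto
qed

text \<open>A binary tree with l leaves has 2 l - 1 nodes, and \<open>x powr pot U D\<close> serves
  as the bound on the leaves below a node.\<close>

definition weight :: "real \<Rightarrow> nat set \<Rightarrow> (nat \<times> nat) set \<Rightarrow> real" where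
  "weight x U D = 2 * x powr pot U D - 1"

lemma weight_ge_1:
  assumes "good U D" "slim U D" "1 \<le> x"
  shows "1 \<le> weight x U D"
  using pot_nonneg[OF assms(1,2)] assms(3) ge_one_powr_ge_zero[of x] unfolding weight_def by force

text \<open>If the potential drops by d1 and d2, the two children together have at most
  \<open>1 / x ^ d1 + 1 / x ^ d2\<close> times the leaf bound of their parent. The three conditions
  say that \<open>x\<close> dominates the three branching vectors; the summand 1 pays for the parent
  itself.\<close>

lemma branch_weight:
  assumes g: "good U D" and s: "slim U D" and b: "branch U D U1 D1 U2 D2"
    and \<theta>: "1 \<le> \<theta>1" "1 \<le> \<theta>2" "1 \<le> \<theta>3" and x: "1 \<le> x"
    and x1: "1 / x ^ (\<theta>1 + \<theta>2) + 1 / x ^ (\<theta>1 * (\<theta>1 + \<theta>2)) \<le> 1"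
    and x2: "1 / x ^ 1 + 1 / x ^ (\<theta>2 * (\<theta>1 + \<theta>2)) \<le> 1"
    and x3: "1 / x ^ (\<theta>1 + \<theta>2) + 1 / x ^ \<theta>3 \<le> 1"
  shows "weight x U1 D1 + weight x U2 D2 + 1 \<le> weight x U D"
proof -
  have main: ?thesis
    if d: "pot U1 D1 \<le> pot U D - real d1 \<and> pot U2 D2 \<le> pot U D - real d2"
      and le: "1 / x ^ d1 + 1 / x ^ d2 \<le> 1" for d1 d2
  proof -
    have "x powr pot U1 D1 \<le> x powr (pot U D - real d1)" "x powr pot U2 D2 \<le> x powr (pot U D - real d2)"
      using d x by (auto intro: powr_mono)
    then have "x powr pot U1 D1 + x powr pot U2 D2 \<le> x powr pot U D * (1 / x ^ d1 + 1 / x ^ d2)"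
      using x by (simp add: powr_diff powr_realpow distrib_left)
    also have "\<dots> \<le> x powr pot U D * 1" by (rule mult_left_mono[OF le]) simp
    finally show ?thesis unfolding weight_def by simp
  qed
  show ?thesis
    using branch_pot[OF g s b \<theta>] main[OF _ x1] main[OF _ x2] main[OF _ x3] by blast
qed

text \<open>The bound collects one unit clause, \<open>\<theta>1\<close> pairs with the literal at
  either end, and \<open>\<theta>3\<close> triples for each of the three positions. Symmetry carries
  every position to the first.\<close>

lemma leaf_occurrences:
  assumes g: "good U D" and lf: "is_leaf U D" and l: "l < L"
  shows "card {(a, b, c). (a, b, c) \<in> leaf_clauses E U D \<and> (a = l \<or> b = l \<or> c = l)} \<le> 1 + 2 * \<theta>1 + 3 * \<theta>3"
proof -
  let ?A = "{(b, c). (l, b, c) \<in> act E U D}"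
  let ?N = "if l \<in> U then {} else nbr U D l"
  let ?S = "{(l, l, l)} \<union> (\<lambda>b. (l, b, b)) ` ?N \<union> (\<lambda>b. (b, l, l)) ` ?N \<union>
     (\<lambda>(b, c). (l, b, c)) ` ?A \<union> (\<lambda>(b, c). (b, l, c)) ` ?A \<union> (\<lambda>(b, c). (b, c, l)) ` ?A"
  have A: "card ?A \<le> \<theta>3" using lf l unfolding is_leaf_def flower3_def by (meson nat_le_linear)
  have N: "card ?N \<le> \<theta>1"
    using lf l unfolding is_leaf_def flower1_def by (cases "l \<in> U") (auto simp: not_le intro: less_imp_le)
  have fN: "finite ?N" using finite_nbr[OF g] by simp
  have sub: "{(a, b, c). (a, b, c) \<in> leaf_clauses E U D \<and> (a = l \<or> b = l \<or> c = l)} \<subseteq> ?S"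
  proof
    fix t assume "t \<in> {(a, b, c). (a, b, c) \<in> leaf_clauses E U D \<and> (a = l \<or> b = l \<or> c = l)}"
    then obtain a b c where t: "t = (a, b, c)" and m: "(a, b, c) \<in> leaf_clauses E U D"
      and h: "a = l \<or> b = l \<or> c = l" by blast
    consider "a = b" "b = c" | "c = b" "(a, b) \<in> free_pairs U D" | "(a, b, c) \<in> act E U D"
      using m by (auto simp: leaf_clauses_def)
    then show "t \<in> ?S"
    proof cases
      case 1
      then show ?thesis using h t by auto
    next
      case 2
      then have "(a, b) \<in> D" "(b, a) \<in> D" "a \<notin> U" "b \<notin> U" using g by (auto simp: free_pairs_def good_def)
      then show ?thesis using h t 2(1) by (auto simp: nbr_def)
    next
      case 3
      have "(b, a, c) \<in> act E U D" "(c, a, b) \<in> act E U D"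
        using act_swap[OF g] 3 by blast+
      then show ?thesis using h t 3 by (auto simp: image_iff)
    qed
  qed
  have "card {(a, b, c). (a, b, c) \<in> leaf_clauses E U D \<and> (a = l \<or> b = l \<or> c = l)} \<le> card ?S"
    by (rule card_mono[OF _ sub]) (use fN finite_act2 in auto)
  also have "\<dots> \<le> card {(l, l, l)} + card ((\<lambda>b. (l, b, b)) ` ?N) + card ((\<lambda>b. (b, l, l)) ` ?N) +
     card ((\<lambda>(b, c). (l, b, c)) ` ?A) + card ((\<lambda>(b, c). (b, l, c)) ` ?A) + card ((\<lambda>(b, c). (b, c, l)) ` ?A)"
    by (intro order_trans[OF card_Un_le] add_mono order_refl)
  also have "\<dots> \<le> 1 + card ?N + card ?N + card ?A + card ?A + card ?A"
    by (intro add_mono card_image_le fN finite_act2) auto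
  also have "\<dots> \<le> 1 + 2 * \<theta>1 + 3 * \<theta>3" using A N by linarith
  finally show ?thesis .
qed

end

text \<open>With \<theta>1 = q^2, \<theta>2 = q^3 and \<theta>3 = q^2 \<beta>, the first inequality
  covers the first and third kind of flower and the second one covers the second kind. By Bernoulli,
  \<open>x ^ (q * \<beta>)\<close> is at least 2, so the large exponents beat the losses 1 / (q + 1)
  and 1 / (q \<beta> + 1) of the small ones. On the other hand x^(6 \<beta> N) is at most exp (6 N /
  q), so a large \<open>q\<close> makes the tree as small as desired.\<close>

lemma thresholds:
  fixes q :: nat
  assumes q: "5 \<le> q" and \<beta>: "\<beta> = q ^ 2 + q ^ 3" and x: "x = 1 + 1 / real (q * \<beta>)"
  shows "1 / x ^ \<beta> + 1 / x ^ (q ^ 2 * \<beta>) \<le> 1" "1 / x ^ 1 + 1 / x ^ (q ^ 3 * \<beta>) \<le> 1"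
proof -
  have \<beta>1: "1 \<le> \<beta>" using q unfolding \<beta> by (simp add: Suc_leI)
  have x1: "1 < x" using q \<beta>1 unfolding x by simp
  have bern: "1 + real n / real (q * \<beta>) \<le> x ^ n" for n
  proof -
    have "- 1 \<le> 1 / real (q * \<beta>)" by (rule order_trans[of _ 0]) auto
    then show ?thesis using Bernoulli_inequality[of "1 / real (q * \<beta>)" n] unfolding x by simp
  qed
  have "1 + 1 / real q = 1 + real \<beta> / real (q * \<beta>)" using q \<beta>1 by simp
  then have xb: "1 + 1 / real q \<le> x ^ \<beta>" using bern[of \<beta>] by simp
  have two: "2 \<le> x ^ (q * \<beta>)" using bern[of "q * \<beta>"] q \<beta>1 by simp
  have p2: "2 ^ m \<le> x ^ (m * (q * \<beta>))" for m
    using power_mono[OF two, of m] by (simp add: power_mult[symmetric] mult.commute)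
  have q2: "real q + 1 \<le> 2 ^ q" 
    by (metis Suc_leI less_exp of_nat_Suc of_nat_le_iff of_nat_numeral of_nat_power add.commute)
  have big: "real q + 1 \<le> x ^ (q ^ 2 * \<beta>)"
    using p2[of q] q2 by (simp add: power2_eq_square mult.assoc)
  have half: "1 / x ^ \<beta> \<le> real q / (real q + 1)"
  proof -
    have "1 / x ^ \<beta> \<le> 1 / (1 + 1 / real q)" using xb q x1 by (intro divide_left_mono mult_pos_pos) (auto intro: add_pos_nonneg)
    also have "\<dots> = real q / (real q + 1)" using q by (simp add: field_simps)
    finally show ?thesis .
  qed
  have "1 / x ^ (q ^ 2 * \<beta>) \<le> 1 / (real q + 1)" using big by (intro divide_left_mono) auto
  then have "1 / x ^ \<beta> + 1 / x ^ (q ^ 2 * \<beta>) \<le> real q / (real q + 1) + 1 / (real q + 1)" using half by (rule add_mono[rotated])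
  also have "\<dots> = 1" by (simp add: add_divide_distrib[symmetric])
  finally show "1 / x ^ \<beta> + 1 / x ^ (q ^ 2 * \<beta>) \<le> 1" .
  have "real (q * \<beta>) + 1 \<le> (real q + 1) ^ 5"
  proof -
    have "q * \<beta> + 1 \<le> (q + 1) ^ 5" unfolding \<beta> by (simp add: eval_nat_numeral algebra_simps)
    then have "real (q * \<beta> + 1) \<le> real ((q + 1) ^ 5)" by (rule of_nat_mono)
    then show ?thesis by (simp add: add.commute)
  qed
  \<comment> \<open>The least admissible \<open>q\<close> is the degree of the preceding polynomial
    bound on \<open>q * \<beta> + 1\<close>.\<close>
  also have "\<dots> \<le> (real q + 1) ^ q" using q by (intro power_increasing) auto
  also have "\<dots> \<le> (2 ^ q) ^ q" using q2 by (intro power_mono) auto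
  also have "\<dots> = 2 ^ (q ^ 2)" by (simp add: power_mult[symmetric] power2_eq_square)
  also have "\<dots> \<le> x ^ (q ^ 2 * (q * \<beta>))" by (rule p2)
  also have "q ^ 2 * (q * \<beta>) = q ^ 3 * \<beta>" by (simp add: eval_nat_numeral)
  finally have "1 / x ^ (q ^ 3 * \<beta>) \<le> 1 / (real (q * \<beta>) + 1)"
    using x1 by (intro divide_left_mono mult_pos_pos) (auto intro: add_nonneg_pos)
  moreover have "1 / x ^ 1 = real (q * \<beta>) / (real (q * \<beta>) + 1)"
    using q \<beta>1 unfolding x by (simp add: field_simps)
  ultimately have "1 / x ^ 1 + 1 / x ^ (q ^ 3 * \<beta>) \<le> real (q * \<beta>) / (real (q * \<beta>) + 1) + 1 / (real (q * \<beta>) + 1)" by simp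
  also have "\<dots> = 1"
  proof -
    have "real (q * \<beta>) + 1 \<noteq> 0" by (metis of_nat_Suc of_nat_eq_0_iff nat.distinct(1) add.commute)
    then show ?thesis unfolding add_divide_distrib[symmetric] by (rule divide_self)
  qed
  finally show "1 / x ^ 1 + 1 / x ^ (q ^ 3 * \<beta>) \<le> 1" .
qed

section \<open>From sparse formulas to Dominating Set\<close>

text \<open>The literal \<open>2 v + 1\<close> is the variable \<open>v\<close>, and \<open>2 v\<close> its negation.\<close>

definition holds :: "(nat \<Rightarrow> bool) \<Rightarrow> nat \<Rightarrow> bool" where
  "holds \<alpha> l \<longleftrightarrow> \<alpha> (l div 2) = odd l"

text \<open>Bit \<open>p\<close> of \<open>\<beta>\<close> is the value of variable
  \<open>i * s + p\<close>. A literal over another block never holds, so an assignment vertex sees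
  only the literals of its own block.\<close>

definition block_holds :: "nat \<Rightarrow> nat \<Rightarrow> nat \<Rightarrow> nat \<Rightarrow> bool" where
  "block_holds s i \<beta> l \<longleftrightarrow> (\<exists>p<s. l div 2 = i * s + p \<and> odd l = odd (\<beta> div 2 ^ p))"

text \<open>
  The variables are split into \<open>k\<close> blocks of length \<open>s\<close>. Vertex 0 is the hub, \<open>blk i\<close> forces a choice
  among the vertices \<open>asg i \<beta>\<close> standing for the assignments \<open>\<beta>\<close> of block \<open>i\<close>, and \<open>cls a b c\<close> stands
  for a possible clause. The remaining vertices are pendant at the hub: they force the hub into the
  solution and raise the number of vertices.
\<close>

locale ds_graph =
  fixes N k s n :: nat and K :: "(nat \<times> nat \<times> nat) set"
  assumes K_sub: "K \<subseteq> {..<2 * N} \<times> {..<2 * N} \<times> {..<2 * N}"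
    and blocks: "N \<le> k * s"
    and n_large: "2 + k + k * 2 ^ s + (2 * N) * ((2 * N) * (2 * N)) \<le> n"
begin

definition blk :: "nat \<Rightarrow> nat" where "blk i = 1 + i"
definition asg :: "nat \<Rightarrow> nat \<Rightarrow> nat" where "asg i \<beta> = 1 + k + i * 2 ^ s + \<beta>"
text \<open>All triples of literals are numbered, clauses or not, so that the number is given by
  arithmetic and the numbering is the same for all leaves. The numbers of absent triples become
  pendant vertices.\<close>

definition cls :: "nat \<Rightarrow> nat \<Rightarrow> nat \<Rightarrow> nat" where
  "cls a b c = 1 + k + k * 2 ^ s + ((2 * N) * ((2 * N) * a + b) + c)"

definition present :: "nat \<Rightarrow> bool" where
  "present v \<longleftrightarrow> (\<exists>a b c. (a, b, c) \<in> K \<and> v = cls a b c)"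

text \<open>Each edge is oriented towards its larger end. The hub is also joined to all assignment
  vertices, so that those not chosen are dominated.\<close>

definition arc :: "nat \<Rightarrow> nat \<Rightarrow> bool" where
  "arc u v \<longleftrightarrow> u = 0 \<and> k < v \<and> v < n \<and> \<not> present v \<or>
     (\<exists>i<k. \<exists>\<beta><2 ^ s. u = blk i \<and> v = asg i \<beta>) \<or>
     (\<exists>i<k. \<exists>\<beta><2 ^ s. u = asg i \<beta> \<and> (\<exists>a b c. (a, b, c) \<in> K \<and> v = cls a b c \<and>
        (block_holds s i \<beta> a \<or> block_holds s i \<beta> b \<or> block_holds s i \<beta> c)))"

definition edges :: "nat set set" where
  "edges = {{u, v} | u v. arc u v}"

lemma asg_lt:
  assumes "i < k" "\<beta> < 2 ^ s"
  shows "k < asg i \<beta>" "asg i \<beta> < 1 + k + k * 2 ^ s"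
proof -
  have "i * 2 ^ s + \<beta> < (i + 1) * 2 ^ s" using assms(2) by simp
  also have "\<dots> \<le> k * 2 ^ s" using assms(1) by (intro mult_le_mono1) auto
  finally show "asg i \<beta> < 1 + k + k * 2 ^ s" unfolding asg_def by simp
qed (simp add: asg_def)

lemma asg_inject:
  assumes "asg i \<beta> = asg i' \<beta>'" "\<beta> < 2 ^ s" "\<beta>' < 2 ^ s"
  shows "i = i' \<and> \<beta> = \<beta>'"
proof -
  have e: "i * 2 ^ s + \<beta> = i' * 2 ^ s + \<beta>'" using assms(1) by (simp add: asg_def)
  have "(i * 2 ^ s + \<beta>) div 2 ^ s = i" "(i' * 2 ^ s + \<beta>') div 2 ^ s = i'" using assms(2,3) by auto
  with e have "i = i'" by simp
  with e show ?thesis by simp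
qed

lemma cls_lt:
  assumes "(a, b, c) \<in> K"
  shows "k + k * 2 ^ s < cls a b c" "cls a b c < n - 1"
proof -
  let ?L = "2 * N"
  have h: "a < ?L" "b < ?L" "c < ?L" using assms K_sub by auto
  have "?L * a + b < ?L * (a + 1)" using h by simp
  also have "\<dots> \<le> ?L * ?L" using h by (intro mult_le_mono2) auto
  finally have "?L * a + b + 1 \<le> ?L * ?L" by simp
  then have "?L * (?L * a + b + 1) \<le> ?L * (?L * ?L)" by (rule mult_le_mono2)
  then have "?L * (?L * a + b) + c < ?L * (?L * ?L)" using h(3) unfolding distrib_left by linarith
  then show "cls a b c < n - 1" using n_large unfolding cls_def by linarith
qed (simp add: cls_def)

lemma cls_inject:
  assumes "cls a b c = cls a' b' c'" "(a, b, c) \<in> K" "(a', b', c') \<in> K"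
  shows "a = a' \<and> b = b' \<and> c = c'"
proof -
  let ?L = "2 * N"
  have h: "b < ?L" "c < ?L" "b' < ?L" "c' < ?L" using assms K_sub by auto
  have e: "?L * (?L * a + b) + c = ?L * (?L * a' + b') + c'" using assms(1) unfolding cls_def by linarith
  have "(?L * (?L * a + b) + c) div ?L = ?L * a + b" "(?L * (?L * a' + b') + c') div ?L = ?L * a' + b'"
    using h by (simp_all only: div_mult_self4 div_less add.right_neutral)
  with e have e2: "?L * a + b = ?L * a' + b'" by simp
  with e have c: "c = c'" by simp
  have "(?L * a + b) div ?L = a" "(?L * a' + b') div ?L = a'" using h by auto
  with e2 have "a = a'" by simp
  with e2 c show ?thesis by simp
qed

lemma arc_lt: "arc u v \<Longrightarrow> u < v \<and> v < n"
proof -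
  assume h: "arc u v"
  have 1: "u < v \<and> v < n" if "i < k" "\<beta> < 2 ^ s" "u = blk i" "v = asg i \<beta>" for i \<beta>
    using asg_lt[OF that(1,2)] that n_large by (simp add: blk_def)
  have 2: "u < v \<and> v < n" if "i < k" "\<beta> < 2 ^ s" "u = asg i \<beta>" "(a, b, c) \<in> K" "v = cls a b c" for i \<beta> a b c
    using asg_lt[OF that(1,2)] that(3-) cls_lt[OF that(4)] by simp
  show ?thesis using h unfolding arc_def
  proof (elim disjE)
    assume "u = 0 \<and> k < v \<and> v < n \<and> \<not> present v" then show ?thesis by auto
  qed (use 1 2 in blast)+
qed

lemma arc_cases:
  assumes "arc u v"
  obtains (hub) "u = 0" "k < v" "v < n" "\<not> present v"
    | (blk) i \<beta> where "i < k" "\<beta> < 2 ^ s" "u = blk i" "v = asg i \<beta>"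
    | (asg) i \<beta> a b c where "i < k" "\<beta> < 2 ^ s" "u = asg i \<beta>" "(a, b, c) \<in> K" "v = cls a b c"
        "block_holds s i \<beta> a \<or> block_holds s i \<beta> b \<or> block_holds s i \<beta> c"
  using assms unfolding arc_def by blast

lemma edge_iff: "{u, v} \<in> edges \<longleftrightarrow> arc u v \<or> arc v u"
  unfolding edges_def by (auto simp: doubleton_eq_iff)

lemma simple_graph_edges: "simple_graph {..<n} edges"
  unfolding simple_graph_def edges_def
proof (intro conjI ballI)
  fix e assume "e \<in> {{u, v} | u v. arc u v}"
  then obtain u v where e: "e = {u, v}" "arc u v" by blast
  with arc_lt[of u v] show "e \<subseteq> {..<n}" "card e = 2" by auto
qed simp

lemma no_arc_to_hub_or_blk: "v \<le> k \<Longrightarrow> \<not> arc u v"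
proof
  assume v: "v \<le> k" and "arc u v"
  from this(2) show False
  proof (cases rule: arc_cases)
    case (blk i \<beta>)
    then show ?thesis using asg_lt(1)[of i \<beta>] v by simp
  next
    case (asg i \<beta> a b c)
    then show ?thesis using cls_lt(1)[of a b c] v by simp
  qed (use v in simp)
qed

lemma hub_arc: "arc 0 v \<longleftrightarrow> k < v \<and> v < n \<and> \<not> present v"
  unfolding arc_def blk_def asg_def by auto

lemma blk_arc: "i < k \<Longrightarrow> arc (blk i) v \<longleftrightarrow> (\<exists>\<beta><2 ^ s. v = asg i \<beta>)"
  unfolding arc_def using asg_lt(1) by (auto simp: blk_def) (metis Suc_leI not_le asg_def add.assoc add_leD1 plus_1_eq_Suc)+

lemma asg_arc:
  assumes "i < k" "\<beta> < 2 ^ s"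
  shows "arc (asg i \<beta>) v \<longleftrightarrow> (\<exists>a b c. (a, b, c) \<in> K \<and> v = cls a b c \<and>
        (block_holds s i \<beta> a \<or> block_holds s i \<beta> b \<or> block_holds s i \<beta> c))"
proof -
  have "asg i \<beta> \<noteq> 0" "\<And>j. j < k \<Longrightarrow> asg i \<beta> \<noteq> blk j" using asg_lt(1)[OF assms] by (auto simp: blk_def)
  then show ?thesis unfolding arc_def using asg_inject assms by blast
qed

lemma arc_to_asg:
  assumes "i < k" "\<beta> < 2 ^ s" "arc u (asg i \<beta>)"
  shows "u = 0 \<or> u = blk i"
  using assms(3)
proof (cases rule: arc_cases)
  case (blk j \<gamma>)
  then show ?thesis using asg_inject[of i \<beta> j \<gamma>] assms(2) by auto
next
  case (asg j \<gamma> a b c)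
  then show ?thesis using asg_lt[OF assms(1,2)] cls_lt(1)[of a b c] by simp
qed simp

lemma arc_to_cls:
  assumes "(a, b, c) \<in> K" "arc u (cls a b c)"
  shows "\<exists>i<k. \<exists>\<beta><2 ^ s. u = asg i \<beta> \<and> (block_holds s i \<beta> a \<or> block_holds s i \<beta> b \<or> block_holds s i \<beta> c)"
  using assms(2)
proof (cases rule: arc_cases)
  case hub
  then show ?thesis using assms(1) unfolding present_def by blast
next
  case (blk i \<beta>)
  then show ?thesis using asg_lt[of i \<beta>] cls_lt(1)[OF assms(1)] by simp
next
  case (asg i \<beta> a' b' c')
  then show ?thesis using cls_inject[OF _ assms(1) asg(4)] by blast
qed

lemma no_arc_from_cls:
  assumes "(a, b, c) \<in> K"
  shows "\<not> arc (cls a b c) v"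
proof
  assume "arc (cls a b c) v"
  then show False using cls_lt(1)[OF assms] asg_lt(2) unfolding arc_def blk_def
    by (auto simp: not_less[symmetric]) (metis add.commute add.left_commute less_Suc_eq_le not_le plus_1_eq_Suc)+
qed

lemma pendant:
  shows "arc u (n - 1) \<Longrightarrow> u = 0" "\<not> arc (n - 1) v"
proof -
  have lt: "asg i \<beta> < n - 1" if "i < k" "\<beta> < 2 ^ s" for i \<beta> using asg_lt(2)[OF that] n_large by linarith
  show "u = 0" if "arc u (n - 1)"
    using that
  proof (cases rule: arc_cases)
    case (blk i \<beta>)
    then show ?thesis using lt[of i \<beta>] by simp
  next
    case (asg i \<beta> a b c)
    then show ?thesis using cls_lt(2)[of a b c] by simp
  qed simp
  show "\<not> arc (n - 1) v" using arc_lt[of "n - 1" v] by auto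
qed

text \<open>The closed neighbourhoods of the \<open>k\<close> block vertices and of the pendant
  vertex \<open>n - 1\<close> are pairwise disjoint, and each of them is hit. So
  \<open>k + 1\<close> vertices contain exactly one from each and nothing else. In particular no
  clause vertex is chosen, and each must be dominated by the unique assignment chosen in some
  block.\<close>

lemma dominating_set_imp_satisfiable:
  assumes S: "card S \<le> k + 1" "dominating_set {..<n} edges S"
  shows "\<exists>\<alpha>. \<forall>(a, b, c)\<in>K. holds \<alpha> a \<or> holds \<alpha> b \<or> holds \<alpha> c"
proof -
  have n1: "1 \<le> n" "k < n - 1" using n_large by auto
  have Ssub: "S \<subseteq> {..<n}" and dom: "\<And>v. v < n \<Longrightarrow> v \<in> S \<or> (\<exists>u\<in>S. arc u v \<or> arc v u)"
    using S(2) unfolding dominating_set_def by (auto simp: edge_iff)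
  have finS: "finite S" using Ssub finite_subset by blast
  define block where "block i = (if i < k then insert (blk i) (asg i ` {..<2 ^ s}) else {0, n - 1})" for i
  have hit: "\<exists>v\<in>S. v \<in> block i" for i
  proof (cases "i < k")
    case True
    then have "blk i < n" using n1 by (simp add: blk_def)
    from dom[OF this] show ?thesis
      using blk_arc[OF True] no_arc_to_hub_or_blk[of "blk i"] True by (auto simp: block_def blk_def)
  next
    case False
    have "n - 1 < n" using n1 by simp
    from dom[OF this] show ?thesis using pendant False by (auto simp: block_def)
  qed
  then obtain pick where pick: "\<And>i. pick i \<in> S" "\<And>i. pick i \<in> block i" by metis
  have asgn: "asg i \<beta> < n - 1" if "i < k" "\<beta> < 2 ^ s" for i \<beta> using asg_lt(2)[OF that] n_large by linarith
  have disj: "i = j" if "v \<in> block i" "v \<in> block j" "i \<le> k" "j \<le> k" for i j v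
  proof -
    have kk: "i = k" if "\<not> i < k" "i \<le> k" for i using that by simp
    have 1: "blk i \<noteq> asg j \<beta>" if "i < k" "j < k" "\<beta> < 2 ^ s" for i j \<beta> using asg_lt(1)[OF that(2,3)] that by (simp add: blk_def)
    have 2: "v \<noteq> 0 \<and> v \<noteq> n - 1" if "v \<in> block i" "i < k" for v i
      using that asg_lt(1)[of i] asgn[of i] n1 by (fastforce simp: block_def blk_def)
    show ?thesis
    proof (cases "i < k"; cases "j < k")
      assume ij: "i < k" "j < k"
      have form: "v = blk i \<or> (\<exists>\<beta><2 ^ s. v = asg i \<beta>)" if "v \<in> block i" "i < k" for i
        using that by (auto simp: block_def)
      from form[OF that(1) ij(1)] form[OF that(2) ij(2)] show ?thesis
      proof (elim disjE exE conjE)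
        assume "v = blk i" "v = blk j" then show ?thesis by (simp add: blk_def)
      next
        fix \<beta> assume "v = blk i" "\<beta> < 2 ^ s" "v = asg j \<beta>" then show ?thesis using 1 ij by metis
      next
        fix \<beta> assume "v = blk j" "\<beta> < 2 ^ s" "v = asg i \<beta>" then show ?thesis using 1 ij by metis
      next
        fix \<beta> \<gamma> assume "\<beta> < 2 ^ s" "v = asg i \<beta>" "\<gamma> < 2 ^ s" "v = asg j \<gamma>"
        then show ?thesis using asg_inject by metis
      qed
    next
      assume "i < k" "\<not> j < k" then show ?thesis using 2[of v i] that by (auto simp: block_def)
    next
      assume "\<not> i < k" "j < k" then show ?thesis using 2[of v j] that by (auto simp: block_def)
    next
      assume "\<not> i < k" "\<not> j < k" then show ?thesis using that by auto
    qed
  qed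
  have "inj_on pick {..k}" by (rule inj_onI) (use disj pick in \<open>metis atMost_iff\<close>)
  then have "card (pick ` {..k}) = k + 1" by (simp add: card_image)
  then have Seq: "S = pick ` {..k}"
    using card_seteq[OF finS, of "pick ` {..k}"] S(1) pick(1) by auto
  have uniq: "v = w" if vw: "v \<in> S" "w \<in> S" "v \<in> block i" "w \<in> block i" "i \<le> k" for v w i
  proof -
    obtain i1 i2 where "v = pick i1" "i1 \<le> k" "w = pick i2" "i2 \<le> k" using vw Seq by auto
    then show ?thesis using disj[of v i1 i] disj[of w i2 i] pick(2) vw by auto
  qed
  \<comment> \<open>A block that is hit in its block vertex has no chosen assignment and gets the
    default value false; it dominates no clause vertex, so its values are irrelevant.\<close>
  define \<alpha> where "\<alpha> x \<longleftrightarrow> (\<exists>\<beta><2 ^ s. asg (x div s) \<beta> \<in> S \<and> odd (\<beta> div 2 ^ (x mod s)))" for x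
  have key: "holds \<alpha> l" if i: "i < k" and \<beta>: "\<beta> < 2 ^ s" "asg i \<beta> \<in> S" and l: "block_holds s i \<beta> l" for i \<beta> l
  proof -
    obtain p where p: "p < s" "l div 2 = i * s + p" "odd l = odd (\<beta> div 2 ^ p)" using l by (auto simp: block_holds_def)
    have dm: "(l div 2) div s = i" "(l div 2) mod s = p" unfolding p(2) using p(1) by auto
    have only: "\<gamma> = \<beta>" if "\<gamma> < 2 ^ s" "asg i \<gamma> \<in> S" for \<gamma>
    proof -
      have "asg i \<gamma> = asg i \<beta>" by (rule uniq[of _ _ i]) (use that \<beta> i in \<open>auto simp: block_def\<close>)
      then show ?thesis using asg_inject[of i \<gamma> i \<beta>] that \<beta> by auto
    qed
    have "\<alpha> (l div 2) \<longleftrightarrow> odd (\<beta> div 2 ^ p)" unfolding \<alpha>_def dm using \<beta> only by blast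
    then show ?thesis unfolding holds_def p(3) by simp
  qed
  have "holds \<alpha> a \<or> holds \<alpha> b \<or> holds \<alpha> c" if K: "(a, b, c) \<in> K" for a b c
  proof -
    have "cls a b c < n" using cls_lt(2)[OF K] by simp
    moreover have "cls a b c \<notin> S"
    proof
      assume "cls a b c \<in> S"
      then obtain i where i: "i \<le> k" "cls a b c \<in> block i" using Seq pick(2) by auto
      show False using i cls_lt[OF K] asg_lt(2)[of i]
        by (cases "i < k") (auto simp: block_def blk_def, force)
    qed
    ultimately obtain u where u: "u \<in> S" "arc u (cls a b c)"
      using dom[of "cls a b c"] no_arc_from_cls[OF K] by blast
    then show ?thesis using arc_to_cls[OF K u(2)] key by blast
  qed
  then show ?thesis by blast
qed

lemma satisfiable_imp_dominating_set:
  assumes \<alpha>: "\<forall>(a, b, c)\<in>K. holds \<alpha> a \<or> holds \<alpha> b \<or> holds \<alpha> c"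
  shows "\<exists>S. card S \<le> k + 1 \<and> dominating_set {..<n} edges S"
proof -
  \<comment> \<open>The number of the assignment that \<open>\<alpha>\<close> induces on block
    \<open>i\<close>.\<close>
  define \<beta> :: "nat \<Rightarrow> nat" where "\<beta> i = horner_sum of_bool 2 (map (\<lambda>p. \<alpha> (i * s + p)) [0..<s])" for i
  have lt: "\<beta> i < 2 ^ s" for i
    using horner_sum_of_bool_2_less[of "map (\<lambda>p. \<alpha> (i * s + p)) [0..<s]"] unfolding \<beta>_def by simp
  have bit: "odd (\<beta> i div 2 ^ p) \<longleftrightarrow> \<alpha> (i * s + p)" if "p < s" for i p
    using that bit_horner_sum_bit_iff[of "map (\<lambda>p. \<alpha> (i * s + p)) [0..<s]" p, where ?'a = nat]
    unfolding \<beta>_def bit_iff_odd by simp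
  let ?S = "insert 0 ((\<lambda>i. asg i (\<beta> i)) ` {..<k})"
  have "card ?S \<le> k + 1"
    using card_insert_le_m1[of "k + 1" "(\<lambda>i. asg i (\<beta> i)) ` {..<k}" 0] card_image_le[of "{..<k}" "\<lambda>i. asg i (\<beta> i)"] by simp
  moreover have "dominating_set {..<n} edges ?S"
    unfolding dominating_set_def edge_iff
  proof (intro conjI ballI)
    have "asg i (\<beta> i) < n" if "i < k" for i using asg_lt(2)[OF that lt, of i] n_large by linarith
    then show "?S \<subseteq> {..<n}" using n_large by auto
    fix v assume "v \<in> {..<n}"
    then have v: "v < n" by simp
    consider "v = 0" | "1 \<le> v" "v \<le> k" | "k < v" "\<not> present v" | "present v" by linarith
    then show "v \<in> ?S \<or> (\<exists>u\<in>?S. arc u v \<or> arc v u)"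
    proof cases
      case 2
      then have "v = blk (v - 1)" "v - 1 < k" by (auto simp: blk_def)
      then have "arc v (asg (v - 1) (\<beta> (v - 1)))" using blk_arc[of "v - 1"] lt by metis
      then show ?thesis using \<open>v - 1 < k\<close> by blast
    next
      case 3
      then show ?thesis using hub_arc v by auto
    next
      case 4
      then obtain a b c where K: "(a, b, c) \<in> K" "v = cls a b c" by (auto simp: present_def)
      have *: "\<exists>i<k. block_holds s i (\<beta> i) l" if l: "holds \<alpha> l" "l < 2 * N" for l
      proof -
        have x: "l div 2 < k * s" using l(2) blocks by linarith
        then have s: "0 < s" by (cases s) auto
        have i: "l div 2 div s < k" using x by (simp add: less_mult_imp_div_less)
        moreover have "block_holds s (l div 2 div s) (\<beta> (l div 2 div s)) l"
          unfolding block_holds_def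
          by (rule exI[of _ "l div 2 mod s"]) (use s l(1) bit in \<open>auto simp: holds_def\<close>)
        ultimately show ?thesis by blast
      qed
      have "a < 2 * N" "b < 2 * N" "c < 2 * N" using K(1) K_sub by auto
      moreover have "holds \<alpha> a \<or> holds \<alpha> b \<or> holds \<alpha> c" using \<alpha> K(1) by auto
      ultimately obtain i where i: "i < k" "block_holds s i (\<beta> i) a \<or> block_holds s i (\<beta> i) b \<or> block_holds s i (\<beta> i) c"
        using * by blast
      then have "arc (asg i (\<beta> i)) v" using asg_arc[OF i(1) lt] K by blast
      then show ?thesis using i(1) by blast
    qed simp
  qed
  ultimately show ?thesis by blast
qed

lemma has_dominating_set_iff:
  "has_dominating_set (n, edges, k + 1) \<longleftrightarrow> (\<exists>\<alpha>. \<forall>(a, b, c)\<in>K. holds \<alpha> a \<or> holds \<alpha> b \<or> holds \<alpha> c)"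
  unfolding has_dominating_set_def
  using dominating_set_imp_satisfiable satisfiable_imp_dominating_set by auto

lemma finite_K: "finite K"
  using K_sub by (rule finite_subset) auto

text \<open>An assignment satisfies one literal for each of its \<open>s\<close> variables, and each
  literal occurs in at most \<open>\<Delta>\<close> clauses. The remaining two neighbours are the
  hub and the block vertex.\<close>

lemma degree_asg:
  assumes i: "i < k" "\<beta> < 2 ^ s"
    and occ: "\<And>l. l < 2 * N \<Longrightarrow> card {(a, b, c). (a, b, c) \<in> K \<and> (a = l \<or> b = l \<or> c = l)} \<le> \<Delta>"
  shows "degree edges (asg i \<beta>) \<le> s * \<Delta> + 2"
proof -
  define lit where "lit p = 2 * (i * s + p) + (if odd (\<beta> div 2 ^ p) then 1 else 0)" for p
  define X where "X p = {(a, b, c). (a, b, c) \<in> K \<and> (a = lit p \<or> b = lit p \<or> c = lit p)}" for p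
  have litD: "\<exists>p<s. l = lit p" if bh: "block_holds s i \<beta> l" for l
  proof -
    obtain p where p: "p < s" "l div 2 = i * s + p" "odd l = odd (\<beta> div 2 ^ p)" using bh unfolding block_holds_def by blast
    have "l = 2 * (l div 2) + (if odd l then 1 else 0)" by simp
    then show ?thesis using p unfolding lit_def by (intro exI[of _ p]) simp
  qed
  have X: "finite (X p)" "card (X p) \<le> \<Delta>" for p
  proof -
    show "finite (X p)" by (rule finite_subset[OF _ finite_K]) (auto simp: X_def)
    show "card (X p) \<le> \<Delta>"
    proof (cases "lit p < 2 * N")
      case True
      then show ?thesis using occ unfolding X_def by simp
    next
      case False
      then have "X p = {}" using K_sub unfolding X_def by auto
      then show ?thesis by simp
    qed
  qed
  let ?v = "asg i \<beta>"
  let ?R = "{{0, ?v}, {blk i, ?v}} \<union> (\<Union>p<s. (\<lambda>(a, b, c). {?v, cls a b c}) ` X p)"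
  have sub: "{e \<in> edges. ?v \<in> e} \<subseteq> ?R"
  proof
    fix e assume "e \<in> {e \<in> edges. ?v \<in> e}"
    then obtain u w where e: "e = {u, w}" "arc u w" "?v \<in> e" unfolding edges_def by blast
    show "e \<in> ?R"
    proof (cases "w = ?v")
      case True
      then show ?thesis using arc_to_asg[OF i] e by auto
    next
      case False
      then have u: "u = ?v" using e by auto
      then obtain a b c where abc: "(a, b, c) \<in> K" "w = cls a b c"
          "block_holds s i \<beta> a \<or> block_holds s i \<beta> b \<or> block_holds s i \<beta> c"
        using e(2) asg_arc[OF i] by blast
      then obtain p where "p < s" "(a, b, c) \<in> X p" using litD unfolding X_def by blast
      then show ?thesis using e(1) u abc(2) by (auto simp: image_iff)
    qed
  qed
  have fin: "finite ?R" using X(1) by auto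
  have "degree edges ?v \<le> card ?R" unfolding degree_def by (rule card_mono[OF fin sub])
  also have "\<dots> \<le> card {{0, ?v}, {blk i, ?v}} + card (\<Union>p<s. (\<lambda>(a, b, c). {?v, cls a b c}) ` X p)" by (rule card_Un_le)
  also have "\<dots> \<le> 2 + (\<Sum>p<s. card ((\<lambda>(a, b, c). {?v, cls a b c}) ` X p))"
    by (intro add_mono card_UN_le) (auto simp: card_insert_if)
  also have "(\<Sum>p<s. card ((\<lambda>(a, b, c). {?v, cls a b c}) ` X p)) \<le> (\<Sum>p<s. \<Delta>)"
    by (intro sum_mono order_trans[OF card_image_le] X)
  finally show ?thesis by simp
qed

text \<open>Every edge that avoids the assignment vertices contains the hub. So a subgraph either
  contains an assignment vertex, whose degree is bounded, or is a star with isolated vertices, in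
  spite of the large degrees of the hub, the block vertices and possibly others.\<close>

lemma degeneracy_le:
  assumes occ: "\<And>l. l < 2 * N \<Longrightarrow> card {(a, b, c). (a, b, c) \<in> K \<and> (a = l \<or> b = l \<or> c = l)} \<le> \<Delta>"
  shows "degeneracy {..<n} edges \<le> s * \<Delta> + 2"
  unfolding degeneracy_def
proof (rule Least_le, intro allI impI)
  fix V' E' assume h: "subgraph V' E' {..<n} edges \<and> V' \<noteq> {}"
  have finE: "finite edges" using simple_graph_edges unfolding simple_graph_def
    by (intro finite_subset[of edges "Pow {..<n}"]) auto
  show "\<exists>v\<in>V'. degree E' v \<le> s * \<Delta> + 2"
  proof (cases "\<exists>i<k. \<exists>\<beta><2 ^ s. asg i \<beta> \<in> V'")
    case True
    then obtain i \<beta> where i: "i < k" "\<beta> < 2 ^ s" "asg i \<beta> \<in> V'" by blast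
    have "degree E' (asg i \<beta>) \<le> degree edges (asg i \<beta>)"
      unfolding degree_def by (rule card_mono) (use h finE in \<open>auto simp: subgraph_def\<close>)
    then show ?thesis using degree_asg[OF i(1,2) occ] i(3) order_trans by blast
  next
    case False
    have star: "\<exists>w. e = {0, w}" if "e \<in> E'" for e
    proof -
      have "e \<in> edges" "e \<subseteq> V'" using that h by (auto simp: subgraph_def simple_graph_def)
      then obtain u w where e: "e = {u, w}" "arc u w" "u \<in> V'" "w \<in> V'" by (auto simp: edges_def)
      then have "u = 0" using False unfolding arc_def by blast
      then show ?thesis using e by blast
    qed
    have deg: "degree E' v \<le> 1" if "v \<noteq> 0" for v
    proof -
      have "{e \<in> E'. v \<in> e} \<subseteq> {{0, v}}" using star that by fastforce
      from card_mono[OF _ this] show ?thesis unfolding degree_def by simp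
    qed
    show ?thesis
    proof (cases "V' = {0}")
      case True
      have "E' = {}"
      proof (rule ccontr)
        assume "E' \<noteq> {}"
        then obtain e where "e \<in> E'" by blast
        then have "e \<subseteq> {0}" "card e = 2" using h True by (auto simp: subgraph_def simple_graph_def)
        then show False using card_mono[of "{0::nat}" e] by simp
      qed
      then show ?thesis using True by (simp add: degree_def)
    next
      case False
      then obtain v where "v \<in> V'" "v \<noteq> 0" using h by auto
      then show ?thesis using deg[of v] by (intro bexI[of _ v]) auto
    qed
  qed
qed

end

section \<open>The search program\<close>

abbreviation (input) "vIn \<equiv> 0::nat"
abbreviation (input) "vDone \<equiv> 1::nat"
abbreviation (input) "vAns \<equiv> 2::nat"
abbreviation (input) "vT1 \<equiv> 3::nat"
abbreviation (input) "vT2 \<equiv> 4::nat"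
abbreviation (input) "vT3 \<equiv> 5::nat"
abbreviation (input) "vK \<equiv> 6::nat"
abbreviation (input) "vS \<equiv> 7::nat"
abbreviation (input) "vN \<equiv> 8::nat"
abbreviation (input) "vL \<equiv> 10::nat"
abbreviation (input) "vSp \<equiv> 11::nat"
abbreviation (input) "vLv \<equiv> 12::nat"
abbreviation (input) "vTy \<equiv> 13::nat"
abbreviation (input) "vH1 \<equiv> 14::nat"
abbreviation (input) "vH2 \<equiv> 15::nat"
abbreviation (input) "vFound \<equiv> 16::nat"
abbreviation (input) "vFail \<equiv> 17::nat"
abbreviation (input) "vIt \<equiv> 23::nat"
abbreviation (input) "vA \<equiv> 25::nat"
abbreviation (input) "vB \<equiv> 26::nat"

text \<open>The scalars from 30 on serve only as bound variables of expressions.\<close>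

definition eLit :: "nat \<Rightarrow> expr" where
  "eLit r = Inp (Plus (Num r) (Plus (Var 30) (Plus (Var 30) (Var 30))))"

definition fIs :: "nat \<Rightarrow> nat \<Rightarrow> nat \<Rightarrow> expr" where
  "fIs a b c = fAnd (fEq (eLit 1) (Var a)) (fAnd (fEq (eLit 2) (Var b)) (fEq (eLit 3) (Var c)))"

definition fClause :: "nat \<Rightarrow> nat \<Rightarrow> nat \<Rightarrow> expr" where
  "fClause a b c = fEx 30 (fAnd (fLess (Plus (Num 3) (Plus (Var 30) (Plus (Var 30) (Var 30)))) (Var vIn))
     (fOr (fOr (fIs a b c) (fIs a c b)) (fOr (fOr (fIs b a c) (fIs b c a)) (fOr (fIs c a b) (fIs c b a)))))"

definition fU :: "nat \<Rightarrow> expr" where "fU a = Cell CurU (Var a)"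
definition fD :: "nat \<Rightarrow> nat \<Rightarrow> expr" where
  "fD a b = Cell CurD (Plus (fMul 31 Bound (Var a)) (Var b))"

definition fAct :: "nat \<Rightarrow> nat \<Rightarrow> nat \<Rightarrow> expr" where
  "fAct a b c = fAnd (fClause a b c) (fAnd (fAnd (fNot (fU a)) (fAnd (fNot (fU b)) (fNot (fU c))))
     (fAnd (fNot (fD a b)) (fAnd (fNot (fD a c)) (fNot (fD b c)))))"

definition fF1 :: "nat \<Rightarrow> expr" where
  "fF1 a = fAnd (fLess (Var a) (Var vL)) (fAnd (fNot (fU a))
     (fNot (fLess (fCount 32 (fAnd (fLess (Var 32) (Var vL)) (fAnd (fNot (fU 32)) (fD a 32)))) (Var vT1))))"
definition fF2 :: "nat \<Rightarrow> nat \<Rightarrow> expr" where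
  "fF2 a b = fAnd (fLess (Var a) (Var vL)) (fAnd (fLess (Var b) (Var vL))
     (fNot (fLess (fCount 32 (fAct a b 32)) (Var vT2))))"
definition fF3 :: "nat \<Rightarrow> expr" where
  "fF3 a = fAnd (fLess (Var a) (Var vL)) (fNot (fLess (fCount2 32 33 (fAct a 32 33)) (Var vT3)))"

text \<open>The numbers 1 to 3 name the kinds of flower in the order of their priority, and 0 marks
  a leaf.\<close>

definition eTy :: expr where
  "eTy = Ite (fEx 34 (fF1 34)) (Num 1)
     (Ite (fEx 34 (fEx 35 (fF2 34 35))) (Num 2) (Ite (fEx 34 (fF3 34)) (Num 3) (Num 0)))"
definition eH1 :: expr where
  "eH1 = Ite (fEq (Var vTy) (Num 1)) (fLeast 36 34 (fF1 34))
     (Ite (fEq (Var vTy) (Num 2)) (fLeast 36 34 (fEx 35 (fF2 34 35))) (fLeast 36 34 (fF3 34)))"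
definition eH2 :: expr where "eH2 = fLeast 36 35 (fF2 vH1 35)"

text \<open>\<open>fU1\<close> and \<open>fD1\<close> describe the child in which the heart holds,
  \<open>fU2\<close> and \<open>fD2\<close> the child in which the petals hold. For the first kind
  \<open>fU2\<close> may add all partners of the heart in \<open>D\<close>: those outside
  \<open>nbr\<close> are units already.\<close>

definition fU1 :: expr where
  "fU1 = fOr (fU vA) (fAnd (fNot (fEq (Var vTy) (Num 2))) (fEq (Var vA) (Var vH1)))"
definition fD1 :: expr where
  "fD1 = fOr (fD vA vB) (fAnd (fEq (Var vTy) (Num 2))
     (fOr (fAnd (fEq (Var vA) (Var vH1)) (fEq (Var vB) (Var vH2)))
          (fAnd (fEq (Var vA) (Var vH2)) (fEq (Var vB) (Var vH1)))))"
definition fU2 :: expr where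
  "fU2 = fOr (fU vA) (fOr (fAnd (fEq (Var vTy) (Num 1)) (fD vH1 vA))
     (fAnd (fEq (Var vTy) (Num 2)) (fAct vH1 vH2 vA)))"
definition fD2 :: expr where
  "fD2 = fOr (fD vA vB) (fAnd (fEq (Var vTy) (Num 3)) (fAct vH1 vA vB))"

definition iU :: "nat \<Rightarrow> expr" where "iU l = Plus (fMul 31 Bound (Var l)) (Var vA)"
definition iD :: "nat \<Rightarrow> expr" where
  "iD l = Plus (fMul 31 Bound (Plus (fMul 37 Bound (Var l)) (Var vA))) (Var vB)"

definition cPush :: "nat \<Rightarrow> expr \<Rightarrow> expr \<Rightarrow> cmd" where
  "cPush l u d = For vA (Write StackU (iU l) (Ite u (Num 1) (Num 0))) ;;
     For vA (For vB (Write StackD (iD l) (Ite d (Num 1) (Num 0))))"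

text \<open>The node is copied because its level on the stack is overwritten by the first child
  while the second child still has to be computed from it.\<close>

definition cPop :: cmd where
  "cPop = For vA (Write CurU (Var vA) (Cell StackU (iU vLv))) ;;
     For vA (For vB (Write CurD (Plus (fMul 31 Bound (Var vA)) (Var vB)) (Cell StackD (iD vLv))))"

definition ePow :: expr where "ePow = Cell Powers (Var vS)"
definition eAsg :: "nat \<Rightarrow> nat \<Rightarrow> expr" where
  "eAsg i b = Plus (Plus (Plus (Num 1) (Var vK)) (fMul 31 (Var i) ePow)) (Var b)"
definition eCls :: "nat \<Rightarrow> nat \<Rightarrow> nat \<Rightarrow> expr" where
  "eCls a b c = Plus (Plus (Plus (Num 1) (Var vK)) (fMul 31 (Var vK) ePow))
     (Plus (fMul 31 (Var vL) (Plus (fMul 37 (Var vL) (Var a)) (Var b))) (Var c))"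

definition fLeafClause :: "nat \<Rightarrow> nat \<Rightarrow> nat \<Rightarrow> expr" where
  "fLeafClause a b c =
     fOr (fAnd (fEq (Var a) (Var b)) (fAnd (fEq (Var b) (Var c)) (fAnd (fLess (Var a) (Var vL)) (fU a))))
     (fOr (fAnd (fEq (Var b) (Var c)) (fAnd (fAnd (fLess (Var a) (Var vL)) (fLess (Var b) (Var vL)))
        (fAnd (fD a b) (fAnd (fNot (fU a)) (fNot (fU b))))))
     (fAct a b c))"

definition fPresent :: "nat \<Rightarrow> expr" where
  "fPresent v = fEx 42 (fEx 43 (fEx 44 (fAnd (fLeafClause 42 43 44) (fEq (Var v) (eCls 42 43 44)))))"

text \<open>There is no division, so the binary digit 46 at place 45 is recognized by guessing the
  quotient 47 and the remainder 48. The same digit is the parity of the literal.\<close>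

definition fBlock :: "nat \<Rightarrow> nat \<Rightarrow> nat \<Rightarrow> expr" where
  "fBlock i b l = fEx 45 (fAnd (fLess (Var 45) (Var vS)) (fEx 46 (fAnd (fLess (Var 46) (Num 2))
     (fAnd (fEq (Var l) (Plus (fMul 31 (Num 2) (Plus (fMul 37 (Var i) (Var vS)) (Var 45))) (Var 46)))
       (fEx 47 (fEx 48 (fAnd (fLess (Var 48) (Cell Powers (Var 45)))
         (fEq (Var b) (Plus (Plus (fMul 31 (Var 47) (Cell Powers (Plus (Var 45) (Num 1))))
           (fMul 31 (Var 46) (Cell Powers (Var 45)))) (Var 48))))))))))"

definition fArc :: "nat \<Rightarrow> nat \<Rightarrow> expr" where
  "fArc u v = fOr
     (fAnd (fEq (Var u) (Num 0)) (fAnd (fLess (Var vK) (Var v)) (fAnd (fLess (Var v) (Var vN)) (fNot (fPresent v)))))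
     (fOr (fEx 40 (fAnd (fLess (Var 40) (Var vK)) (fEx 41 (fAnd (fLess (Var 41) ePow)
        (fAnd (fEq (Var u) (Plus (Num 1) (Var 40))) (fEq (Var v) (eAsg 40 41)))))))
     (fEx 40 (fAnd (fLess (Var 40) (Var vK)) (fEx 41 (fAnd (fLess (Var 41) ePow)
        (fAnd (fEq (Var u) (eAsg 40 41)) (fEx 42 (fEx 43 (fEx 44 (fAnd (fLeafClause 42 43 44)
          (fAnd (fEq (Var v) (eCls 42 43 44))
            (fOr (fBlock 40 41 42) (fOr (fBlock 40 41 43) (fBlock 40 41 44))))))))))))))"

text \<open>
  Entries outside the adjacency matrix go behind it, which keeps the map from loop variables to
  addresses injective.
\<close>

definition iG :: expr where
  "iG = Ite (fAnd (fLess (Var vA) (Var vN)) (fLess (Var vB) (Var vN)))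
     (Plus (Num 2) (Plus (fMul 31 (Var vN) (Var vA)) (Var vB)))
     (Plus (Plus (Num 2) (fMul 31 (Var vN) (Var vN))) (Plus (fMul 31 Bound (Var vA)) (Var vB)))"

definition cGraph :: cmd where
  "cGraph = For vA (For vB (Write Graph iG (Ite (fOr (fArc vA vB) (fArc vB vA)) (Num 1) (Num 0)))) ;;
     Write Graph (Num 0) (Var vN) ;; Write Graph (Num 1) (Plus (Var vK) (Num 1)) ;;
     Assign vLen (Plus (Num 2) (fMul 31 (Var vN) (Var vN)))"

text \<open>A simulation that has not halted within the bound says nothing about the leaf; it raises
  \<open>vFail\<close>, which invalidates the whole try.\<close>

definition cLeaf :: "instr list \<Rightarrow> cmd" where
  "cLeaf P = cGraph ;; sim_run P ;;
     Cond (fLess (Var vPc) (Num (length P))) (Assign vFail (Num 1))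
       (Cond (fEq (rd (Num 0)) (Num 1)) (Assign vFound (Num 1)) Skip)"

definition cClassify :: cmd where
  "cClassify = Assign vLv (Minus (Var vSp) (Num 1)) ;; cPop ;; Assign vTy eTy ;; Assign vH1 eH1 ;; Assign vH2 eH2"

text \<open>The first child takes the level of its parent, the second one goes on top of it.\<close>

definition cNode :: "instr list \<Rightarrow> cmd" where
  "cNode P = cClassify ;; Cond (Var vTy)
     (cPush vLv fU1 fD1 ;; cPush vSp fU2 fD2 ;; Assign vSp (Plus (Var vSp) (Num 1)))
     (cLeaf P ;; Assign vSp (Var vLv))"

definition cTry :: "instr list \<Rightarrow> cmd" where
  "cTry P = Assign vFound (Num 0) ;; Assign vFail (Num 0) ;; Assign vLv (Num 0) ;;
     cPush vLv (Num 0) (Num 0) ;; Assign vSp (Num 1) ;;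
     For vIt (Cond (Var vSp) (cNode P) Skip) ;;
     Cond (fAnd (fNot (Var vSp)) (fNot (Var vFail))) (Assign vDone (Num 1) ;; Assign vAns (Var vFound)) Skip"

definition eDeg :: expr where
  "eDeg = Plus (fMul 37 (Var vS) (Plus (Plus (Num 1) (fMul 31 (Num 2) (Var vT1))) (fMul 31 (Num 3) (Var vT3)))) (Num 2)"

text \<open>The size conditions stand in front: they make the later products and the entries of
  \<open>Powers\<close> correct, where \<open>C + 3\<close> below the bound takes care of the
  constant factors \<open>C\<close>, 2 and 3. The last condition says that \<open>C\<close> times
  the degeneracy bound is at most log n, which is enough as soon as \<open>C\<close> is at least 1 /
  c.\<close>

definition fGuard :: "nat \<Rightarrow> expr" where
  "fGuard C = fAnd (fAnd (fLess (Var vIn) Bound) (fAnd (fLess (Var vL) Bound) (fLess (Plus (Num C) (Num 3)) Bound)))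
     (fAnd (fAnd (fLess (Var vK) Bound) (fAnd (fLess (Var vS) Bound) (fLess (Var vN) Bound)))
     (fAnd (fNot (fLess (fMul 31 (Var vK) (Var vS)) (Inp (Num 0))))
     (fAnd (fNot (fLess (Var vN) (Plus (Plus (Plus (Num 2) (Var vK)) (fMul 31 (Var vK) ePow))
         (fMul 31 (Var vL) (fMul 37 (Var vL) (Var vL))))))
     (fAnd (fLess (fMul 38 (Num C) eDeg) Bound)
       (fNot (fLess (Var vN) (Cell Powers (fMul 38 (Num C) eDeg))))))))"

text \<open>All parameters below the bound are tried until one try succeeds. The table of powers is
  rebuilt in each round, for nothing is assumed about the memory at its start.\<close>

definition cMain :: "nat \<Rightarrow> instr list \<Rightarrow> cmd" where
  "cMain C P = Write Powers (Num 0) (Num 1) ;;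
     For vA (Write Powers (Plus (Var vA) (Num 1)) (Plus (Cell Powers (Var vA)) (Cell Powers (Var vA)))) ;;
     Assign vL (Plus (Inp (Num 0)) (Inp (Num 0))) ;; Assign vDone (Num 0) ;;
     For vT1 (For vT2 (For vT3 (For vK (For vS (For vN
       (Cond (fAnd (fNot (Var vDone)) (fGuard C)) (cTry P) Skip))))))"

subsection \<open>Meaning of the expressions\<close>

definition lit_triple :: "clause3 \<Rightarrow> nat \<times> nat \<times> nat" where
  "lit_triple = (\<lambda>(a, b, c). (enc_literal a, enc_literal b, enc_literal c))"

definition clauses :: "clause3 list \<Rightarrow> (nat \<times> nat \<times> nat) set" where
  "clauses \<phi> = (let T = lit_triple ` set \<phi> in {(a, b, c). (a, b, c) \<in> T \<or> (a, c, b) \<in> T \<or>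
     (b, a, c) \<in> T \<or> (b, c, a) \<in> T \<or> (c, a, b) \<in> T \<or> (c, b, a) \<in> T})"

lemma clauses_iff:
  "(a, b, c) \<in> clauses \<phi> \<longleftrightarrow> (a, b, c) \<in> lit_triple ` set \<phi> \<or> (a, c, b) \<in> lit_triple ` set \<phi> \<or>
     (b, a, c) \<in> lit_triple ` set \<phi> \<or> (b, c, a) \<in> lit_triple ` set \<phi> \<or>
     (c, a, b) \<in> lit_triple ` set \<phi> \<or> (c, b, a) \<in> lit_triple ` set \<phi>"
  by (simp add: clauses_def Let_def)

lemma length_enc_sat3: "length (enc_sat3 (N, \<phi>)) = 1 + 3 * length \<phi>"
  unfolding enc_sat3_def by (induction \<phi>) auto

lemma enc_sat3_0: "enc_sat3 (N, \<phi>) ! 0 = N"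
  by (simp add: enc_sat3_def)

lemma enc_sat3_nth:
  assumes "j < length \<phi>"
  shows "(enc_sat3 (N, \<phi>) ! (1 + 3 * j), enc_sat3 (N, \<phi>) ! (2 + 3 * j), enc_sat3 (N, \<phi>) ! (3 + 3 * j)) =
    lit_triple (\<phi> ! j)"
proof -
  define g :: "clause3 \<Rightarrow> nat list" where "g = (\<lambda>(a, b, c). [enc_literal a, enc_literal b, enc_literal c])"
  have "concat (map g \<phi>) ! (3 * j + r) = g (\<phi> ! j) ! r" if "r < 3" for r
    using assms
  proof (induction \<phi> arbitrary: j)
    case (Cons t \<phi>)
    have l: "length (g t) = 3" by (simp add: g_def split: prod.split)
    show ?case
    proof (cases j)
      case 0
      then show ?thesis using that l by (simp add: nth_append)
    next
      case (Suc i)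
      then have "3 * j + r - 3 = 3 * i + r" "\<not> 3 * j + r < 3" by auto
      then show ?thesis using Cons Suc l by (simp add: nth_append)
    qed
  qed simp
  from this[of 0] this[of 1] this[of 2] show ?thesis
    by (auto simp: enc_sat3_def g_def[symmetric] lit_triple_def split: prod.split)
      (auto simp: g_def numeral_2_eq_2 numeral_3_eq_3)
qed

lemma lit_true_holds: "lit_true \<alpha> l \<longleftrightarrow> holds \<alpha> (enc_literal l)"
  by (auto simp: lit_true_def holds_def enc_literal_def)

lemma satisfiable3_models:
  "satisfiable3 \<phi> \<longleftrightarrow> (\<exists>\<alpha>. models (clauses \<phi>) (holds \<alpha>) {} {})"
proof -
  have "(\<forall>(a, b, c)\<in>set \<phi>. lit_true \<alpha> a \<or> lit_true \<alpha> b \<or> lit_true \<alpha> c) \<longleftrightarrow>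
      models (clauses \<phi>) (holds \<alpha>) {} {}" for \<alpha>
  proof
    assume h: "\<forall>(a, b, c)\<in>set \<phi>. lit_true \<alpha> a \<or> lit_true \<alpha> b \<or> lit_true \<alpha> c"
    then have "holds \<alpha> a \<or> holds \<alpha> b \<or> holds \<alpha> c" if "(a, b, c) \<in> lit_triple ` set \<phi>" for a b c
      using that by (auto simp: lit_triple_def lit_true_holds)
    then have "holds \<alpha> a \<or> holds \<alpha> b \<or> holds \<alpha> c" if "(a, b, c) \<in> clauses \<phi>" for a b c
      using that unfolding clauses_iff by blast
    then show "models (clauses \<phi>) (holds \<alpha>) {} {}" unfolding models_def by auto
  next
    assume m: "models (clauses \<phi>) (holds \<alpha>) {} {}"
    have "lit_true \<alpha> a \<or> lit_true \<alpha> b \<or> lit_true \<alpha> c" if "(a, b, c) \<in> set \<phi>" for a b c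
    proof -
      have "(enc_literal a, enc_literal b, enc_literal c) \<in> clauses \<phi>"
        using imageI[OF that, of lit_triple] unfolding clauses_iff by (simp add: lit_triple_def)
      then show ?thesis using m unfolding models_def lit_true_holds by auto
    qed
    then show "\<forall>(a, b, c)\<in>set \<phi>. lit_true \<alpha> a \<or> lit_true \<alpha> b \<or> lit_true \<alpha> c"
      by (intro ballI) (metis (no_types, lifting) case_prod_conv prod_cases3)
  qed
  then show ?thesis unfolding satisfiable3_def by simp
qed

lemma bit_decomposition:
  fixes \<beta> w p :: nat
  assumes "w < 2"
  shows "(\<exists>q r. r < 2 ^ p \<and> \<beta> = q * 2 ^ (p + 1) + w * 2 ^ p + r) \<longleftrightarrow> w = \<beta> div 2 ^ p mod 2"
proof
  assume "\<exists>q r. r < 2 ^ p \<and> \<beta> = q * 2 ^ (p + 1) + w * 2 ^ p + r"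
  then obtain q r where h: "r < 2 ^ p" "\<beta> = (2 * q + w) * 2 ^ p + r" by (auto simp: algebra_simps)
  then have "\<beta> div 2 ^ p = 2 * q + w" by simp
  then show "w = \<beta> div 2 ^ p mod 2" using assms by simp
next
  assume w: "w = \<beta> div 2 ^ p mod 2"
  define d where "d = \<beta> div 2 ^ p"
  have "\<beta> = d * 2 ^ p + \<beta> mod 2 ^ p" unfolding d_def by (rule div_mult_mod_eq[symmetric])
  moreover have "d = 2 * (d div 2) + w" unfolding w d_def[symmetric] by simp
  moreover have "(2 * z + w) * 2 ^ p = z * 2 ^ (p + 1) + w * 2 ^ p" for z :: nat by (simp add: algebra_simps)
  ultimately have "\<beta> = (d div 2) * 2 ^ (p + 1) + w * 2 ^ p + \<beta> mod 2 ^ p" by metis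
  then show "\<exists>q r. r < 2 ^ p \<and> \<beta> = q * 2 ^ (p + 1) + w * 2 ^ p + r" by (metis mod_less_divisor zero_less_numeral zero_less_power)
qed

text \<open>Parameters that meet the size conditions of \<open>fGuard\<close>; these suffice to
  evaluate the formulas. The degeneracy condition enters in \<open>solver_round\<close>.\<close>

locale round = sparsification "2 * N" \<theta>1 \<theta>2 \<theta>3 "clauses \<phi>"
  for N \<theta>1 \<theta>2 \<theta>3 :: nat and \<phi> :: "clause3 list" +
  fixes B k s n C :: nat and x :: "nat list"
  assumes x: "x = enc_sat3 (N, \<phi>)"
    and len: "length x < B" and L: "2 * N < B" and k: "k < B" and s: "s < B" and n: "n < B"
    and C: "C + 3 < B"
    and blocks: "N \<le> k * s"
    and n_large: "2 + k + k * 2 ^ s + (2 * N) * ((2 * N) * (2 * N)) \<le> n"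
begin

text \<open>What a try reads but never changes. Only scalars up to 10 are involved, so that
  \<open>env_upd\<close> disposes of all working and bound variables.\<close>

definition env :: "store \<Rightarrow> heap \<Rightarrow> bool" where
  "env \<rho> \<mu> \<longleftrightarrow> \<rho> vIn = length x \<and> \<rho> vT1 = \<theta>1 \<and> \<rho> vT2 = \<theta>2 \<and> \<rho> vT3 = \<theta>3 \<and> \<rho> vK = k \<and> \<rho> vS = s \<and>
     \<rho> vN = n \<and> \<rho> vL = 2 * N \<and> (\<forall>i\<le>B. \<mu> Powers i = 2 ^ i)"

lemma envD:
  assumes "env \<rho> \<mu>"
  shows "\<rho> 0 = length x" "\<rho> 3 = \<theta>1" "\<rho> 4 = \<theta>2" "\<rho> 5 = \<theta>3" "\<rho> 6 = k" "\<rho> 7 = s" "\<rho> 8 = n" "\<rho> 10 = 2 * N"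
    "\<And>i. i \<le> B \<Longrightarrow> \<mu> Powers i = 2 ^ i"
  using assms unfolding env_def by auto

lemma env_upd [simp]: "11 \<le> v \<Longrightarrow> env (\<rho>(v := i)) \<mu> \<longleftrightarrow> env \<rho> \<mu>"
  unfolding env_def by auto

definition cU :: "heap \<Rightarrow> nat set" where "cU \<mu> = {a. a < 2 * N \<and> \<mu> CurU a \<noteq> 0}"
definition cD :: "heap \<Rightarrow> (nat \<times> nat) set" where
  "cD \<mu> = {(a, b). a < 2 * N \<and> b < 2 * N \<and> \<mu> CurD (B * a + b) \<noteq> 0}"

lemma tr_fClause:
  assumes "env \<rho> \<mu>" "a \<noteq> 30" "b \<noteq> 30" "c \<noteq> 30"
  shows "tr x B \<mu> \<rho> (fClause a b c) \<longleftrightarrow> (\<rho> a, \<rho> b, \<rho> c) \<in> clauses \<phi>"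
proof -
  define lt where "lt j = (x ! (1 + 3 * j), x ! (2 + 3 * j), x ! (3 + 3 * j))" for j
  have t3: "j + (j + j) = 3 * j" for j :: nat by simp
  have lx: "length x = 1 + 3 * length \<phi>" by (simp add: x length_enc_sat3)
  have perm: "tr x B \<mu> (\<rho>(30 := j)) (fIs a' b' c') \<longleftrightarrow> lt j = (\<rho> a', \<rho> b', \<rho> c')"
    if "j < length \<phi>" "a' \<noteq> 30" "b' \<noteq> 30" "c' \<noteq> 30" for j a' b' c'
    using that lx by (simp add: fIs_def eLit_def t3 lt_def)
  have lj: "lt j = lit_triple (\<phi> ! j)" if "j < length \<phi>" for j
    unfolding lt_def x by (rule enc_sat3_nth[OF that])
  have bnd: "j < B \<and> 3 + 3 * j < length x \<longleftrightarrow> j < length \<phi>" for j using len lx by auto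
  have "tr x B \<mu> \<rho> (fClause a b c) \<longleftrightarrow> (\<exists>j. (j < B \<and> 3 + 3 * j < length x) \<and>
      (lt j = (\<rho> a, \<rho> b, \<rho> c) \<or> lt j = (\<rho> a, \<rho> c, \<rho> b) \<or> lt j = (\<rho> b, \<rho> a, \<rho> c) \<or>
       lt j = (\<rho> b, \<rho> c, \<rho> a) \<or> lt j = (\<rho> c, \<rho> a, \<rho> b) \<or> lt j = (\<rho> c, \<rho> b, \<rho> a)))"
  proof -
    have "\<rho> 0 = length x" using assms(1) by (simp add: env_def)
    then show ?thesis unfolding fClause_def tr_simps
      using perm assms(2-) bnd by (simp add: t3 conj_assoc cong: conj_cong) (metis bnd)
  qed
  also have "\<dots> \<longleftrightarrow> (\<exists>j<length \<phi>. let t = lit_triple (\<phi> ! j) in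
      t = (\<rho> a, \<rho> b, \<rho> c) \<or> t = (\<rho> a, \<rho> c, \<rho> b) \<or> t = (\<rho> b, \<rho> a, \<rho> c) \<or>
       t = (\<rho> b, \<rho> c, \<rho> a) \<or> t = (\<rho> c, \<rho> a, \<rho> b) \<or> t = (\<rho> c, \<rho> b, \<rho> a))"
    unfolding bnd Let_def using lj by (metis (no_types, lifting))
  also have "\<dots> \<longleftrightarrow> (\<rho> a, \<rho> b, \<rho> c) \<in> clauses \<phi>"
  proof -
    have "t \<in> lit_triple ` set \<phi> \<longleftrightarrow> (\<exists>j<length \<phi>. lit_triple (\<phi> ! j) = t)" for t
      by (metis (no_types, lifting) image_iff in_set_conv_nth)
    then show ?thesis unfolding clauses_iff Let_def by blast
  qed
  finally show ?thesis .
qed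

lemma tr_fU: "tr x B \<mu> \<rho> (fU a) \<longleftrightarrow> \<mu> CurU (\<rho> a) \<noteq> 0"
  by (simp add: fU_def tr_def)

lemma ev_mul_bound: "a \<noteq> 31 \<Longrightarrow> ev x B \<mu> \<rho> (fMul 31 Bound (Var a)) = B * \<rho> a"
  by (rule ev_fMul) auto

lemma tr_fD: "a \<noteq> 31 \<Longrightarrow> tr x B \<mu> \<rho> (fD a b) \<longleftrightarrow> \<mu> CurD (B * \<rho> a + \<rho> b) \<noteq> 0"
  by (simp add: fD_def tr_def ev_mul_bound)

lemma tr_fAct:
  assumes "env \<rho> \<mu>" "a \<noteq> 30" "b \<noteq> 30" "c \<noteq> 30" "a \<noteq> 31" "b \<noteq> 31"
  shows "tr x B \<mu> \<rho> (fAct a b c) \<longleftrightarrow> (\<rho> a, \<rho> b, \<rho> c) \<in> act (clauses \<phi>) (cU \<mu>) (cD \<mu>)"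
proof -
  have "\<rho> a < 2 * N \<and> \<rho> b < 2 * N \<and> \<rho> c < 2 * N" if "(\<rho> a, \<rho> b, \<rho> c) \<in> clauses \<phi>"
    using that E_sub by auto
  then show ?thesis
    using assms by (cases "(\<rho> a, \<rho> b, \<rho> c) \<in> clauses \<phi>")
      (simp_all add: fAct_def tr_fClause tr_fU tr_fD act_def cU_def cD_def)
qed

lemma tr_fF1:
  assumes "env \<rho> \<mu>" "a \<noteq> 31" "a \<noteq> 32"
  shows "tr x B \<mu> \<rho> (fF1 a) \<longleftrightarrow> flower1 (cU \<mu>) (cD \<mu>) (\<rho> a)"
proof (cases "\<rho> a < 2 * N")
  case True
  have "nbr (cU \<mu>) (cD \<mu>) (\<rho> a) = {i. i < B \<and> tr x B \<mu> (\<rho>(32 := i)) (fAnd (fLess (Var 32) (Var vL)) (fAnd (fNot (fU 32)) (fD a 32)))}"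
    using assms L True by (auto simp: nbr_def cU_def cD_def tr_fU tr_fD envD)
  then show ?thesis using True assms by (auto simp: fF1_def flower1_def ev_fCount tr_fU cU_def envD not_less)
qed (use assms in \<open>auto simp: fF1_def flower1_def envD\<close>)

lemma act_lt_B: "(a, b, c) \<in> act (clauses \<phi>) U D \<Longrightarrow> b < B \<and> c < B"
  using act_lt[of a b c U D] L by simp

lemma tr_fF2:
  assumes "env \<rho> \<mu>" "a \<noteq> 30" "b \<noteq> 30" "a \<noteq> 31" "b \<noteq> 31" "a \<noteq> 32" "b \<noteq> 32"
  shows "tr x B \<mu> \<rho> (fF2 a b) \<longleftrightarrow> flower2 (cU \<mu>) (cD \<mu>) (\<rho> a) (\<rho> b)"
proof -
  have "{c. (\<rho> a, \<rho> b, c) \<in> act (clauses \<phi>) (cU \<mu>) (cD \<mu>)} = {i. i < B \<and> tr x B \<mu> (\<rho>(32 := i)) (fAct a b 32)}"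
    using assms act_lt_B by (auto simp: tr_fAct)
  then show ?thesis using assms by (simp add: fF2_def flower2_def ev_fCount envD not_less)
qed

lemma tr_fF3:
  assumes "env \<rho> \<mu>" "a \<noteq> 30" "a \<noteq> 31" "a \<noteq> 32" "a \<noteq> 33"
  shows "tr x B \<mu> \<rho> (fF3 a) \<longleftrightarrow> flower3 (cU \<mu>) (cD \<mu>) (\<rho> a)"
proof -
  have "{(b, c). (\<rho> a, b, c) \<in> act (clauses \<phi>) (cU \<mu>) (cD \<mu>)} =
      {(i, j). i < B \<and> j < B \<and> tr x B \<mu> (\<rho>(32 := i, 33 := j)) (fAct a 32 33)}"
    using assms act_lt_B by (auto simp: tr_fAct)
  then show ?thesis using assms by (simp add: fF3_def flower3_def ev_fCount2 envD not_less)
qed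

lemma ev_ePow: "env \<rho> \<mu> \<Longrightarrow> ev x B \<mu> \<rho> ePow = 2 ^ s"
  using s by (simp add: ePow_def envD)

lemma ev_eAsg:
  assumes "env \<rho> \<mu>" "i \<noteq> 31" "\<rho> i \<le> B"
  shows "ev x B \<mu> \<rho> (eAsg i b) = 1 + k + \<rho> i * 2 ^ s + \<rho> b"
proof -
  have "ev x B \<mu> \<rho> (fMul 31 (Var i) ePow) = \<rho> i * 2 ^ s"
    by (rule ev_fMul) (use assms in \<open>auto simp: ev_ePow\<close>)
  then show ?thesis using assms by (simp add: eAsg_def envD)
qed

lemma ev_eCls:
  assumes "env \<rho> \<mu>" "a \<noteq> 31" "a \<noteq> 37" "b \<noteq> 31"
  shows "ev x B \<mu> \<rho> (eCls a b c) = 1 + k + k * 2 ^ s + ((2 * N) * ((2 * N) * \<rho> a + \<rho> b) + \<rho> c)"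
proof -
  have 1: "ev x B \<mu> \<rho> (fMul 31 (Var vK) ePow) = k * 2 ^ s"
    by (rule ev_fMul) (use assms k in \<open>auto simp: ev_ePow envD\<close>)
  have 2: "ev x B \<mu> \<rho>' (fMul 37 (Var vL) (Var a)) = 2 * N * \<rho> a" if "env \<rho>' \<mu>" "\<rho>' a = \<rho> a" for \<rho>'
    by (rule ev_fMul) (use assms L that in \<open>auto simp: envD\<close>)
  have "ev x B \<mu> \<rho> (fMul 31 (Var vL) (Plus (fMul 37 (Var vL) (Var a)) (Var b))) = 2 * N * (2 * N * \<rho> a + \<rho> b)"
    by (rule ev_fMul) (use assms L 2 in \<open>auto simp: envD\<close>)
  then show ?thesis using assms 1 by (simp add: eCls_def envD)
qed

lemma tr_fLeafClause:
  assumes "env \<rho> \<mu>" "a \<noteq> 30" "b \<noteq> 30" "c \<noteq> 30" "a \<noteq> 31" "b \<noteq> 31"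
  shows "tr x B \<mu> \<rho> (fLeafClause a b c) \<longleftrightarrow> (\<rho> a, \<rho> b, \<rho> c) \<in> leaf_clauses (clauses \<phi>) (cU \<mu>) (cD \<mu>)"
  using assms by (auto simp: fLeafClause_def tr_fAct tr_fU tr_fD leaf_clauses_def cU_def cD_def free_pairs_def envD)

lemma leaf_clauses_lt:
  assumes "(a, b, c) \<in> leaf_clauses (clauses \<phi>) (cU \<mu>) (cD \<mu>)"
  shows "a < 2 * N \<and> b < 2 * N \<and> c < 2 * N"
  using assms act_lt[of a b c] by (auto simp: leaf_clauses_def cU_def cD_def free_pairs_def)

lemma tr_fBlock:
  assumes e: "env \<rho> \<mu>" and ib: "i \<in> {40, 41, 42, 43, 44}" "b \<in> {40, 41, 42, 43, 44}" "l \<in> {40, 41, 42, 43, 44}"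
    and lt: "\<rho> i < B" "\<rho> b < B"
  shows "tr x B \<mu> \<rho> (fBlock i b l) \<longleftrightarrow> block_holds s (\<rho> i) (\<rho> b) (\<rho> l)"
proof -
  have B2: "2 < B" using C by simp
  have "40 \<le> i \<and> i < 45" using ib(1) by auto
  moreover have "40 \<le> b \<and> b < 45" using ib(2) by auto
  moreover have "40 \<le> l \<and> l < 45" using ib(3) by auto
  ultimately have i': "i \<noteq> 31" "i \<noteq> 37" "i < 45" "b \<noteq> 31" "b < 45" "l < 45" "i \<noteq> 45" "i \<noteq> 46" "i \<noteq> 47" "i \<noteq> 48"
    "b \<noteq> 45" "b \<noteq> 46" "b \<noteq> 47" "b \<noteq> 48" "l \<noteq> 45" "l \<noteq> 46" "l \<noteq> 47" "l \<noteq> 48" by auto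
  have m1: "ev x B \<mu> \<rho>' (fMul 31 (Num 2) (Plus (fMul 37 (Var i) (Var vS)) (Var 45))) = 2 * (\<rho> i * s + \<rho>' 45)"
    if h: "env \<rho>' \<mu>" "\<rho>' i = \<rho> i" for \<rho>'
  proof -
    have "ev x B \<mu> \<rho>'' (fMul 37 (Var i) (Var vS)) = \<rho> i * s" if "env \<rho>'' \<mu>" "\<rho>'' i = \<rho> i" for \<rho>''
      by (rule ev_fMul) (use that i' lt in \<open>auto simp: envD\<close>)
    then show ?thesis by (intro ev_fMul) (use h i' B2 in auto)
  qed
  have m2: "ev x B \<mu> \<rho>' (fMul 31 (Var 47) (Cell Powers (Plus (Var 45) (Num 1)))) = \<rho>' 47 * 2 ^ (\<rho>' 45 + 1)"
    if "env \<rho>' \<mu>" "\<rho>' 45 < s" "\<rho>' 47 < B" for \<rho>'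
    by (rule ev_fMul) (use that s in \<open>auto simp: envD\<close>)
  have m3: "ev x B \<mu> \<rho>' (fMul 31 (Var 46) (Cell Powers (Var 45))) = \<rho>' 46 * 2 ^ \<rho>' 45"
    if "env \<rho>' \<mu>" "\<rho>' 45 < s" "\<rho>' 46 < B" for \<rho>'
    by (rule ev_fMul) (use that s in \<open>auto simp: envD\<close>)
  have "tr x B \<mu> \<rho> (fBlock i b l) \<longleftrightarrow> (\<exists>p<B. p < s \<and> (\<exists>w<B. w < 2 \<and> \<rho> l = 2 * (\<rho> i * s + p) + w \<and>
      (\<exists>q<B. \<exists>r<B. r < 2 ^ p \<and> \<rho> b = q * 2 ^ (p + 1) + w * 2 ^ p + r)))"
    using e i' s by (simp add: fBlock_def m1 m2 m3 envD cong: conj_cong del: power_Suc One_nat_def)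
  also have "\<dots> \<longleftrightarrow> (\<exists>p<s. \<exists>w<2. \<rho> l = 2 * (\<rho> i * s + p) + w \<and> w = \<rho> b div 2 ^ p mod 2)"
  proof -
    have bits: "(\<exists>q<B. \<exists>r<B. r < 2 ^ p \<and> \<rho> b = q * 2 ^ (p + 1) + w * 2 ^ p + r) \<longleftrightarrow> w = \<rho> b div 2 ^ p mod 2" if "w < 2" for w p
    proof -
      \<comment> \<open>Quotient and remainder are at most the number itself, which is below
        \<open>B\<close>; bounded quantifiers therefore find them.\<close>
      have "q < B \<and> r < B" if "\<rho> b = q * 2 ^ (p + 1) + w * 2 ^ p + r" for q r
      proof -
        have "q * 1 \<le> q * 2 ^ (p + 1)" by (rule mult_le_mono2) simp
        then show ?thesis using that lt(2) by linarith
      qed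
      then show ?thesis unfolding bit_decomposition[OF that, symmetric] by blast
    qed
    have pB: "p < B" if "p < s" for p using that s by simp
    have wB: "w < B" if "w < 2" for w using that B2 by simp
    show ?thesis
    proof
      assume "\<exists>p<B. p < s \<and> (\<exists>w<B. w < 2 \<and> \<rho> l = 2 * (\<rho> i * s + p) + w \<and>
        (\<exists>q<B. \<exists>r<B. r < 2 ^ p \<and> \<rho> b = q * 2 ^ (p + 1) + w * 2 ^ p + r))"
      then obtain p w where h: "p < s" "w < 2" "\<rho> l = 2 * (\<rho> i * s + p) + w"
        "\<exists>q<B. \<exists>r<B. r < 2 ^ p \<and> \<rho> b = q * 2 ^ (p + 1) + w * 2 ^ p + r" by blast
      from h(4) have "w = \<rho> b div 2 ^ p mod 2" by (rule bits[OF h(2), THEN iffD1])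
      with h(1-3) show "\<exists>p<s. \<exists>w<2. \<rho> l = 2 * (\<rho> i * s + p) + w \<and> w = \<rho> b div 2 ^ p mod 2" by blast
    next
      assume "\<exists>p<s. \<exists>w<2. \<rho> l = 2 * (\<rho> i * s + p) + w \<and> w = \<rho> b div 2 ^ p mod 2"
      then obtain p w where h: "p < s" "w < 2" "\<rho> l = 2 * (\<rho> i * s + p) + w" "w = \<rho> b div 2 ^ p mod 2" by blast
      from h(4) have "\<exists>q<B. \<exists>r<B. r < 2 ^ p \<and> \<rho> b = q * 2 ^ (p + 1) + w * 2 ^ p + r"
        by (rule bits[OF h(2), THEN iffD2])
      with h(1-3) pB[OF h(1)] wB[OF h(2)] show "\<exists>p<B. p < s \<and> (\<exists>w<B. w < 2 \<and> \<rho> l = 2 * (\<rho> i * s + p) + w \<and>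
        (\<exists>q<B. \<exists>r<B. r < 2 ^ p \<and> \<rho> b = q * 2 ^ (p + 1) + w * 2 ^ p + r))" by blast
    qed
  qed
  also have "\<dots> \<longleftrightarrow> block_holds s (\<rho> i) (\<rho> b) (\<rho> l)"
    unfolding block_holds_def
  proof -
    have e: "(\<exists>w<2. l = 2 * m + w \<and> w = d mod 2) \<longleftrightarrow> l div 2 = m \<and> odd l = odd d" for l m d :: nat
      by presburger
    show "(\<exists>p<s. \<exists>w<2. \<rho> l = 2 * (\<rho> i * s + p) + w \<and> w = \<rho> b div 2 ^ p mod 2) \<longleftrightarrow>
        (\<exists>p<s. \<rho> l div 2 = \<rho> i * s + p \<and> odd (\<rho> l) = odd (\<rho> b div 2 ^ p))" by (simp only: e)
  qed
  finally show ?thesis .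
qed

end

section \<open>Adjacency matrices, radix notation and halted runs\<close>

lemma concat_matrix:
  assumes "i < l" "j < m"
  shows "concat (map (\<lambda>i. map (f i) [0..<m]) [0..<l]) ! (m * i + j) = f i j"
  using assms(1)
proof (induction l)
  case (Suc l)
  have len: "length (concat (map (\<lambda>i. map (f i) [0..<m]) [0..<l])) = m * l" for l
    by (induction l) (auto simp: length_concat)
  show ?case
  proof (cases "i = l")
    case True
    then show ?thesis using assms(2) by (simp add: nth_append len)
  next
    case False
    then have i: "i < l" using Suc.prems by simp
    have "m * i + j < m * (i + 1)" using assms(2) by simp
    also have "\<dots> \<le> m * l" using i by (intro mult_le_mono2) auto
    finally show ?thesis using Suc.IH[OF i] by (simp add: nth_append len)
  qed
qed simp

lemma length_matrix: "length (concat (map (\<lambda>i. map (f i) [0..<m]) [0..<l])) = l * m"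
  by (induction l) auto

lemma radix_inject:
  fixes B :: nat
  assumes "B * i + j = B * i' + j'" "j < B" "j' < B"
  shows "i = i' \<and> j = j'"
proof -
  have "(B * i + j) div B = i" "(B * i' + j') div B = i'" using assms(2,3) by auto
  with assms(1) have "i = i'" by simp
  with assms(1) show ?thesis by simp
qed

lemma config_after_halted:
  assumes "halted P (config_after P y t)"
  shows "config_after P y (t + d) = config_after P y t"
  using assms by (induction d) (simp_all add: config_after_def step_def)

text \<open>A halted configuration no longer changes, so the configuration after \<open>B\<close>
  steps agrees with the answering one whenever it is halted, no matter which of the two comes first.
  The first claim thus needs no comparison of \<open>T\<close> with \<open>B\<close>.\<close>

lemma answers_within_config:
  assumes "answers_within P y b T"
  shows "halted P (config_after P y B) \<Longrightarrow> snd (config_after P y B) 0 = (if b then 1 else 0)"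
    and "T \<le> real B \<Longrightarrow> halted P (config_after P y B)"
proof -
  obtain t where t: "real t \<le> T" "halted P (config_after P y t)"
    "snd (config_after P y t) 0 = (if b then 1 else 0)" using assms unfolding answers_within_def by blast
  show "snd (config_after P y B) 0 = (if b then 1 else 0)" if h: "halted P (config_after P y B)"
  proof (cases "t \<le> B")
    case True
    then show ?thesis using config_after_halted[OF t(2), of "B - t"] t(3) by simp
  next
    case False
    then show ?thesis using config_after_halted[OF h, of "t - B"] t(3) by simp
  qed
  show "halted P (config_after P y B)" if "T \<le> real B"
  proof -
    have "t \<le> B" using that t(1) by linarith
    then show ?thesis using config_after_halted[OF t(2), of "B - t"] t(2) by simp
  qed
qed

section \<open>Contents of the graph and of the stack in memory\<close>

context round
begin

abbreviation "leafs \<mu> \<equiv> leaf_clauses (clauses \<phi>) (cU \<mu>) (cD \<mu>)"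
abbreviation "arcs \<mu> \<equiv> ds_graph.arc N k s n (leafs \<mu>)"
abbreviation "edgs \<mu> \<equiv> ds_graph.edges N k s n (leafs \<mu>)"

lemma ds_graph_leafs: "ds_graph N k s n (leafs \<mu>)"
proof
  show "leafs \<mu> \<subseteq> {..<2 * N} \<times> {..<2 * N} \<times> {..<2 * N}" using leaf_clauses_lt by auto
qed (use blocks n_large in auto)

lemma tr_fPresent:
  assumes "env \<rho> \<mu>" "v < 30"
  shows "tr x B \<mu> \<rho> (fPresent v) \<longleftrightarrow> ds_graph.present N k s (leafs \<mu>) (\<rho> v)"
proof -
  interpret G: ds_graph N k s n "leafs \<mu>" by (rule ds_graph_leafs)
  have "tr x B \<mu> \<rho> (fPresent v) \<longleftrightarrow> (\<exists>a<B. \<exists>b<B. \<exists>c<B. (a, b, c) \<in> leafs \<mu> \<and> \<rho> v = G.cls a b c)"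
    using assms by (simp add: fPresent_def tr_fLeafClause ev_eCls G.cls_def)
  also have "\<dots> \<longleftrightarrow> G.present (\<rho> v)"
  proof -
    have "a < B \<and> b < B \<and> c < B" if "(a, b, c) \<in> leafs \<mu>" for a b c
      using leaf_clauses_lt[OF that] L by simp
    then show ?thesis unfolding G.present_def by blast
  qed
  finally show ?thesis .
qed

lemma tr_fArc:
  assumes e: "env \<rho> \<mu>" and uv: "u \<noteq> 31" "u < 30" "v < 30" and lt: "\<rho> u < B" "\<rho> v < B"
  shows "tr x B \<mu> \<rho> (fArc u v) \<longleftrightarrow> arcs \<mu> (\<rho> u) (\<rho> v)"
proof -
  interpret G: ds_graph N k s n "leafs \<mu>" by (rule ds_graph_leafs)
  have K: "a < B \<and> b < B \<and> c < B" if "(a, b, c) \<in> leafs \<mu>" for a b c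
    using leaf_clauses_lt[OF that] L by simp
  \<comment> \<open>The number of an assignment is at most that of its vertex, so searching below
    \<open>B\<close> loses nothing even if \<open>2 ^ s\<close> were larger.\<close>
  have A: "\<beta> < B" if "\<rho> w = G.asg i \<beta>" "\<rho> w < B" for w i \<beta> using that by (simp add: G.asg_def)
  let ?bh = "\<lambda>i \<beta> a b c. block_holds s i \<beta> a \<or> block_holds s i \<beta> b \<or> block_holds s i \<beta> c"
  have 1: "tr x B \<mu> \<rho> (fEx 40 (fAnd (fLess (Var 40) (Var vK)) (fEx 41 (fAnd (fLess (Var 41) ePow)
        (fAnd (fEq (Var u) (Plus (Num 1) (Var 40))) (fEq (Var v) (eAsg 40 41)))))))
     \<longleftrightarrow> (\<exists>i<k. \<exists>\<beta><2 ^ s. \<rho> u = G.blk i \<and> \<rho> v = G.asg i \<beta>)" (is "?l1 \<longleftrightarrow> ?r1")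
  proof -
    have "?l1 \<longleftrightarrow> (\<exists>i<B. i < k \<and> (\<exists>\<beta><B. \<beta> < 2 ^ s \<and> \<rho> u = G.blk i \<and> \<rho> v = G.asg i \<beta>))"
      using e uv by (simp add: ev_ePow ev_eAsg envD G.blk_def G.asg_def cong: conj_cong)
    also have "\<dots> \<longleftrightarrow> ?r1" using A[of v] lt(2) k by (meson less_trans)
    finally show ?thesis .
  qed
  have 2: "tr x B \<mu> \<rho> (fEx 40 (fAnd (fLess (Var 40) (Var vK)) (fEx 41 (fAnd (fLess (Var 41) ePow)
        (fAnd (fEq (Var u) (eAsg 40 41)) (fEx 42 (fEx 43 (fEx 44 (fAnd (fLeafClause 42 43 44)
          (fAnd (fEq (Var v) (eCls 42 43 44))
            (fOr (fBlock 40 41 42) (fOr (fBlock 40 41 43) (fBlock 40 41 44))))))))))))) \<longleftrightarrow>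
      (\<exists>i<k. \<exists>\<beta><2 ^ s. \<rho> u = G.asg i \<beta> \<and> (\<exists>a b c. (a, b, c) \<in> leafs \<mu> \<and> \<rho> v = G.cls a b c \<and> ?bh i \<beta> a b c))"
    (is "?l2 \<longleftrightarrow> ?r2")
  proof -
    have "?l2 \<longleftrightarrow> (\<exists>i<B. i < k \<and> (\<exists>\<beta><B. \<beta> < 2 ^ s \<and> \<rho> u = G.asg i \<beta> \<and>
        (\<exists>a<B. \<exists>b<B. \<exists>c<B. (a, b, c) \<in> leafs \<mu> \<and> \<rho> v = G.cls a b c \<and> ?bh i \<beta> a b c)))"
      using e uv
      by (simp add: ev_ePow ev_eAsg ev_eCls tr_fLeafClause tr_fBlock envD G.cls_def G.asg_def cong: conj_cong)
    also have "\<dots> \<longleftrightarrow> ?r2"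
    proof
      assume ?r2
      then obtain i \<beta> a b c where h: "i < k" "\<beta> < 2 ^ s" "\<rho> u = G.asg i \<beta>" "(a, b, c) \<in> leafs \<mu>"
        "\<rho> v = G.cls a b c" "?bh i \<beta> a b c" by blast
      moreover have "i < B" "\<beta> < B" using h(1) k A[OF h(3) lt(1)] by auto
      ultimately show "\<exists>i<B. i < k \<and> (\<exists>\<beta><B. \<beta> < 2 ^ s \<and> \<rho> u = G.asg i \<beta> \<and>
        (\<exists>a<B. \<exists>b<B. \<exists>c<B. (a, b, c) \<in> leafs \<mu> \<and> \<rho> v = G.cls a b c \<and> ?bh i \<beta> a b c))"
        using K[OF h(4)] by blast
    qed blast
    finally show ?thesis .
  qed
  show ?thesis unfolding fArc_def G.arc_def
    using e uv 1 2 tr_fPresent[OF e uv(3)] by (simp add: envD)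
qed

lemma env_cong:
  assumes "env \<rho> \<mu>" "\<And>u. u \<le> 10 \<Longrightarrow> \<rho>' u = \<rho> u" "\<mu>' Powers = \<mu> Powers"
  shows "env \<rho>' \<mu>'"
  using assms unfolding env_def by simp

lemma cur_cong:
  assumes "\<mu>' CurU = \<mu> CurU" "\<mu>' CurD = \<mu> CurD"
  shows "cU \<mu>' = cU \<mu>" "cD \<mu>' = cD \<mu>"
  using assms by (simp_all add: cU_def cD_def)

lemma mv_cGraph: "mv cGraph = {vA, vB, vLen}" and ma_cGraph: "ma cGraph = {Graph}"
  by (auto simp: cGraph_def)

lemma sem_cGraph:
  assumes e: "env \<rho> \<mu>"
  shows "holds_input (enc_ds (n, edgs \<mu>, k + 1)) (sem x B cGraph (\<rho>, \<mu>))"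
proof -
  interpret G: ds_graph N k s n "leafs \<mu>" by (rule ds_graph_leafs)
  define p where "p i j = (if i < n \<and> j < n then 2 + (n * i + j) else 2 + n * n + (B * i + j))" for i j
  define q where "q i j = (if arcs \<mu> i j \<or> arcs \<mu> j i then 1 else 0 :: nat)" for i j
  let ?c = "For vA (For vB (Write Graph iG (Ite (fOr (fArc vA vB) (fArc vB vA)) (Num 1) (Num 0))))"
  define s1 where "s1 = sem x B ?c (\<rho>, \<mu>)"
  have small: "n * i + j < n * n" if "i < n" "j < n" for i j
  proof -
    have "n * i + j < n * (i + 1)" using that by simp
    also have "\<dots> \<le> n * n" using that by (intro mult_le_mono2) auto
    finally show ?thesis .
  qed
  have mul: "ev x B \<mu>' \<rho>' (fMul 31 (Var vN) f) = n * b" if "env \<rho>' \<mu>'" "\<And>i. ev x B \<mu>' (\<rho>'(31 := i)) f = b" for \<rho>' \<mu>' f b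
    by (rule ev_fMul) (use that n in \<open>auto simp: envD\<close>)
  have fill: "snd s1 Graph (p i j) = q i j" if "i < B" "j < B" for i j
    unfolding s1_def
  proof (rule sem_fill2(1)[where p = p and q = q, OF _ _ _ that])
    fix i j \<rho>' \<mu>' assume h: "i < B" "j < B" "\<And>u. u \<noteq> vA \<Longrightarrow> u \<noteq> vB \<Longrightarrow> \<rho>' u = \<rho> u"
      "\<And>a'. a' \<noteq> Graph \<Longrightarrow> \<mu>' a' = \<mu> a'" "\<rho>' vA = i" "\<rho>' vB = j"
    have e': "env \<rho>' \<mu>'" by (rule env_cong[OF e]) (use h in auto)
    have c: "cU \<mu>' = cU \<mu>" "cD \<mu>' = cD \<mu>" by (rule cur_cong; use h(4) in simp)+
    have "ev x B \<mu>' \<rho>' iG = p i j"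
      using h(5,6) by (simp add: iG_def ev_Ite_tr p_def envD[OF e'] mul[OF e'] ev_mul_bound del: ev.simps(8))
    moreover have "ev x B \<mu>' \<rho>' (Ite (fOr (fArc vA vB) (fArc vB vA)) (Num 1) (Num 0)) = q i j"
      using h by (simp add: ev_Ite_tr q_def tr_fArc[OF e'] c del: ev.simps(8))
    ultimately show "ev x B \<mu>' \<rho>' iG = p i j \<and>
        ev x B \<mu>' \<rho>' (Ite (fOr (fArc vA vB) (fArc vB vA)) (Num 1) (Num 0)) = q i j" by blast
  next
    fix i j i' j' assume h: "i < B" "j < B" "i' < B" "j' < B" "p i j = p i' j'"
    show "i = i' \<and> j = j'"
    proof (cases "i < n \<and> j < n"; cases "i' < n \<and> j' < n")
      assume a: "i < n \<and> j < n" "i' < n \<and> j' < n"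
      then have "n * i + j = n * i' + j'" using h(5) by (simp add: p_def)
      then show ?thesis using radix_inject[of n i j i' j'] a by blast
    next
      assume a: "i < n \<and> j < n" "\<not> (i' < n \<and> j' < n)"
      then have "p i j = 2 + (n * i + j)" "p i' j' = 2 + n * n + (B * i' + j')" by (auto simp: p_def)
      then show ?thesis using h(5) small[of i j] a(1) by linarith
    next
      assume a: "\<not> (i < n \<and> j < n)" "i' < n \<and> j' < n"
      then have "p i j = 2 + n * n + (B * i + j)" "p i' j' = 2 + (n * i' + j')" by (auto simp: p_def)
      then show ?thesis using h(5) small[of i' j'] a(2) by linarith
    next
      assume a: "\<not> (i < n \<and> j < n)" "\<not> (i' < n \<and> j' < n)"
      then have "B * i + j = B * i' + j'" using h(5) unfolding p_def by (simp only: if_False a)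
      then show ?thesis using radix_inject[of B i j i' j'] h by blast
    qed
  qed simp
  have fr: "fst s1 u = \<rho> u" if "u \<noteq> vA" "u \<noteq> vB" for u
    using sem_frame_var[of u ?c x B "(\<rho>, \<mu>)"] that by (simp add: s1_def)
  have ar: "snd s1 a = \<mu> a" if "a \<noteq> Graph" for a
    using sem_frame_arr[of a ?c x B "(\<rho>, \<mu>)"] that by (simp add: s1_def)
  have e1: "env (fst s1) (snd s1)" by (rule env_cong[OF e]) (use fr ar in auto)
  define s2 where "s2 = sem x B cGraph (\<rho>, \<mu>)"
  have s2: "s2 = ((fst s1)(vLen := 2 + n * n),
      (snd s1)(Graph := (snd s1 Graph)(0 := n, 1 := k + 1)))"
  proof -
    obtain \<rho>1 \<mu>1 where p: "s1 = (\<rho>1, \<mu>1)" by fastforce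
    have e1': "env \<rho>1 \<mu>1" using e1 p by simp
    have e2: "env \<rho>1 (\<mu>1(Graph := g))" for g by (rule env_cong[OF e1']) auto
    have "s2 = sem x B (Write Graph (Num 0) (Var vN) ;; Write Graph (Num 1) (Plus (Var vK) (Num 1)) ;;
        Assign vLen (Plus (Num 2) (fMul 31 (Var vN) (Var vN)))) s1"
      unfolding s2_def cGraph_def s1_def by (simp only: sem.simps(4))
    then show ?thesis unfolding p by (simp add: envD[OF e1'] mul[OF e2])
  qed
  let ?y = "enc_ds (n, edgs \<mu>, k + 1)"
  have len: "length ?y = 2 + n * n" by (simp add: enc_ds_def length_matrix)
  have "snd s2 Graph r = ?y ! r" if r: "r < length ?y" for r
  proof -
    consider "r = 0" | "r = 1" | "2 \<le> r" by linarith
    then show ?thesis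
    proof cases
      case 3
      define i where "i = (r - 2) div n"
      define j where "j = (r - 2) mod n"
      have rn: "r - 2 < n * n" using r len 3 by linarith
      then have n0: "0 < n" by (cases n) auto
      have ij: "i < n" "j < n" unfolding i_def j_def using rn n0 by (auto simp: less_mult_imp_div_less)
      have r': "r = 2 + (n * i + j)" using 3 unfolding i_def j_def by simp
      have "snd s2 Graph r = snd s1 Graph (p i j)" unfolding s2 using 3 ij by (simp add: p_def r')
      also have "\<dots> = q i j" by (rule fill) (use ij n in auto)
      also have "\<dots> = ?y ! r"
        unfolding r' enc_ds_def using concat_matrix[OF ij, of "\<lambda>i j. if {i, j} \<in> edgs \<mu> then 1 else (0 :: nat)"]
        by (simp add: q_def G.edge_iff)
      finally show ?thesis .
    qed (auto simp: s2 enc_ds_def)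
  qed
  then show ?thesis unfolding holds_input_def s2_def[symmetric] using len by (simp add: s2)
qed

definition stU :: "heap \<Rightarrow> nat \<Rightarrow> nat set" where
  "stU \<mu> i = {a. a < 2 * N \<and> \<mu> StackU (B * i + a) \<noteq> 0}"
definition stD :: "heap \<Rightarrow> nat \<Rightarrow> (nat \<times> nat) set" where
  "stD \<mu> i = {(a, b). a < 2 * N \<and> b < 2 * N \<and> \<mu> StackD (B * (B * i + a) + b) \<noteq> 0}"

lemma ev_iU: "l \<noteq> 31 \<Longrightarrow> ev x B \<mu> \<rho> (iU l) = B * \<rho> l + \<rho> vA"
  by (simp add: iU_def ev_mul_bound)

lemma ev_iD:
  assumes "l \<noteq> 31" "l \<noteq> 37"
  shows "ev x B \<mu> \<rho> (iD l) = B * (B * \<rho> l + \<rho> vA) + \<rho> vB"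
proof -
  have 1: "ev x B \<mu> \<rho>' (fMul 37 Bound (Var l)) = B * \<rho>' l" for \<rho>' by (rule ev_fMul) (use assms in auto)
  have "ev x B \<mu> \<rho> (fMul 31 Bound (Plus (fMul 37 Bound (Var l)) (Var vA))) = B * (B * \<rho> l + \<rho> vA)"
    by (rule ev_fMul) (use assms 1 in auto)
  then show ?thesis by (simp add: iD_def)
qed

lemma mv_cPop: "mv cPop = {vA, vB}" and ma_cPop: "ma cPop = {CurU, CurD}"
  by (auto simp: cPop_def)

lemma sem_cPop:
  shows "cU (snd (sem x B cPop (\<rho>, \<mu>))) = stU \<mu> (\<rho> vLv)" "cD (snd (sem x B cPop (\<rho>, \<mu>))) = stD \<mu> (\<rho> vLv)"
proof -
  let ?c1 = "For vA (Write CurU (Var vA) (Cell StackU (iU vLv)))"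
  let ?c2 = "For vA (For vB (Write CurD (Plus (fMul 31 Bound (Var vA)) (Var vB)) (Cell StackD (iD vLv))))"
  define s1 where "s1 = sem x B ?c1 (\<rho>, \<mu>)"
  define s2 where "s2 = sem x B ?c2 s1"
  have s2: "sem x B cPop (\<rho>, \<mu>) = s2" by (simp add: cPop_def s2_def s1_def)
  have 1: "snd s1 CurU a = \<mu> StackU (B * \<rho> vLv + a)" if "a < B" for a
    unfolding s1_def
    by (rule sem_fill_at(1)[where p = "\<lambda>i. i" and q = "\<lambda>a. \<mu> StackU (B * \<rho> vLv + a)", OF _ _ that])
      (auto simp: ev_iU)
  have lv: "fst s1 vLv = \<rho> vLv" and sd: "snd s1 StackD = \<mu> StackD"
    using sem_frame_var[of vLv ?c1 x B "(\<rho>, \<mu>)"] sem_frame_arr[of StackD ?c1 x B "(\<rho>, \<mu>)"] by (simp_all add: s1_def)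
  have 2: "snd s2 CurD (B * a + b) = \<mu> StackD (B * (B * \<rho> vLv + a) + b)" if "a < B" "b < B" for a b
  proof -
    have "snd (sem x B ?c2 (fst s1, snd s1)) CurD (B * a + b) = \<mu> StackD (B * (B * \<rho> vLv + a) + b)"
    proof (rule sem_fill2(1)[where p = "\<lambda>a b. B * a + b" and q = "\<lambda>a b. \<mu> StackD (B * (B * \<rho> vLv + a) + b)", OF _ _ _ that])
      fix i j i' j' assume "i < B" "j < B" "i' < B" "j' < B" "B * i + j = B * i' + j'"
      then show "i = i' \<and> j = j'" using radix_inject by blast
    qed (use lv sd in \<open>auto simp: ev_iD ev_mul_bound\<close>)
    then show ?thesis by (simp add: s2_def)
  qed
  have 3: "snd s2 CurU = snd s1 CurU" using sem_frame_arr[of CurU ?c2 x B s1] by (simp add: s2_def)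
  show "cU (snd (sem x B cPop (\<rho>, \<mu>))) = stU \<mu> (\<rho> vLv)"
    unfolding s2 using 1 3 L by (auto simp: cU_def stU_def)
  show "cD (snd (sem x B cPop (\<rho>, \<mu>))) = stD \<mu> (\<rho> vLv)"
    unfolding s2 using 2 L by (auto simp: cD_def stD_def)
qed

lemma mv_cPush: "mv (cPush l u d) = {vA, vB}" and ma_cPush: "ma (cPush l u d) = {StackU, StackD}"
  by (auto simp: cPush_def)

text \<open>The hypotheses on \<open>u\<close> and \<open>d\<close> quantify over all contents of
  the two stacks, that is, the pushed conditions do not read the stack. The remaining levels survive
  because addresses are written in radix \<open>B\<close> with digits below
  \<open>B\<close>.\<close>

lemma sem_cPush:
  assumes l: "l \<noteq> 31" "l \<noteq> 37" "l \<noteq> vA" "l \<noteq> vB"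
    and u: "\<And>\<rho>' \<mu>'. (\<And>v. v \<noteq> vA \<Longrightarrow> v \<noteq> vB \<Longrightarrow> \<rho>' v = \<rho> v) \<Longrightarrow> (\<And>a. a \<noteq> StackU \<Longrightarrow> a \<noteq> StackD \<Longrightarrow> \<mu>' a = \<mu> a) \<Longrightarrow>
      tr x B \<mu>' \<rho>' u \<longleftrightarrow> U (\<rho>' vA)"
    and d: "\<And>\<rho>' \<mu>'. (\<And>v. v \<noteq> vA \<Longrightarrow> v \<noteq> vB \<Longrightarrow> \<rho>' v = \<rho> v) \<Longrightarrow> (\<And>a. a \<noteq> StackU \<Longrightarrow> a \<noteq> StackD \<Longrightarrow> \<mu>' a = \<mu> a) \<Longrightarrow>
      tr x B \<mu>' \<rho>' d \<longleftrightarrow> D (\<rho>' vA) (\<rho>' vB)"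
  shows "stU (snd (sem x B (cPush l u d) (\<rho>, \<mu>))) (\<rho> l) = {a. a < 2 * N \<and> U a}"
    and "stD (snd (sem x B (cPush l u d) (\<rho>, \<mu>))) (\<rho> l) = {(a, b). a < 2 * N \<and> b < 2 * N \<and> D a b}"
    and "i \<noteq> \<rho> l \<Longrightarrow> stU (snd (sem x B (cPush l u d) (\<rho>, \<mu>))) i = stU \<mu> i"
    and "i \<noteq> \<rho> l \<Longrightarrow> stD (snd (sem x B (cPush l u d) (\<rho>, \<mu>))) i = stD \<mu> i"
proof -
  let ?c1 = "For vA (Write StackU (iU l) (Ite u (Num 1) (Num 0)))"
  let ?c2 = "For vA (For vB (Write StackD (iD l) (Ite d (Num 1) (Num 0))))"
  define s1 where "s1 = sem x B ?c1 (\<rho>, \<mu>)"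
  define s2 where "s2 = sem x B ?c2 s1"
  have s2: "sem x B (cPush l u d) (\<rho>, \<mu>) = s2" by (simp add: cPush_def s2_def s1_def)
  have u': "tr x B \<mu>' \<rho>' u \<longleftrightarrow> U (\<rho>' vA)" if "\<And>v. v \<noteq> vA \<Longrightarrow> \<rho>' v = \<rho> v" "\<And>a. a \<noteq> StackU \<Longrightarrow> \<mu>' a = \<mu> a" for \<rho>' \<mu>'
    by (rule u) (use that in auto)
  note f1 = sem_fill_at[where a = StackU and v = vA and p = "\<lambda>a. B * \<rho> l + a" and q = "\<lambda>a. if U a then 1 else 0"
      and e = "iU l" and f = "Ite u (Num 1) (Num 0)" and \<rho> = \<rho> and \<mu> = \<mu> and x = x and B = B]
  have idx1: "ev x B \<mu>' \<rho>' (iU l) = B * \<rho> l + i \<and> ev x B \<mu>' \<rho>' (Ite u (Num 1) (Num 0)) = (if U i then 1 else 0)"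
    if "i < B" "\<And>v. v \<noteq> vA \<Longrightarrow> \<rho>' v = \<rho> v" "\<And>a. a \<noteq> StackU \<Longrightarrow> \<mu>' a = \<mu> a" "\<rho>' vA = i" for i \<rho>' \<mu>'
    using that l u'[of \<rho>' \<mu>', OF that(2,3)] by (simp add: ev_iU ev_Ite_tr del: ev.simps(8))
  have 1: "snd s1 StackU (B * \<rho> l + a) = (if U a then 1 else 0)" if "a < B" for a
    unfolding s1_def by (rule f1(1)) (use idx1 that in auto)
  have k1: "snd s1 StackU m = \<mu> StackU m" if "\<And>a. a < B \<Longrightarrow> m \<noteq> B * \<rho> l + a" for m
    unfolding s1_def by (rule f1(2)) (use idx1 that in auto)
  have fr: "fst s1 v = \<rho> v" if "v \<noteq> vA" for v
    using sem_frame_var[of v ?c1 x B "(\<rho>, \<mu>)"] that by (simp add: s1_def)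
  have ar: "snd s1 a = \<mu> a" if "a \<noteq> StackU" for a
    using sem_frame_arr[of a ?c1 x B "(\<rho>, \<mu>)"] that by (simp add: s1_def)
  note f2 = sem_fill2[where a = StackD and v = vA and w = vB and p = "\<lambda>a b. B * (B * \<rho> l + a) + b"
      and q = "\<lambda>a b. if D a b then 1 else 0"
      and e = "iD l" and f = "Ite d (Num 1) (Num 0)" and \<rho> = "fst s1" and \<mu> = "snd s1" and x = x and B = B]
  have idx2: "ev x B \<mu>' \<rho>' (iD l) = B * (B * \<rho> l + i) + j \<and> ev x B \<mu>' \<rho>' (Ite d (Num 1) (Num 0)) = (if D i j then 1 else 0)"
    if "i < B" "j < B" "\<And>v. v \<noteq> vA \<Longrightarrow> v \<noteq> vB \<Longrightarrow> \<rho>' v = fst s1 v" "\<And>a. a \<noteq> StackD \<Longrightarrow> \<mu>' a = snd s1 a" "\<rho>' vA = i" "\<rho>' vB = j" for i j \<rho>' \<mu>'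
  proof -
    have "tr x B \<mu>' \<rho>' d \<longleftrightarrow> D (\<rho>' vA) (\<rho>' vB)" by (rule d) (use that fr ar in auto)
    moreover have "\<rho>' l = \<rho> l" using that(3)[of l] fr[of l] l by simp
    ultimately show ?thesis using that(5,6) l by (simp add: ev_iD ev_Ite_tr del: ev.simps(8))
  qed
  have inj2: "a = a' \<and> b = b'" if "a < B" "b < B" "a' < B" "b' < B" "B * (B * \<rho> l + a) + b = B * (B * \<rho> l + a') + b'" for a b a' b'
    using radix_inject[OF that(5,2,4)] by simp
  have 2: "snd s2 StackD (B * (B * \<rho> l + a) + b) = (if D a b then 1 else 0)" if "a < B" "b < B" for a b
  proof -
    have "snd (sem x B ?c2 (fst s1, snd s1)) StackD (B * (B * \<rho> l + a) + b) = (if D a b then 1 else 0)"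
      by (rule f2(1)[OF idx2 inj2 _ that]) auto
    then show ?thesis by (simp add: s2_def)
  qed
  have k2: "snd s2 StackD m = \<mu> StackD m" if "\<And>a b. a < B \<Longrightarrow> b < B \<Longrightarrow> m \<noteq> B * (B * \<rho> l + a) + b" for m
  proof -
    have "snd (sem x B ?c2 (fst s1, snd s1)) StackD m = snd s1 StackD m"
      by (rule f2(2)[OF idx2 inj2 _ that]) auto
    then show ?thesis using ar[of StackD] by (simp add: s2_def)
  qed
  have 3: "snd s2 StackU = snd s1 StackU" using sem_frame_arr[of StackU ?c2 x B s1] by (simp add: s2_def)
  show "stU (snd (sem x B (cPush l u d) (\<rho>, \<mu>))) (\<rho> l) = {a. a < 2 * N \<and> U a}"
    unfolding s2 stU_def 3 using 1 L by (auto split: if_splits)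
  show "stD (snd (sem x B (cPush l u d) (\<rho>, \<mu>))) (\<rho> l) = {(a, b). a < 2 * N \<and> b < 2 * N \<and> D a b}"
    unfolding s2 stD_def using 2 L by (auto split: if_splits)
  have "snd s1 StackU (B * i + a) = \<mu> StackU (B * i + a)" if "i \<noteq> \<rho> l" "a < 2 * N" for a
    by (rule k1) (use that L radix_inject[of B i a "\<rho> l"] in auto)
  then show "i \<noteq> \<rho> l \<Longrightarrow> stU (snd (sem x B (cPush l u d) (\<rho>, \<mu>))) i = stU \<mu> i"
    unfolding s2 stU_def 3 by auto
  have "snd s2 StackD (B * (B * i + a) + b) = \<mu> StackD (B * (B * i + a) + b)" if "i \<noteq> \<rho> l" "a < 2 * N" "b < 2 * N" for a b
  proof (rule k2)
    fix a' b' assume h: "a' < B" "b' < B"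
    show "B * (B * i + a) + b \<noteq> B * (B * \<rho> l + a') + b'"
      using radix_inject[of B "B * i + a" b "B * \<rho> l + a'" b'] radix_inject[of B i a "\<rho> l" a'] h that L by auto
  qed
  then show "i \<noteq> \<rho> l \<Longrightarrow> stD (snd (sem x B (cPush l u d) (\<rho>, \<mu>))) i = stD \<mu> i"
    unfolding s2 stD_def by auto
qed

lemma mv_cClassify: "mv cClassify = {vA, vB, vLv, vTy, vH1, vH2}" and ma_cClassify: "ma cClassify = {CurU, CurD}"
  by (auto simp: cClassify_def mv_cPop ma_cPop)

lemma sem_cClassify:
  fixes \<rho> \<mu>
  defines "s' \<equiv> sem x B cClassify (\<rho>, \<mu>)"
  assumes e: "env \<rho> \<mu>" and sp: "\<rho> vSp = Suc i"
  shows "env (fst s') (snd s')" "cU (snd s') = stU \<mu> i" "cD (snd s') = stD \<mu> i" "fst s' vLv = i"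
    and "fst s' vTy = 0 \<and> is_leaf (stU \<mu> i) (stD \<mu> i) \<or>
      fst s' vTy = 1 \<and> flower1 (stU \<mu> i) (stD \<mu> i) (fst s' vH1) \<or>
      fst s' vTy = 2 \<and> (\<forall>a. \<not> flower1 (stU \<mu> i) (stD \<mu> i) a) \<and> flower2 (stU \<mu> i) (stD \<mu> i) (fst s' vH1) (fst s' vH2) \<or>
      fst s' vTy = 3 \<and> (\<forall>a. \<not> flower1 (stU \<mu> i) (stD \<mu> i) a) \<and> (\<forall>a b. \<not> flower2 (stU \<mu> i) (stD \<mu> i) a b) \<and>
        flower3 (stU \<mu> i) (stD \<mu> i) (fst s' vH1)"
proof -
  let ?U = "stU \<mu> i" and ?D = "stD \<mu> i"
  define s1 where "s1 = sem x B cPop (\<rho>(vLv := i), \<mu>)"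
  obtain \<rho>1 \<mu>1 where s1p: "s1 = (\<rho>1, \<mu>1)" by fastforce
  have fr: "\<rho>1 v = \<rho> v" if "v \<notin> {vA, vB, vLv}" for v
    using sem_frame_var[of v cPop x B "(\<rho>(vLv := i), \<mu>)"] that s1p s1_def by (simp add: mv_cPop)
  have lv: "\<rho>1 vLv = i"
    using sem_frame_var[of vLv cPop x B "(\<rho>(vLv := i), \<mu>)"] s1p s1_def by (simp add: mv_cPop)
  have ar: "\<mu>1 a = \<mu> a" if "a \<notin> {CurU, CurD}" for a
    using sem_frame_arr[of a cPop x B "(\<rho>(vLv := i), \<mu>)"] that s1p s1_def by (simp add: ma_cPop)
  have cu: "cU \<mu>1 = ?U" "cD \<mu>1 = ?D"
    using sem_cPop[of "\<rho>(vLv := i)" \<mu>] s1p s1_def by simp_all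
  have e1: "env \<rho>1 \<mu>1" by (rule env_cong[OF e]) (use fr ar in auto)
  define ty where "ty = ev x B \<mu>1 \<rho>1 eTy"
  define h1 where "h1 = ev x B \<mu>1 (\<rho>1(vTy := ty)) eH1"
  define h2 where "h2 = ev x B \<mu>1 (\<rho>1(vTy := ty, vH1 := h1)) eH2"
  have s': "s' = (\<rho>1(vTy := ty, vH1 := h1, vH2 := h2), \<mu>1)"
    unfolding s'_def cClassify_def ty_def h1_def h2_def using sp by (simp add: s1_def[symmetric] s1p)
  show "env (fst s') (snd s')" "cU (snd s') = stU \<mu> i" "cD (snd s') = stD \<mu> i" "fst s' vLv = i"
    using e1 cu lv by (simp_all add: s')
  have lt1: "flower1 U D a \<Longrightarrow> a < B" and lt2: "flower2 U D a b \<Longrightarrow> a < B \<and> b < B" and lt3: "flower3 U D a \<Longrightarrow> a < B"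
    for U D a b using L by (auto simp: flower1_def flower2_def flower3_def)
  let ?F1 = "\<exists>a<B. flower1 ?U ?D a" and ?F2 = "\<exists>a<B. \<exists>b<B. flower2 ?U ?D a b" and ?F3 = "\<exists>a<B. flower3 ?U ?D a"
  have ty: "ty = (if ?F1 then 1 else if ?F2 then 2 else if ?F3 then 3 else 0)"
    unfolding ty_def eTy_def using e1 by (simp add: ev_Ite_tr tr_fF1 tr_fF2 tr_fF3 cu del: ev.simps(8))
  consider (1) "?F1" "ty = 1" | (2) "\<not> ?F1" "?F2" "ty = 2" | (3) "\<not> ?F1" "\<not> ?F2" "?F3" "ty = 3"
    | (0) "\<not> ?F1" "\<not> ?F2" "\<not> ?F3" "ty = 0" using ty by presburger
  then show "fst s' vTy = 0 \<and> is_leaf (stU \<mu> i) (stD \<mu> i) \<or>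
      fst s' vTy = 1 \<and> flower1 (stU \<mu> i) (stD \<mu> i) (fst s' vH1) \<or>
      fst s' vTy = 2 \<and> (\<forall>a. \<not> flower1 (stU \<mu> i) (stD \<mu> i) a) \<and> flower2 (stU \<mu> i) (stD \<mu> i) (fst s' vH1) (fst s' vH2) \<or>
      fst s' vTy = 3 \<and> (\<forall>a. \<not> flower1 (stU \<mu> i) (stD \<mu> i) a) \<and> (\<forall>a b. \<not> flower2 (stU \<mu> i) (stD \<mu> i) a b) \<and>
        flower3 (stU \<mu> i) (stD \<mu> i) (fst s' vH1)"
  proof cases
    case 1
    then obtain a where a: "a < B" "flower1 ?U ?D a" by blast
    have "flower1 ?U ?D (ev x B \<mu>1 (\<rho>1(vTy := ty)) (fLeast 36 34 (fF1 34)))"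
      by (rule ev_fLeast(2)[where Q = "flower1 ?U ?D", OF _ _ a]) (use e1 in \<open>simp_all add: tr_fF1 cu\<close>)
    then have "flower1 ?U ?D h1" using 1(2) by (simp add: h1_def eH1_def ev_Ite_tr del: ev.simps(8))
    then show ?thesis using 1(2) by (simp add: s')
  next
    case 2
    then obtain a where a: "a < B" "\<exists>b<B. flower2 ?U ?D a b" by blast
    have "\<exists>b<B. flower2 ?U ?D (ev x B \<mu>1 (\<rho>1(vTy := ty)) (fLeast 36 34 (fEx 35 (fF2 34 35)))) b"
      by (rule ev_fLeast(2)[where Q = "\<lambda>a. \<exists>b<B. flower2 ?U ?D a b", OF _ _ a]) (use e1 in \<open>simp_all add: tr_fF2 cu\<close>)
    then have "\<exists>b<B. flower2 ?U ?D h1 b" using 2(3) by (simp add: h1_def eH1_def ev_Ite_tr del: ev.simps(8))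
    then obtain b where b: "b < B" "flower2 ?U ?D h1 b" by blast
    have "flower2 ?U ?D h1 (ev x B \<mu>1 (\<rho>1(vTy := ty, vH1 := h1)) (fLeast 36 35 (fF2 vH1 35)))"
      by (rule ev_fLeast(2)[where Q = "flower2 ?U ?D h1", OF _ _ b]) (use e1 in \<open>simp_all add: tr_fF2 cu\<close>)
    then have "flower2 ?U ?D h1 h2" by (simp add: h2_def eH2_def)
    then show ?thesis using 2(1,3) lt1 by (auto simp: s')
  next
    case 3
    then obtain a where a: "a < B" "flower3 ?U ?D a" by blast
    have "flower3 ?U ?D (ev x B \<mu>1 (\<rho>1(vTy := ty)) (fLeast 36 34 (fF3 34)))"
      by (rule ev_fLeast(2)[where Q = "flower3 ?U ?D", OF _ _ a]) (use e1 in \<open>simp_all add: tr_fF3 cu\<close>)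
    then have "flower3 ?U ?D h1" using 3(4) by (simp add: h1_def eH1_def ev_Ite_tr del: ev.simps(8))
    moreover have "\<not> flower1 ?U ?D a" "\<not> flower2 ?U ?D a b" for a b using 3(1,2) lt1 lt2 by blast+
    ultimately show ?thesis using 3(4) by (simp add: s')
  next
    case 0
    have "\<not> flower1 ?U ?D a" "\<not> flower2 ?U ?D a b" "\<not> flower3 ?U ?D a" for a b
      using 0(1-3) lt1 lt2 lt3 by blast+
    then show ?thesis using 0(4) by (simp add: s' is_leaf_def)
  qed
qed

end

section \<open>Processing a node and searching the branching tree\<close>

locale solver_round = round N \<theta>1 \<theta>2 \<theta>3 \<phi> B k s n C x
  for N \<theta>1 \<theta>2 \<theta>3 \<phi> B k s n C x +
  fixes c :: real and tm :: "nat \<Rightarrow> nat \<Rightarrow> real" and P :: "instr list"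
  assumes deg: "real (s * (1 + 2 * \<theta>1 + 3 * \<theta>3) + 2) \<le> c * log 2 (real n)"
    and correct: "\<And>n' E k'. (n', E, k') \<in> ds_instances c \<Longrightarrow>
      answers_within P (enc_ds (n', E, k')) (has_dominating_set (n', E, k')) (tm n' k')"
begin

definition sat :: "nat set \<Rightarrow> (nat \<times> nat) set \<Rightarrow> bool" where
  "sat U D \<longleftrightarrow> (\<exists>\<alpha>. models (clauses \<phi>) (holds \<alpha>) U D)"

text \<open>The absence of flowers bounds the occurrences of every literal, hence the degeneracy;
  together with \<open>deg\<close> this makes the graph a legal instance for \<open>P\<close>. At
  inner nodes the graph may be illegal and \<open>P\<close> unreliable.\<close>

lemma leaf_instance:
  assumes "good (cU \<mu>) (cD \<mu>)" "is_leaf (cU \<mu>) (cD \<mu>)"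
  shows "(n, edgs \<mu>, k + 1) \<in> ds_instances c"
    and "has_dominating_set (n, edgs \<mu>, k + 1) \<longleftrightarrow> sat (cU \<mu>) (cD \<mu>)"
proof -
  interpret G: ds_graph N k s n "leafs \<mu>" by (rule ds_graph_leafs)
  have "degeneracy {..<n} G.edges \<le> s * (1 + 2 * \<theta>1 + 3 * \<theta>3) + 2"
    by (rule G.degeneracy_le) (rule leaf_occurrences[OF assms])
  then have "real (degeneracy {..<n} G.edges) \<le> real (s * (1 + 2 * \<theta>1 + 3 * \<theta>3) + 2)" by (rule of_nat_mono)
  then have "real (degeneracy {..<n} G.edges) \<le> c * log 2 (real n)" using deg by (rule order_trans)
  then show "(n, edgs \<mu>, k + 1) \<in> ds_instances c"
    using G.simple_graph_edges n_large by (simp add: ds_instances_def)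
  show "has_dominating_set (n, edgs \<mu>, k + 1) \<longleftrightarrow> sat (cU \<mu>) (cD \<mu>)"
    unfolding G.has_dominating_set_iff sat_def leaf_clauses_models ..
qed

lemma mv_cLeaf: "mv (cLeaf P) \<subseteq> {vA, vB, vLen, vPc, vCnt, vAddr, vVal, vTick, vFail, vFound}"
  and ma_cLeaf: "ma (cLeaf P) \<subseteq> {Graph, Slot, Log, Mem}"
  using mv_sim_run[of P] ma_sim_run[of P] by (auto simp: cLeaf_def mv_cGraph ma_cGraph)

text \<open>An answer given within \<open>B\<close> steps is right even if the promised time exceeds
  \<open>B\<close>, and a missing answer shows that it does.\<close>

lemma sem_cLeaf:
  fixes \<rho> \<mu>
  defines "s' \<equiv> sem x B (cLeaf P) (\<rho>, \<mu>)"
  assumes e: "env \<rho> \<mu>" and g: "good (cU \<mu>) (cD \<mu>)" and lf: "is_leaf (cU \<mu>) (cD \<mu>)"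
  shows "fst s' vFail = \<rho> vFail \<and> fst s' vFound = (if sat (cU \<mu>) (cD \<mu>) then 1 else \<rho> vFound) \<or>
      fst s' vFail = 1 \<and> fst s' vFound = \<rho> vFound \<and> \<not> tm n (k + 1) \<le> real B"
proof -
  let ?y = "enc_ds (n, edgs \<mu>, k + 1)"
  define s1 where "s1 = sem x B cGraph (\<rho>, \<mu>)"
  define s2 where "s2 = sem x B (sim_run P) s1"
  obtain \<rho>2 \<mu>2 where s2p: "s2 = (\<rho>2, \<mu>2)" by fastforce
  have conf: "sim_config s2 = config_after P ?y B"
    unfolding s2_def s1_def by (rule sem_sim_run[OF sem_cGraph[OF e]])
  then have pc: "\<rho>2 vPc = fst (config_after P ?y B)" and mem: "mem_of \<mu>2 (\<rho>2 vCnt) = snd (config_after P ?y B)"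
    by (auto simp: sim_config_def s2p prod_eq_iff)
  have fr: "\<rho>2 v = \<rho> v" if "v = vFail \<or> v = vFound" for v
  proof -
    have "v \<notin> mv (sim_run P)" "v \<notin> mv cGraph" using that mv_sim_run[of P] by (auto simp: mv_cGraph)
    then show ?thesis using sem_frame_var[of v "sim_run P" x B s1] sem_frame_var[of v cGraph x B "(\<rho>, \<mu>)"]
      s2p unfolding s2_def s1_def by simp
  qed
  have s': "s' = sem x B (Cond (fLess (Var vPc) (Num (length P))) (Assign vFail (Num 1))
       (Cond (fEq (rd (Num 0)) (Num 1)) (Assign vFound (Num 1)) Skip)) s2"
    unfolding s'_def cLeaf_def s2_def s1_def by (simp only: sem.simps(4))
  note ans = answers_within_config[OF correct[OF leaf_instance(1)[OF g lf]], where B = B]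
  show ?thesis
  proof (cases "halted P (config_after P ?y B)")
    case True
    then have "\<not> \<rho>2 vPc < length P" by (simp add: pc halted_def)
    moreover have "mem_of \<mu>2 (\<rho>2 vCnt) 0 = (if sat (cU \<mu>) (cD \<mu>) then 1 else 0)"
      unfolding mem using ans(1)[OF True] leaf_instance(2)[OF g lf] by simp
    ultimately show ?thesis unfolding s' s2p
      using fr by (simp add: sem_Cond_tr del: sem.simps(5))
  next
    case False
    then have "\<rho>2 vPc < length P" by (simp add: pc halted_def)
    moreover have "\<not> tm n (k + 1) \<le> real B" using ans(2) False by blast
    ultimately show ?thesis unfolding s' s2p
      using fr by (simp add: sem_Cond_tr del: sem.simps(5))
  qed
qed

lemma mv_cNode: "mv (cNode P) \<subseteq> {11..29}" and ma_cNode: "Powers \<notin> ma (cNode P)"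
proof -
  have "mv (cLeaf P) \<subseteq> {11..29}" by (rule order_trans[OF mv_cLeaf]) simp
  then show "mv (cNode P) \<subseteq> {11..29}" by (simp add: cNode_def mv_cClassify mv_cPush)
  have "Powers \<notin> ma (cLeaf P)" using ma_cLeaf by blast
  then show "Powers \<notin> ma (cNode P)" by (simp add: cNode_def ma_cClassify ma_cPush)
qed

lemma sem_cNode:
  fixes \<rho> \<mu>
  defines "s' \<equiv> sem x B (cNode P) (\<rho>, \<mu>)"
  assumes e: "env \<rho> \<mu>" and sp: "\<rho> vSp = Suc i" and g: "good (stU \<mu> i) (stD \<mu> i)"
  shows "is_leaf (stU \<mu> i) (stD \<mu> i) \<and> fst s' vSp = i \<and>
      stU (snd s') = stU \<mu> \<and> stD (snd s') = stD \<mu> \<and>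
      (fst s' vFail = \<rho> vFail \<and> fst s' vFound = (if sat (stU \<mu> i) (stD \<mu> i) then 1 else \<rho> vFound) \<or>
       fst s' vFail = 1 \<and> fst s' vFound = \<rho> vFound \<and> \<not> tm n (k + 1) \<le> real B) \<or>
    branch (stU \<mu> i) (stD \<mu> i) (stU (snd s') i) (stD (snd s') i) (stU (snd s') (Suc i)) (stD (snd s') (Suc i)) \<and>
      fst s' vSp = Suc (Suc i) \<and> (\<forall>j<i. stU (snd s') j = stU \<mu> j \<and> stD (snd s') j = stD \<mu> j) \<and>
      fst s' vFail = \<rho> vFail \<and> fst s' vFound = \<rho> vFound"
proof -
  let ?U = "stU \<mu> i" and ?D = "stD \<mu> i"
  define s1 where "s1 = sem x B cClassify (\<rho>, \<mu>)"
  obtain \<rho>1 \<mu>1 where s1p: "s1 = (\<rho>1, \<mu>1)" by fastforce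
  note cl = sem_cClassify[OF e sp, folded s1_def, unfolded s1p fst_conv snd_conv]
  have fr: "\<rho>1 v = \<rho> v" if "v \<in> {vSp, vFail, vFound}" for v
    using sem_frame_var[of v cClassify x B "(\<rho>, \<mu>)"] that s1p s1_def by (auto simp: mv_cClassify)
  have ar: "\<mu>1 a = \<mu> a" if "a \<notin> {CurU, CurD}" for a
    using sem_frame_arr[of a cClassify x B "(\<rho>, \<mu>)"] that s1p s1_def by (simp add: ma_cClassify)
  have st1: "stU \<mu>1 = stU \<mu>" "stD \<mu>1 = stD \<mu>" using ar[of StackU] ar[of StackD] by (simp_all add: stU_def stD_def fun_eq_iff)
  have s': "s' = sem x B (Cond (Var vTy)
     (cPush vLv fU1 fD1 ;; cPush vSp fU2 fD2 ;; Assign vSp (Plus (Var vSp) (Num 1)))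
     (cLeaf P ;; Assign vSp (Var vLv))) s1"
    unfolding s'_def cNode_def s1_def by (simp only: sem.simps(4))
  show ?thesis
  proof (cases "\<rho>1 vTy = 0")
    case True
    define s2 where "s2 = sem x B (cLeaf P) (\<rho>1, \<mu>1)"
    have lf: "is_leaf ?U ?D" using cl(5) True by auto
    have s'': "s' = ((fst s2)(vSp := fst s2 vLv), snd s2)"
      unfolding s' s1p using True by (simp add: s2_def[symmetric]) (cases s2, simp)
    have "vLv \<notin> mv (cLeaf P)" using mv_cLeaf by auto
    then have lv: "fst s2 vLv = i" using sem_frame_var[of vLv "cLeaf P" x B "(\<rho>1, \<mu>1)"] cl(4) by (simp add: s2_def)
    have "StackU \<notin> ma (cLeaf P)" "StackD \<notin> ma (cLeaf P)" using ma_cLeaf by auto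
    then have "snd s2 StackU = \<mu>1 StackU" "snd s2 StackD = \<mu>1 StackD"
      using sem_frame_arr[of StackU "cLeaf P" x B "(\<rho>1, \<mu>1)"] sem_frame_arr[of StackD "cLeaf P" x B "(\<rho>1, \<mu>1)"]
      by (simp_all add: s2_def)
    then have "stU (snd s2) = stU \<mu>" "stD (snd s2) = stD \<mu>"
      using st1 by (simp_all add: stU_def stD_def fun_eq_iff)
    moreover have "fst s2 vFail = \<rho> vFail \<and> fst s2 vFound = (if sat ?U ?D then 1 else \<rho> vFound) \<or>
        fst s2 vFail = 1 \<and> fst s2 vFound = \<rho> vFound \<and> \<not> tm n (k + 1) \<le> real B"
      using sem_cLeaf[OF cl(1), folded s2_def] g lf fr[of vFail] fr[of vFound] unfolding cl(2,3)
      by (auto split: if_splits)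
    ultimately show ?thesis using lf lv by (simp add: s'')
  next
    case False
    define s2 where "s2 = sem x B (cPush vLv fU1 fD1) (\<rho>1, \<mu>1)"
    obtain \<rho>2 \<mu>2 where s2p: "s2 = (\<rho>2, \<mu>2)" by fastforce
    define s3 where "s3 = sem x B (cPush vSp fU2 fD2) (\<rho>2, \<mu>2)"
    obtain \<rho>3 \<mu>3 where s3p: "s3 = (\<rho>3, \<mu>3)" by fastforce
    have fr2: "\<rho>2 v = \<rho>1 v" if "v \<noteq> vA" "v \<noteq> vB" for v
      using sem_frame_var[of v "cPush vLv fU1 fD1" x B "(\<rho>1, \<mu>1)"] that s2p s2_def by (simp add: mv_cPush)
    have ar2: "\<mu>2 a = \<mu>1 a" if "a \<noteq> StackU" "a \<noteq> StackD" for a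
      using sem_frame_arr[of a "cPush vLv fU1 fD1" x B "(\<rho>1, \<mu>1)"] that s2p s2_def by (simp add: ma_cPush)
    have fr3: "\<rho>3 v = \<rho>1 v" if "v \<noteq> vA" "v \<noteq> vB" for v
      using sem_frame_var[of v "cPush vSp fU2 fD2" x B "(\<rho>2, \<mu>2)"] that s3p s3_def fr2 by (simp add: mv_cPush)
    have s'': "s' = (\<rho>3(vSp := Suc (Suc i)), \<mu>3)"
      unfolding s' s1p using False fr3[of vSp] fr[of vSp] sp
      by (simp add: s2_def[symmetric] s2p s3_def[symmetric] s3p)
    define ty h1 h2 where "ty = \<rho>1 vTy" and "h1 = \<rho>1 vH1" and "h2 = \<rho>1 vH2"
    define act' where "act' = act (clauses \<phi>) ?U ?D"
    \<comment> \<open>Any state in the middle of pushing: the stack may have changed, but the copy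
      of the parent and its flower have not.\<close>
    have evs: "env \<rho>' \<mu>'" "cU \<mu>' = ?U" "cD \<mu>' = ?D" "\<mu>' CurU = \<mu>1 CurU" "\<mu>' CurD = \<mu>1 CurD"
      "\<rho>' vTy = ty" "\<rho>' vH1 = h1" "\<rho>' vH2 = h2"
      if h: "\<And>v. v \<noteq> vA \<Longrightarrow> v \<noteq> vB \<Longrightarrow> \<rho>' v = \<rho>1 v" "\<And>a. a \<noteq> StackU \<Longrightarrow> a \<noteq> StackD \<Longrightarrow> \<mu>' a = \<mu>1 a" for \<rho>' \<mu>'
    proof -
      show "env \<rho>' \<mu>'" by (rule env_cong[OF cl(1)]) (use h in auto)
      show "cU \<mu>' = ?U" "cD \<mu>' = ?D" using cur_cong[of \<mu>' \<mu>1] h(2) cl(2,3) by auto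
    qed (use h in \<open>auto simp: ty_def h1_def h2_def\<close>)
    have push1: "stU \<mu>2 i = {a. a < 2 * N \<and> (\<mu>1 CurU a \<noteq> 0 \<or> ty \<noteq> 2 \<and> a = h1)}"
      "stD \<mu>2 i = {(a, b). a < 2 * N \<and> b < 2 * N \<and> (\<mu>1 CurD (B * a + b) \<noteq> 0 \<or> ty = 2 \<and> (a = h1 \<and> b = h2 \<or> a = h2 \<and> b = h1))}"
      "\<And>j. j \<noteq> i \<Longrightarrow> stU \<mu>2 j = stU \<mu> j" "\<And>j. j \<noteq> i \<Longrightarrow> stD \<mu>2 j = stD \<mu> j"
    proof -
      have u: "tr x B \<mu>' \<rho>' fU1 \<longleftrightarrow> \<mu>1 CurU (\<rho>' vA) \<noteq> 0 \<or> ty \<noteq> 2 \<and> \<rho>' vA = h1"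
        if h: "\<And>v. v \<noteq> vA \<Longrightarrow> v \<noteq> vB \<Longrightarrow> \<rho>' v = \<rho>1 v" "\<And>a. a \<noteq> StackU \<Longrightarrow> a \<noteq> StackD \<Longrightarrow> \<mu>' a = \<mu>1 a" for \<rho>' \<mu>'
        using evs[OF h] by (simp add: fU1_def tr_fU)
      have d: "tr x B \<mu>' \<rho>' fD1 \<longleftrightarrow> \<mu>1 CurD (B * \<rho>' vA + \<rho>' vB) \<noteq> 0 \<or>
          ty = 2 \<and> (\<rho>' vA = h1 \<and> \<rho>' vB = h2 \<or> \<rho>' vA = h2 \<and> \<rho>' vB = h1)"
        if h: "\<And>v. v \<noteq> vA \<Longrightarrow> v \<noteq> vB \<Longrightarrow> \<rho>' v = \<rho>1 v" "\<And>a. a \<noteq> StackU \<Longrightarrow> a \<noteq> StackD \<Longrightarrow> \<mu>' a = \<mu>1 a" for \<rho>' \<mu>'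
        using evs[OF h] by (simp add: fD1_def tr_fD)
      note p = sem_cPush[where l = vLv and u = fU1 and d = fD1 and \<rho> = \<rho>1 and \<mu> = \<mu>1
          and U = "\<lambda>a. \<mu>1 CurU a \<noteq> 0 \<or> ty \<noteq> 2 \<and> a = h1"
          and D = "\<lambda>a b. \<mu>1 CurD (B * a + b) \<noteq> 0 \<or> ty = 2 \<and> (a = h1 \<and> b = h2 \<or> a = h2 \<and> b = h1)",
          OF _ _ _ _ u d, folded s2_def, unfolded s2p snd_conv cl(4) st1]
      show "stU \<mu>2 i = {a. a < 2 * N \<and> (\<mu>1 CurU a \<noteq> 0 \<or> ty \<noteq> 2 \<and> a = h1)}" by (rule p(1)) auto
      show "stD \<mu>2 i = {(a, b). a < 2 * N \<and> b < 2 * N \<and> (\<mu>1 CurD (B * a + b) \<noteq> 0 \<or> ty = 2 \<and> (a = h1 \<and> b = h2 \<or> a = h2 \<and> b = h1))}"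
        by (rule p(2)) auto
      show "\<And>j. j \<noteq> i \<Longrightarrow> stU \<mu>2 j = stU \<mu> j" by (rule p(3)) auto
      show "\<And>j. j \<noteq> i \<Longrightarrow> stD \<mu>2 j = stD \<mu> j" by (rule p(4)) auto
    qed
    have sp2: "\<rho>2 vSp = Suc i" using fr2[of vSp] fr[of vSp] sp by simp
    have push2: "stU \<mu>3 (Suc i) = {a. a < 2 * N \<and> (\<mu>1 CurU a \<noteq> 0 \<or> ty = 1 \<and> \<mu>1 CurD (B * h1 + a) \<noteq> 0 \<or> ty = 2 \<and> (h1, h2, a) \<in> act')}"
      "stD \<mu>3 (Suc i) = {(a, b). a < 2 * N \<and> b < 2 * N \<and> (\<mu>1 CurD (B * a + b) \<noteq> 0 \<or> ty = 3 \<and> (h1, a, b) \<in> act')}"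
      "\<And>j. j \<noteq> Suc i \<Longrightarrow> stU \<mu>3 j = stU \<mu>2 j" "\<And>j. j \<noteq> Suc i \<Longrightarrow> stD \<mu>3 j = stD \<mu>2 j"
    proof -
      have u: "tr x B \<mu>' \<rho>' fU2 \<longleftrightarrow> \<mu>1 CurU (\<rho>' vA) \<noteq> 0 \<or> ty = 1 \<and> \<mu>1 CurD (B * h1 + \<rho>' vA) \<noteq> 0 \<or> ty = 2 \<and> (h1, h2, \<rho>' vA) \<in> act'"
        if h: "\<And>v. v \<noteq> vA \<Longrightarrow> v \<noteq> vB \<Longrightarrow> \<rho>' v = \<rho>2 v" "\<And>a. a \<noteq> StackU \<Longrightarrow> a \<noteq> StackD \<Longrightarrow> \<mu>' a = \<mu>2 a" for \<rho>' \<mu>'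
      proof -
        have h1: "\<And>v. v \<noteq> vA \<Longrightarrow> v \<noteq> vB \<Longrightarrow> \<rho>' v = \<rho>1 v" and h2: "\<And>a. a \<noteq> StackU \<Longrightarrow> a \<noteq> StackD \<Longrightarrow> \<mu>' a = \<mu>1 a"
          using h fr2 ar2 by auto
        show ?thesis using evs[OF h1 h2] by (simp add: fU2_def tr_fU tr_fD tr_fAct act'_def)
      qed
      have d: "tr x B \<mu>' \<rho>' fD2 \<longleftrightarrow> \<mu>1 CurD (B * \<rho>' vA + \<rho>' vB) \<noteq> 0 \<or> ty = 3 \<and> (h1, \<rho>' vA, \<rho>' vB) \<in> act'"
        if h: "\<And>v. v \<noteq> vA \<Longrightarrow> v \<noteq> vB \<Longrightarrow> \<rho>' v = \<rho>2 v" "\<And>a. a \<noteq> StackU \<Longrightarrow> a \<noteq> StackD \<Longrightarrow> \<mu>' a = \<mu>2 a" for \<rho>' \<mu>'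
      proof -
        have h1: "\<And>v. v \<noteq> vA \<Longrightarrow> v \<noteq> vB \<Longrightarrow> \<rho>' v = \<rho>1 v" and h2: "\<And>a. a \<noteq> StackU \<Longrightarrow> a \<noteq> StackD \<Longrightarrow> \<mu>' a = \<mu>1 a"
          using h fr2 ar2 by auto
        show ?thesis using evs[OF h1 h2] by (simp add: fD2_def tr_fD tr_fAct act'_def)
      qed
      note p = sem_cPush[where l = vSp and u = fU2 and d = fD2 and \<rho> = \<rho>2 and \<mu> = \<mu>2
          and U = "\<lambda>a. \<mu>1 CurU a \<noteq> 0 \<or> ty = 1 \<and> \<mu>1 CurD (B * h1 + a) \<noteq> 0 \<or> ty = 2 \<and> (h1, h2, a) \<in> act'"
          and D = "\<lambda>a b. \<mu>1 CurD (B * a + b) \<noteq> 0 \<or> ty = 3 \<and> (h1, a, b) \<in> act'",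
          OF _ _ _ _ u d, folded s3_def, unfolded s3p snd_conv sp2]
      show "stU \<mu>3 (Suc i) = {a. a < 2 * N \<and> (\<mu>1 CurU a \<noteq> 0 \<or> ty = 1 \<and> \<mu>1 CurD (B * h1 + a) \<noteq> 0 \<or> ty = 2 \<and> (h1, h2, a) \<in> act')}"
        by (rule p(1)) auto
      show "stD \<mu>3 (Suc i) = {(a, b). a < 2 * N \<and> b < 2 * N \<and> (\<mu>1 CurD (B * a + b) \<noteq> 0 \<or> ty = 3 \<and> (h1, a, b) \<in> act')}"
        by (rule p(2)) auto
      show "\<And>j. j \<noteq> Suc i \<Longrightarrow> stU \<mu>3 j = stU \<mu>2 j" by (rule p(3)) auto
      show "\<And>j. j \<noteq> Suc i \<Longrightarrow> stD \<mu>3 j = stD \<mu>2 j" by (rule p(4)) auto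
    qed
    have U: "?U = {a. a < 2 * N \<and> \<mu>1 CurU a \<noteq> 0}" and D: "?D = {(a, b). a < 2 * N \<and> b < 2 * N \<and> \<mu>1 CurD (B * a + b) \<noteq> 0}"
      using cl(2,3) by (auto simp: cU_def cD_def)
    have alt: "a < 2 * N \<and> b < 2 * N \<and> d < 2 * N" if "(a, b, d) \<in> act'" for a b d
      using that act_lt unfolding act'_def by blast
    have "branch ?U ?D (stU \<mu>3 i) (stD \<mu>3 i) (stU \<mu>3 (Suc i)) (stD \<mu>3 (Suc i))"
    proof -
      have st3: "stU \<mu>3 i = stU \<mu>2 i" "stD \<mu>3 i = stD \<mu>2 i" using push2(3,4) by auto
      consider (1) "ty = 1" "flower1 ?U ?D h1" | (2) "ty = 2" "\<forall>a. \<not> flower1 ?U ?D a" "flower2 ?U ?D h1 h2"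
        | (3) "ty = 3" "\<forall>a. \<not> flower1 ?U ?D a" "\<forall>a b. \<not> flower2 ?U ?D a b" "flower3 ?U ?D h1"
        using cl(5) False unfolding ty_def h1_def h2_def by auto
      then show ?thesis
      proof cases
        case 1
        have lt: "h1 < 2 * N" using 1(2) by (simp add: flower1_def)
        have "stU \<mu>2 i = insert h1 ?U" unfolding push1(1) U using lt 1(1) by auto
        moreover have "stD \<mu>2 i = ?D" unfolding push1(2) D using 1(1) by auto
        moreover have "stU \<mu>3 (Suc i) = ?U \<union> nbr ?U ?D h1" unfolding push2(1) nbr_def
          using 1(1) lt by (auto simp: U D)
        moreover have "stD \<mu>3 (Suc i) = ?D" unfolding push2(2) D using 1(1) by auto
        ultimately show ?thesis unfolding branch_def st3 using 1(2) by blast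
      next
        case 2
        have lt: "h1 < 2 * N" "h2 < 2 * N" using 2(3) by (auto simp: flower2_def)
        have "stU \<mu>2 i = ?U" unfolding push1(1) U using 2(1) by auto
        moreover have "stD \<mu>2 i = ?D \<union> {(h1, h2), (h2, h1)}" unfolding push1(2) D using 2(1) lt by auto
        moreover have "stU \<mu>3 (Suc i) = ?U \<union> {d. (h1, h2, d) \<in> act'}" unfolding push2(1) U
          using 2(1) alt by auto
        moreover have "stD \<mu>3 (Suc i) = ?D" unfolding push2(2) D using 2(1) by auto
        ultimately show ?thesis unfolding branch_def st3 act'_def using 2(2,3) by blast
      next
        case 3
        have lt: "h1 < 2 * N" using 3(4) by (simp add: flower3_def)
        have "stU \<mu>2 i = insert h1 ?U" unfolding push1(1) U using lt 3(1) by auto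
        moreover have "stD \<mu>2 i = ?D" unfolding push1(2) D using 3(1) by auto
        moreover have "stU \<mu>3 (Suc i) = ?U" unfolding push2(1) U using 3(1) by auto
        moreover have "stD \<mu>3 (Suc i) = ?D \<union> {(b, d). (h1, b, d) \<in> act'}" unfolding push2(2) D
          using 3(1) alt by auto
        ultimately show ?thesis unfolding branch_def st3 act'_def using 3(2-4) by blast
      qed
    qed
    moreover have "\<forall>j<i. stU \<mu>3 j = stU \<mu> j \<and> stD \<mu>3 j = stD \<mu> j" using push1(3,4) push2(3,4) by auto
    moreover have "\<rho>3 vFail = \<rho> vFail" "\<rho>3 vFound = \<rho> vFound" using fr3[of vFail] fr3[of vFound] fr[of vFail] fr[of vFound] by auto
    ultimately show ?thesis unfolding s'' by simp
  qed
qed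

end

lemma tr_Var: "tr x B \<mu> \<rho> (Var v) \<longleftrightarrow> \<rho> v \<noteq> 0"
  by (simp add: tr_def)

definition contracting :: "nat \<Rightarrow> nat \<Rightarrow> nat \<Rightarrow> real \<Rightarrow> bool" where
  "contracting \<theta>1 \<theta>2 \<theta>3 X \<longleftrightarrow> 1 \<le> \<theta>1 \<and> 1 \<le> \<theta>2 \<and> 1 \<le> \<theta>3 \<and> 1 \<le> X \<and>
     1 / X ^ (\<theta>1 + \<theta>2) + 1 / X ^ (\<theta>1 * (\<theta>1 + \<theta>2)) \<le> 1 \<and>
     1 / X ^ 1 + 1 / X ^ (\<theta>2 * (\<theta>1 + \<theta>2)) \<le> 1 \<and>
     1 / X ^ (\<theta>1 + \<theta>2) + 1 / X ^ \<theta>3 \<le> 1"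

context solver_round
begin

text \<open>Only termination depends on this condition. A try with other parameters may fail or run
  out of iterations, but it never ends with a wrong answer.\<close>

definition fast :: "real \<Rightarrow> bool" where
  "fast X \<longleftrightarrow> tm n (k + 1) \<le> real B \<and> contracting \<theta>1 \<theta>2 \<theta>3 X"

lemma root_weight: "weight X {} {} = 2 * X powr (3 * real (\<theta>1 + \<theta>2) * real (2 * N)) - 1"
  by (simp add: weight_def pot_def free_pairs_def)

text \<open>The weights of the nodes on the stack bound the number of remaining iterations.\<close>

definition search_inv :: "real \<Rightarrow> nat \<Rightarrow> store \<times> heap \<Rightarrow> bool" where
  "search_inv X it z \<longleftrightarrow> env (fst z) (snd z) \<and>
     (\<forall>i<fst z vSp. good (stU (snd z) i) (stD (snd z) i)) \<and> fst z vFound \<le> 1 \<and>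
     (fst z vFail = 0 \<longrightarrow>
       ((fst z vFound = 1 \<or> (\<exists>i<fst z vSp. sat (stU (snd z) i) (stD (snd z) i))) \<longleftrightarrow> sat {} {})) \<and>
     (fast X \<longrightarrow> fst z vFail = 0 \<and> (\<forall>i<fst z vSp. slim (stU (snd z) i) (stD (snd z) i)) \<and>
       (0 < fst z vSp \<longrightarrow>
         (\<Sum>i<fst z vSp. weight X (stU (snd z) i) (stD (snd z) i)) + real it \<le> weight X {} {}))"

text \<open>A leaf removes weight at least 1 from the stack, and a branch replaces a node by two
  whose weights sum to at least 1 less; either pays for the iteration. Satisfiability of the input
  stays equivalent to having found a satisfiable leaf or keeping a satisfiable node, and a failure
  makes this part of the invariant void.\<close>

lemma search_inv_step:
  assumes "search_inv X it (\<rho>, \<mu>)"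
  shows "search_inv X (Suc it) (sem x B (Cond (Var vSp) (cNode P) Skip) (\<rho>(vIt := it), \<mu>))"
proof (cases "\<rho> vSp")
  case 0
  then show ?thesis using assms by (simp add: search_inv_def)
next
  case (Suc i)
  let ?\<rho> = "\<rho>(vIt := it)"
  define s' where "s' = sem x B (cNode P) (?\<rho>, \<mu>)"
  have s': "sem x B (Cond (Var vSp) (cNode P) Skip) (?\<rho>, \<mu>) = s'" using Suc by (simp add: s'_def)
  let ?U = "stU \<mu> i" and ?D = "stD \<mu> i"
  have inv: "env \<rho> \<mu>" "\<And>j. j < Suc i \<Longrightarrow> good (stU \<mu> j) (stD \<mu> j)" "\<rho> vFound \<le> 1"
    "\<rho> vFail = 0 \<Longrightarrow> (\<rho> vFound = 1 \<or> (\<exists>j<Suc i. sat (stU \<mu> j) (stD \<mu> j))) \<longleftrightarrow> sat {} {}"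
    and invf: "fast X \<Longrightarrow> \<rho> vFail = 0" "\<And>j. fast X \<Longrightarrow> j < Suc i \<Longrightarrow> slim (stU \<mu> j) (stD \<mu> j)"
      "fast X \<Longrightarrow> (\<Sum>j<Suc i. weight X (stU \<mu> j) (stD \<mu> j)) + real it \<le> weight X {} {}"
    using assms Suc by (auto simp: search_inv_def)
  have e: "env ?\<rho> \<mu>" using inv(1) by simp
  have env': "env (fst s') (snd s')"
  proof (rule env_cong[OF e])
    fix u :: nat assume "u \<le> 10"
    then have "u \<notin> mv (cNode P)" using mv_cNode by auto
    then show "fst s' u = ?\<rho> u" using sem_frame_var[of u "cNode P" x B "(?\<rho>, \<mu>)"] by (simp add: s'_def)
  next
    show "snd s' Powers = \<mu> Powers" using sem_frame_arr[OF ma_cNode, of x B "(?\<rho>, \<mu>)"] by (simp add: s'_def)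
  qed
  have g: "good ?U ?D" using inv(2)[of i] by simp
  have ex_Suc: "(\<exists>j<Suc m. Q j) \<longleftrightarrow> (\<exists>j<m. Q j) \<or> Q m" for Q m by (auto simp: less_Suc_eq)
  have sp: "?\<rho> vSp = Suc i" using Suc by simp
  from sem_cNode[OF e sp g, folded s'_def]
  consider (leaf) "is_leaf ?U ?D" "fst s' vSp = i" "stU (snd s') = stU \<mu>" "stD (snd s') = stD \<mu>"
      "fst s' vFail = \<rho> vFail" "fst s' vFound = (if sat ?U ?D then 1 else \<rho> vFound)"
    | (fail) "fst s' vSp = i" "stU (snd s') = stU \<mu>" "stD (snd s') = stD \<mu>"
      "fst s' vFail = 1" "fst s' vFound = \<rho> vFound" "\<not> tm n (k + 1) \<le> real B"
    | (branch) "branch ?U ?D (stU (snd s') i) (stD (snd s') i) (stU (snd s') (Suc i)) (stD (snd s') (Suc i))"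
      "fst s' vSp = Suc (Suc i)" "\<And>j. j < i \<Longrightarrow> stU (snd s') j = stU \<mu> j \<and> stD (snd s') j = stD \<mu> j"
      "fst s' vFail = \<rho> vFail" "fst s' vFound = \<rho> vFound"
    by auto
  then have "search_inv X (Suc it) s'"
  proof cases
    case leaf
    have "(\<Sum>j<i. weight X (stU \<mu> j) (stD \<mu> j)) + real (Suc it) \<le> weight X {} {}" if f: "fast X"
    proof -
      have "1 \<le> weight X ?U ?D"
        by (rule weight_ge_1[OF g invf(2)[OF f]]) (use f in \<open>auto simp: fast_def contracting_def\<close>)
      then show ?thesis using invf(3)[OF f] by simp
    qed
    moreover have "fst s' vFound \<le> 1" using leaf(6) inv(3) by (cases "sat ?U ?D") auto
    moreover have "(fst s' vFound = 1 \<or> (\<exists>j<i. sat (stU \<mu> j) (stD \<mu> j))) \<longleftrightarrow> sat {} {}" if "\<rho> vFail = 0"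
      using inv(4)[OF that] leaf(6) unfolding ex_Suc by (cases "sat ?U ?D") auto
    ultimately show ?thesis unfolding search_inv_def leaf(2-5) using env' inv(2) invf(1,2) by auto
  next
    case fail
    then show ?thesis using env' inv invf unfolding search_inv_def by (auto simp: fast_def contracting_def)
  next
    case branch
    define U1 D1 U2 D2 where "U1 = stU (snd s') i" and "D1 = stD (snd s') i"
      and "U2 = stU (snd s') (Suc i)" and "D2 = stD (snd s') (Suc i)"
    note defs = U1_def D1_def U2_def D2_def
    have br: "branch ?U ?D U1 D1 U2 D2" using branch(1) by (simp add: defs)
    have sat: "sat ?U ?D \<longleftrightarrow> sat U1 D1 \<or> sat U2 D2" unfolding sat_def using branch_models[OF br] by blast
    have good: "good (stU (snd s') j) (stD (snd s') j)" if "j < Suc (Suc i)" for j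
      using that branch_good[OF g br] inv(2) branch(3) by (auto simp: less_Suc_eq defs)
    have slim: "slim (stU (snd s') j) (stD (snd s') j)" if "j < Suc (Suc i)" "fast X" for j
      using that branch_slim[OF g invf(2)[of i] _ br] invf(2) branch(3) by (auto simp: less_Suc_eq defs fast_def contracting_def)
    have "(\<Sum>j<Suc (Suc i). weight X (stU (snd s') j) (stD (snd s') j)) + real (Suc it) \<le> weight X {} {}" if f: "fast X"
    proof -
      have "weight X U1 D1 + weight X U2 D2 + 1 \<le> weight X ?U ?D"
        by (rule branch_weight[OF g invf(2)[OF f] br]) (use f in \<open>auto simp: fast_def contracting_def\<close>)
      moreover have "(\<Sum>j<i. weight X (stU (snd s') j) (stD (snd s') j)) = (\<Sum>j<i. weight X (stU \<mu> j) (stD \<mu> j))"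
        by (rule sum.cong) (use branch(3) in auto)
      ultimately show ?thesis using invf(3)[OF f] by (simp add: defs)
    qed
    moreover have "(\<exists>j<Suc (Suc i). sat (stU (snd s') j) (stD (snd s') j)) \<longleftrightarrow> (\<exists>j<Suc i. sat (stU \<mu> j) (stD \<mu> j))"
      unfolding ex_Suc using branch(3) sat by (auto simp: defs)
    ultimately show ?thesis using env' inv(3,4) invf(1) good slim branch(2,4,5) unfolding search_inv_def by auto
  qed
  then show ?thesis unfolding s' .
qed

lemma mv_cTry: "mv (cTry P) \<subseteq> {1, 2} \<union> {11..29}" and ma_cTry: "Powers \<notin> ma (cTry P)"
  using mv_cNode ma_cNode by (auto simp: cTry_def mv_cPush ma_cPush)

lemma sem_cTry:
  fixes \<rho> \<mu>
  defines "s' \<equiv> sem x B (cTry P) (\<rho>, \<mu>)"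
  assumes e: "env \<rho> \<mu>" and d: "\<rho> vDone = 0"
  shows "fst s' vDone = 0 \<or> fst s' vDone = 1 \<and> fst s' vAns = (if sat {} {} then 1 else 0)"
    and "fast X \<Longrightarrow> weight X {} {} \<le> real B \<Longrightarrow> fst s' vDone = 1"
proof -
  let ?\<rho> = "\<rho>(vFound := 0, vFail := 0, vLv := 0)"
  define s1 where "s1 = sem x B (cPush vLv (Num 0) (Num 0)) (?\<rho>, \<mu>)"
  obtain \<rho>1 \<mu>1 where s1p: "s1 = (\<rho>1, \<mu>1)" by fastforce
  define s2 where "s2 = sem x B (For vIt (Cond (Var vSp) (cNode P) Skip)) (\<rho>1(vSp := 1), \<mu>1)"
  obtain \<rho>2 \<mu>2 where s2p: "s2 = (\<rho>2, \<mu>2)" by fastforce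
  let ?end = "Cond (fAnd (fNot (Var vSp)) (fNot (Var vFail))) (Assign vDone (Num 1) ;; Assign vAns (Var vFound)) Skip"
  have s': "s' = sem x B ?end s2"
    unfolding s'_def cTry_def s2_def using s1p s1_def by simp
  have fr: "\<rho>1 v = ?\<rho> v" if "v \<noteq> vA" "v \<noteq> vB" for v
    using sem_frame_var[of v "cPush vLv (Num 0) (Num 0)" x B "(?\<rho>, \<mu>)"] that s1p s1_def by (simp add: mv_cPush)
  have ar: "\<mu>1 a = \<mu> a" if "a \<noteq> StackU" "a \<noteq> StackD" for a
    using sem_frame_arr[of a "cPush vLv (Num 0) (Num 0)" x B "(?\<rho>, \<mu>)"] that s1p s1_def by (simp add: ma_cPush)
  have e1: "env \<rho>1 \<mu>1" by (rule env_cong[OF e]) (use fr ar in auto)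
  have root: "stU \<mu>1 0 = {}" "stD \<mu>1 0 = {}"
    using sem_cPush(1,2)[where l = vLv and u = "Num 0" and d = "Num 0" and \<rho> = ?\<rho> and \<mu> = \<mu>
        and U = "\<lambda>_. False" and D = "\<lambda>_ _. False", folded s1_def]
    by (simp_all add: s1p tr_def)
  have root_good: "good {} {}" and root_slim: "slim {} {}" by (auto simp: good_def slim_def nbr_def)
  have inv: "search_inv X B s2" for X
    unfolding s2_def
  proof (rule sem_For_inv[where I = "search_inv X"])
    show "search_inv X 0 (\<rho>1(vSp := 1), \<mu>1)"
      using e1 root root_good root_slim fr[of vFound] fr[of vFail] by (simp add: search_inv_def)
    fix i s assume "search_inv X i s"
    then show "search_inv X (Suc i) (sem x B (Cond (Var vSp) (cNode P) Skip) ((fst s)(vIt := i), snd s))"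
      using search_inv_step[of X i "fst s" "snd s"] by simp
  qed
  have d2: "\<rho>2 vDone = 0"
  proof -
    have "vDone \<notin> mv (For vIt (Cond (Var vSp) (cNode P) Skip))" using mv_cNode by auto
    from sem_frame_var[OF this, of x B "(\<rho>1(vSp := 1), \<mu>1)"] show ?thesis
      using s2p fr[of vDone] d unfolding s2_def by simp
  qed
  show "fst s' vDone = 0 \<or> fst s' vDone = 1 \<and> fst s' vAns = (if sat {} {} then 1 else 0)"
  proof (cases "\<rho>2 vSp = 0 \<and> \<rho>2 vFail = 0")
    case True
    then have "\<rho>2 vFound = (if sat {} {} then 1 else 0)" using inv[of 1] by (auto simp: search_inv_def s2p)
    then show ?thesis unfolding s' s2p using True by (simp add: sem_Cond_tr tr_Var del: sem.simps(5))
  next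
    case False
    then show ?thesis unfolding s' s2p using d2 by (auto simp: sem_Cond_tr tr_Var simp del: sem.simps(5))
  qed
  show "fst s' vDone = 1" if f: "fast X" "weight X {} {} \<le> real B"
  proof -
    have "\<rho>2 vSp = 0"
    proof (rule ccontr)
      assume sp: "\<rho>2 vSp \<noteq> 0"
      have w: "1 \<le> weight X (stU \<mu>2 i) (stD \<mu>2 i)" if "i < \<rho>2 vSp" for i
        by (rule weight_ge_1) (use inv[of X] that f in \<open>auto simp: search_inv_def s2p fast_def contracting_def\<close>)
      have "1 \<le> (\<Sum>i<\<rho>2 vSp. weight X (stU \<mu>2 i) (stD \<mu>2 i))"
      proof -
        have "real (\<rho>2 vSp) = (\<Sum>i<\<rho>2 vSp. 1)" by simp
        also have "\<dots> \<le> (\<Sum>i<\<rho>2 vSp. weight X (stU \<mu>2 i) (stD \<mu>2 i))" by (rule sum_mono) (use w in auto)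
        finally show ?thesis using sp by linarith
      qed
      \<comment> \<open>After \<open>B\<close> iterations the root weight is used up, while every
        node still on the stack would have weight at least 1.\<close>
      moreover have "(\<Sum>i<\<rho>2 vSp. weight X (stU \<mu>2 i) (stD \<mu>2 i)) + real B \<le> weight X {} {}"
        using inv[of X] f sp by (simp add: search_inv_def s2p)
      ultimately show False using f(2) by linarith
    qed
    moreover have "\<rho>2 vFail = 0" using inv[of X] f by (simp add: search_inv_def s2p)
    ultimately show ?thesis unfolding s' s2p by (simp add: sem_Cond_tr tr_Var del: sem.simps(5))
  qed
qed

end

section \<open>Trying all parameters\<close>

lemma sparsification_clauses:
  assumes "(N, \<phi>) \<in> sat3_instances"
  shows "sparsification (2 * N) (clauses \<phi>)"
proof
  have "t \<in> {..<2 * N} \<times> {..<2 * N} \<times> {..<2 * N}" if "t \<in> lit_triple ` set \<phi>" for t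
    using assms that by (fastforce simp: sat3_instances_def lit_triple_def enc_literal_def)
  then show "clauses \<phi> \<subseteq> {..<2 * N} \<times> {..<2 * N} \<times> {..<2 * N}"
    unfolding subset_iff by (auto simp: clauses_iff)
qed (auto simp: clauses_iff)

locale main_program =
  fixes N :: nat and \<phi> :: "clause3 list" and c :: real and tm :: "nat \<Rightarrow> nat \<Rightarrow> real"
    and P :: "instr list" and C :: nat and x :: "nat list"
  assumes inst: "(N, \<phi>) \<in> sat3_instances" and x: "x = enc_sat3 (N, \<phi>)"
    and c: "0 < c" "1 \<le> c * real C"
    and correct: "\<And>n' E k'. (n', E, k') \<in> ds_instances c \<Longrightarrow>
      answers_within P (enc_ds (n', E, k')) (has_dominating_set (n', E, k')) (tm n' k')"
begin

definition guard :: "nat \<Rightarrow> nat \<Rightarrow> nat \<Rightarrow> nat \<Rightarrow> nat \<Rightarrow> nat \<Rightarrow> bool" where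
  "guard B \<theta>1 \<theta>3 k s n \<longleftrightarrow> length x < B \<and> 2 * N < B \<and> C + 3 < B \<and> k < B \<and> s < B \<and> n < B \<and> N \<le> k * s \<and>
     2 + k + k * 2 ^ s + 2 * N * (2 * N * (2 * N)) \<le> n \<and>
     C * (s * (1 + 2 * \<theta>1 + 3 * \<theta>3) + 2) < B \<and> 2 ^ (C * (s * (1 + 2 * \<theta>1 + 3 * \<theta>3) + 2)) \<le> n"

text \<open>Holds between any two tries and mentions no loop parameter. The answer is constrained
  once \<open>vDone\<close> is set, which is the soundness of the program.\<close>

definition ready :: "nat \<Rightarrow> store \<times> heap \<Rightarrow> bool" where
  "ready B s \<longleftrightarrow> fst s vIn = length x \<and> fst s vL = 2 * N \<and> (\<forall>i\<le>B. snd s Powers i = 2 ^ i) \<and>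
     (fst s vDone \<noteq> 0 \<longrightarrow> fst s vAns = (if satisfiable3 \<phi> then 1 else 0))"

lemma tr_fGuard:
  assumes "ready B (\<rho>, \<mu>)"
  shows "tr x B \<mu> \<rho> (fGuard C) \<longleftrightarrow> guard B (\<rho> vT1) (\<rho> vT3) (\<rho> vK) (\<rho> vS) (\<rho> vN)"
proof (cases "length x < B \<and> 2 * N < B \<and> C + 3 < B \<and> \<rho> vK < B \<and> \<rho> vS < B \<and> \<rho> vN < B")
  case True
  let ?\<Delta> = "1 + 2 * \<rho> vT1 + 3 * \<rho> vT3"
  have r: "\<rho> 0 = length x" "\<rho> 10 = 2 * N" "\<And>i. i \<le> B \<Longrightarrow> \<mu> Powers i = 2 ^ i" using assms by (auto simp: ready_def)
  have "0 < length x" "x ! 0 = N" by (simp_all add: x length_enc_sat3 enc_sat3_0)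
  then have inp: "ev x B \<mu> \<rho> (Inp (Num 0)) = N" by simp
  have 1: "ev x B \<mu> \<rho> (fMul 31 (Var vK) (Var vS)) = \<rho> vK * \<rho> vS" by (rule ev_fMul) (use True in auto)
  have 2: "ev x B \<mu> \<rho> (fMul 31 (Var vK) ePow) = \<rho> vK * 2 ^ \<rho> vS" by (rule ev_fMul) (use True r in \<open>auto simp: ePow_def\<close>)
  have 3: "ev x B \<mu> \<rho>' (fMul 37 (Var vL) (Var vL)) = 2 * N * (2 * N)" if "\<rho>' 10 = 2 * N" for \<rho>'
    by (rule ev_fMul) (use True that in auto)
  have 4: "ev x B \<mu> \<rho> (fMul 31 (Var vL) (fMul 37 (Var vL) (Var vL))) = 2 * N * (2 * N * (2 * N))"
    by (rule ev_fMul) (use True r 3 in auto)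
  have 5: "ev x B \<mu> \<rho>' (fMul 31 (Num 2) (Var vT1)) = 2 * \<rho>' vT1" "ev x B \<mu> \<rho>' (fMul 31 (Num 3) (Var vT3)) = 3 * \<rho>' vT3" for \<rho>'
    by (rule ev_fMul; use True in auto)+
  have 6: "ev x B \<mu> \<rho>' eDeg = \<rho>' vS * (1 + 2 * \<rho>' vT1 + 3 * \<rho>' vT3) + 2" if "\<rho>' vS < B" for \<rho>'
  proof -
    have "ev x B \<mu> \<rho>' (fMul 37 (Var vS) (Plus (Plus (Num 1) (fMul 31 (Num 2) (Var vT1))) (fMul 31 (Num 3) (Var vT3)))) =
        \<rho>' vS * (1 + 2 * \<rho>' vT1 + 3 * \<rho>' vT3)"
      by (rule ev_fMul) (use that 5 in auto)
    then show ?thesis by (simp add: eDeg_def)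
  qed
  have 7: "ev x B \<mu> \<rho> (fMul 38 (Num C) eDeg) = C * (\<rho> vS * ?\<Delta> + 2)"
    by (rule ev_fMul) (use True 6 in auto)
  show ?thesis
    using True r inp by (simp add: fGuard_def guard_def 1 2 4 7 not_less del: One_nat_def ev.simps(5) cong: conj_cong)
next
  case False
  then show ?thesis using assms by (auto simp: fGuard_def guard_def ready_def)
qed

lemma guard_round:
  assumes "guard B \<theta>1 \<theta>3 k s n"
  shows "solver_round N \<theta>1 \<theta>3 \<phi> B k s n C x c tm P"
proof -
  interpret sparsification "2 * N" \<theta>1 \<theta>2 \<theta>3 "clauses \<phi>" by (rule sparsification_clauses[OF inst])
  let ?d = "s * (1 + 2 * \<theta>1 + 3 * \<theta>3) + 2"
  have "2 ^ (C * ?d) \<le> n" "0 < n" using assms by (auto simp: guard_def)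
  then have "real (2 ^ (C * ?d)) \<le> real n" by (intro of_nat_mono)
  then have "2 ^ (C * ?d) \<le> real n" by simp
  then have "2 powr real (C * ?d) \<le> real n" by (simp add: powr_realpow del: of_nat_mult of_nat_add)
  then have "real (C * ?d) \<le> log 2 (real n)" using \<open>0 < n\<close> by (simp add: le_log_iff del: of_nat_mult of_nat_add)
  note log_n = this
  have g: "length x < B" "2 * N < B" "C + 3 < B" "k < B" "s < B" "n < B" "N \<le> k * s"
    "2 + k + k * 2 ^ s + 2 * N * (2 * N * (2 * N)) \<le> n"
    using assms unfolding guard_def by blast+
  \<comment> \<open>The factor 1 is replaced by \<open>c * C\<close>, whereupon \<open>C\<close>
    joins the degree bound to form a quantity that is at most log n.\<close>
  have "real ?d = 1 * real ?d" by (simp only: mult_1)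
  also have "\<dots> \<le> (c * real C) * real ?d" using c by (intro mult_right_mono) auto
  also have "\<dots> = c * real (C * ?d)" by (simp only: of_nat_mult mult.assoc)
  also have "\<dots> \<le> c * log 2 (real n)" using c log_n by (intro mult_left_mono) auto
  finally have d: "real ?d \<le> c * log 2 (real n)" .
  show ?thesis
    by unfold_locales (fact g | fact x | fact d | (rule correct, assumption))+
qed

abbreviation "cInner \<equiv> Cond (fAnd (fNot (Var vDone)) (fGuard C)) (cTry P) Skip"

definition good_cmd :: "nat \<Rightarrow> cmd \<Rightarrow> bool" where
  "good_cmd B cm \<longleftrightarrow> (\<forall>s. ready B s \<longrightarrow> ready B (sem x B cm s) \<and> (fst s vDone \<noteq> 0 \<longrightarrow> fst (sem x B cm s) vDone \<noteq> 0))"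

lemma cInner_step:
  assumes r: "ready B (\<rho>, \<mu>)" and t: "tr x B \<mu> \<rho> (fAnd (fNot (Var vDone)) (fGuard C))"
  shows "ready B (sem x B (cTry P) (\<rho>, \<mu>))"
    and "tm (\<rho> vN) (\<rho> vK + 1) \<le> real B \<Longrightarrow> contracting (\<rho> vT1) (\<rho> vT2) (\<rho> vT3) X \<Longrightarrow>
      2 * X powr (3 * real (\<rho> vT1 + \<rho> vT2) * real (2 * N)) - 1 \<le> real B \<Longrightarrow> fst (sem x B (cTry P) (\<rho>, \<mu>)) vDone \<noteq> 0"
proof -
  let ?s = "sem x B (cTry P) (\<rho>, \<mu>)"
  have g: "guard B (\<rho> vT1) (\<rho> vT3) (\<rho> vK) (\<rho> vS) (\<rho> vN)" and d: "\<rho> vDone = 0"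
    using t tr_fGuard[OF r] by (auto simp: tr_Var)
  interpret R: solver_round N "\<rho> vT1" "\<rho> vT2" "\<rho> vT3" \<phi> B "\<rho> vK" "\<rho> vS" "\<rho> vN" C x c tm P by (rule guard_round[OF g])
  have e: "R.env \<rho> \<mu>" using r by (simp add: R.env_def ready_def)
  have "0 \<notin> mv (cTry P)" "10 \<notin> mv (cTry P)" using R.mv_cTry by auto
  then have "fst ?s 0 = \<rho> 0" "fst ?s 10 = \<rho> 10" using sem_frame_var[of _ "cTry P" x B "(\<rho>, \<mu>)"] by auto
  moreover have "snd ?s Powers = \<mu> Powers" using sem_frame_arr[OF R.ma_cTry, of x B "(\<rho>, \<mu>)"] by simp
  moreover have "R.sat {} {} \<longleftrightarrow> satisfiable3 \<phi>" unfolding R.sat_def satisfiable3_models ..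
  ultimately show "ready B ?s" using R.sem_cTry(1)[OF e d] r unfolding ready_def by auto
  show "fst ?s vDone \<noteq> 0" if "tm (\<rho> vN) (\<rho> vK + 1) \<le> real B" "contracting (\<rho> vT1) (\<rho> vT2) (\<rho> vT3) X"
     "2 * X powr (3 * real (\<rho> vT1 + \<rho> vT2) * real (2 * N)) - 1 \<le> real B"
    using R.sem_cTry(2)[OF e d, of X] that unfolding R.fast_def R.root_weight by simp
qed

lemma good_cInner: "good_cmd B cInner"
  unfolding good_cmd_def
proof (intro allI impI)
  fix s assume r: "ready B s"
  obtain \<rho> \<mu> where s: "s = (\<rho>, \<mu>)" by fastforce
  show "ready B (sem x B cInner s) \<and> (fst s vDone \<noteq> 0 \<longrightarrow> fst (sem x B cInner s) vDone \<noteq> 0)"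
    using cInner_step(1)[of B \<rho> \<mu>] r unfolding s sem_Cond_tr by (auto simp: tr_Var)
qed

lemma good_For:
  assumes "good_cmd B cm" "v \<notin> {vIn, vDone, vAns, vL}"
  shows "good_cmd B (For v cm)"
  unfolding good_cmd_def
proof (intro allI impI)
  fix s assume r: "ready B s"
  show "ready B (sem x B (For v cm) s) \<and> (fst s vDone \<noteq> 0 \<longrightarrow> fst (sem x B (For v cm) s) vDone \<noteq> 0)"
  proof (rule sem_For_inv[where I = "\<lambda>_ s'. ready B s' \<and> (fst s vDone \<noteq> 0 \<longrightarrow> fst s' vDone \<noteq> 0)"])
    fix i s' assume "ready B s' \<and> (fst s vDone \<noteq> 0 \<longrightarrow> fst s' vDone \<noteq> 0)"
    moreover have "ready B ((fst s')(v := i), snd s') \<longleftrightarrow> ready B s'" using assms(2) by (auto simp: ready_def)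
    ultimately show "ready B (sem x B cm ((fst s')(v := i), snd s')) \<and>
        (fst s vDone \<noteq> 0 \<longrightarrow> fst (sem x B cm ((fst s')(v := i), snd s')) vDone \<noteq> 0)"
      using assms unfolding good_cmd_def by (auto dest!: spec[of _ "((fst s')(v := i), snd s')"])
  qed (use r in simp)
qed

definition hits :: "nat \<Rightarrow> (nat \<Rightarrow> nat) \<Rightarrow> nat set \<Rightarrow> cmd \<Rightarrow> bool" where
  "hits B val vs cm \<longleftrightarrow> (\<forall>s. ready B s \<longrightarrow> (\<forall>v\<in>vs. fst s v = val v) \<longrightarrow> fst (sem x B cm s) vDone \<noteq> 0)"

text \<open>The set \<open>vs\<close> contains the parameters already fixed by outer loops, so that
  the six loops can be peeled off one by one. The iteration with the right value leaves
  \<open>vDone\<close> set, and \<open>good_cmd\<close> preserves it through the later ones.\<close>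

lemma hits_For:
  assumes g: "good_cmd B cm" and h: "hits B val (insert v vs) cm" and v: "v \<notin> {vIn, vDone, vAns, vL}" "v \<notin> vs"
    and lt: "val v < B" and fr: "vs \<inter> mv cm = {}"
  shows "hits B val vs (For v cm)"
  unfolding hits_def
proof (intro allI impI)
  fix s assume r: "ready B s" and a: "\<forall>u\<in>vs. fst s u = val u"
  let ?I = "\<lambda>i s'. ready B s' \<and> (\<forall>u\<in>vs. fst s' u = val u) \<and> (val v < i \<longrightarrow> fst s' vDone \<noteq> 0)"
  have "?I B (sem x B (For v cm) s)"
  proof (rule sem_For_inv[where I = ?I])
    fix i s' assume i: "i < B" and I: "?I i s'"
    let ?s = "((fst s')(v := i), snd s')"
    have r': "ready B ?s" using I v by (auto simp: ready_def)
    have "\<forall>u\<in>vs. fst (sem x B cm ?s) u = val u"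
      using sem_frame_var[of _ cm x B ?s] I v(2) fr by fastforce
    moreover have "fst (sem x B cm ?s) vDone \<noteq> 0" if "val v < Suc i"
    proof (cases "val v = i")
      case True
      then show ?thesis using h r' I v(2) unfolding hits_def by (auto dest!: spec[of _ ?s])
    next
      case False
      then have "fst ?s vDone \<noteq> 0" using I that v(1) by auto
      then show ?thesis using g r' unfolding good_cmd_def by blast
    qed
    ultimately show "?I (Suc i) (sem x B cm ?s)" using g r' unfolding good_cmd_def by blast
  qed (use r a in simp)
  then show "fst (sem x B (For v cm) s) vDone \<noteq> 0" using lt by blast
qed

abbreviation "cInit \<equiv> Write Powers (Num 0) (Num 1) ;;
     For vA (Write Powers (Plus (Var vA) (Num 1)) (Plus (Cell Powers (Var vA)) (Cell Powers (Var vA)))) ;;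
     Assign vL (Plus (Inp (Num 0)) (Inp (Num 0))) ;; Assign vDone (Num 0)"

abbreviation "cLoops \<equiv> For vT1 (For vT2 (For vT3 (For vK (For vS (For vN cInner)))))"

lemma cMain_split: "sem x B (cMain C P) s = sem x B cLoops (sem x B cInit s)"
  by (simp only: cMain_def sem.simps(4))

lemma ready_cInit:
  assumes "\<rho> vIn = length x"
  shows "ready B (sem x B cInit (\<rho>, \<mu>))"
proof -
  let ?c = "For vA (Write Powers (Plus (Var vA) (Num 1)) (Plus (Cell Powers (Var vA)) (Cell Powers (Var vA))))"
  define s1 where "s1 = sem x B ?c (\<rho>, \<mu>(Powers := (\<mu> Powers)(0 := 1)))"
  obtain \<rho>1 \<mu>1 where s1p: "s1 = (\<rho>1, \<mu>1)" by fastforce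
  have "\<forall>j\<le>B. snd s1 Powers j = 2 ^ j"
    unfolding s1_def
    by (rule sem_For_inv[where I = "\<lambda>i s. \<forall>j\<le>i. snd s Powers j = 2 ^ j"]) (auto simp: le_Suc_eq)
  moreover have "\<rho>1 0 = length x"
    using sem_frame_var[of 0 ?c x B "(\<rho>, \<mu>(Powers := (\<mu> Powers)(0 := 1)))"] assms s1p unfolding s1_def by simp
  moreover have "0 < length x" "x ! 0 = N" by (simp_all add: x length_enc_sat3 enc_sat3_0)
  moreover have "sem x B cInit (\<rho>, \<mu>) = sem x B (Assign vL (Plus (Inp (Num 0)) (Inp (Num 0))) ;; Assign vDone (Num 0)) s1"
    unfolding s1_def by (simp only: sem.simps ev.simps)
  ultimately show ?thesis by (simp add: s1p ready_def)
qed

lemma good_cLoops: "good_cmd B cLoops"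
  by (intro good_For good_cInner) auto

lemma cMain_sound:
  assumes "\<rho> vIn = length x"
  shows "fst (sem x B (cMain C P) (\<rho>, \<mu>)) vIn = length x"
    and "fst (sem x B (cMain C P) (\<rho>, \<mu>)) vDone \<noteq> 0 \<Longrightarrow>
      fst (sem x B (cMain C P) (\<rho>, \<mu>)) vAns = (if satisfiable3 \<phi> then 1 else 0)"
proof -
  have "ready B (sem x B (cMain C P) (\<rho>, \<mu>))"
    using good_cLoops ready_cInit[where \<rho> = \<rho>, OF assms] unfolding cMain_split good_cmd_def by blast
  then show "fst (sem x B (cMain C P) (\<rho>, \<mu>)) vIn = length x"
    "fst (sem x B (cMain C P) (\<rho>, \<mu>)) vDone \<noteq> 0 \<Longrightarrow>
      fst (sem x B (cMain C P) (\<rho>, \<mu>)) vAns = (if satisfiable3 \<phi> then 1 else 0)"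
    by (simp_all add: ready_def)
qed

lemma cMain_complete:
  assumes "\<rho> vIn = length x" and g: "guard B \<theta>1 \<theta>3 k s n"
    and lt: "\<theta>1 < B" "\<theta>2 < B" "\<theta>3 < B"
    and f: "tm n (k + 1) \<le> real B" "contracting \<theta>1 \<theta>2 \<theta>3 X"
    and w: "2 * X powr (3 * real (\<theta>1 + \<theta>2) * real (2 * N)) - 1 \<le> real B"
  shows "fst (sem x B (cMain C P) (\<rho>, \<mu>)) vDone \<noteq> 0"
proof -
  interpret R: solver_round N \<theta>1 \<theta>2 \<theta>3 \<phi> B k s n C x c tm P by (rule guard_round[OF g])
  define val :: "nat \<Rightarrow> nat" where "val = (\<lambda>_. 0)(vT1 := \<theta>1, vT2 := \<theta>2, vT3 := \<theta>3, vK := k, vS := s, vN := n)"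
  have fr: "vs \<inter> mv (cTry P) = {}" if "vs \<subseteq> {3..8}" for vs using that R.mv_cTry by fastforce
  have inner: "hits B val {vN, vS, vK, vT3, vT2, vT1} cInner"
    unfolding hits_def
  proof (intro allI impI)
    fix s' assume r: "ready B s'" and a: "\<forall>v\<in>{vN, vS, vK, vT3, vT2, vT1}. fst s' v = val v"
    obtain \<rho>' \<mu>' where s': "s' = (\<rho>', \<mu>')" by fastforce
    have v: "\<rho>' vT1 = \<theta>1" "\<rho>' vT2 = \<theta>2" "\<rho>' vT3 = \<theta>3" "\<rho>' vK = k" "\<rho>' vS = s" "\<rho>' vN = n"
      using a by (simp_all add: s' val_def)
    show "fst (sem x B cInner s') vDone \<noteq> 0"
    proof (cases "\<rho>' vDone = 0")
      case True
      have t: "tr x B \<mu>' \<rho>' (fAnd (fNot (Var vDone)) (fGuard C))"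
        using True g tr_fGuard[of B \<rho>' \<mu>'] r by (simp add: s' v tr_Var)
      then show ?thesis
        unfolding s' sem_Cond_tr using cInner_step(2)[of B \<rho>' \<mu>' X] r f w by (simp add: s' v)
    next
      case False
      then show ?thesis using good_cInner[of B] r unfolding good_cmd_def s' by (metis fst_conv)
    qed
  qed
  have lt': "k < B" "s < B" "n < B" using g by (auto simp: guard_def)
  have "hits B val {} cLoops"
    by (intro hits_For good_For good_cInner)
      (use inner lt lt' fr in \<open>auto simp: val_def\<close>)
  then show ?thesis using ready_cInit[where \<rho> = \<rho>, OF assms(1)] unfolding cMain_split hits_def by blast
qed

end

section \<open>Running time\<close>

text \<open>There are 2 N literals, hence at most 8 N^3 distinct clauses, each of which takes three
  entries.\<close>

lemma length_sat3_le:
  assumes "(N, \<phi>) \<in> sat3_instances"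
  shows "length (enc_sat3 (N, \<phi>)) \<le> 1 + 24 * N ^ 3"
proof -
  define A where "A = {..<N} \<times> (UNIV :: bool set)"
  have "set \<phi> \<subseteq> A \<times> A \<times> A" using assms by (fastforce simp: sat3_instances_def A_def)
  then have "card (set \<phi>) \<le> card (A \<times> A \<times> A)" by (rule card_mono[rotated]) (simp add: A_def)
  also have "\<dots> = 8 * N ^ 3" by (simp add: A_def card_cartesian_product power3_eq_cube)
  finally have "length \<phi> \<le> 8 * N ^ 3" using assms distinct_card[of \<phi>] by (simp add: sat3_instances_def)
  then show ?thesis by (simp add: length_enc_sat3)
qed

lemma contracting_params:
  assumes "5 \<le> q"
  shows "contracting (q ^ 2) (q ^ 3) (q ^ 2 * (q ^ 2 + q ^ 3)) (1 + 1 / real (q * (q ^ 2 + q ^ 3)))"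
  using thresholds[OF assms refl refl] assms unfolding contracting_def by (simp add: Suc_le_eq)

text \<open>Both requirements on \<open>n\<close> in \<open>guard\<close>, added up, for the block
  length \<open>N div k + 1\<close>.\<close>

definition graph_size :: "nat \<Rightarrow> nat \<Rightarrow> nat \<Rightarrow> nat \<Rightarrow> nat" where
  "graph_size C \<Delta> k N = 2 ^ (C * ((N div k + 1) * \<Delta> + 2)) +
     (2 + k + k * 2 ^ (N div k + 1) + 2 * N * (2 * N * (2 * N)))"

text \<open>A sum over everything that has to fit below \<open>B\<close>: the input, the graph, the
  thresholds, the simulated time and the number of nodes of the branching tree. A sum is easier to
  estimate than a maximum.\<close>

definition params_bound :: "nat \<Rightarrow> (nat \<Rightarrow> nat \<Rightarrow> real) \<Rightarrow> nat \<Rightarrow> nat \<Rightarrow> nat \<Rightarrow> nat" where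
  "params_bound C tm q k N = (let \<beta> = q ^ 2 + q ^ 3; n = graph_size C (1 + 2 * q ^ 2 + 3 * (q ^ 2 * \<beta>)) k N in
     24 * N ^ 3 + n + (C + q ^ 2 + q ^ 3 + q ^ 2 * \<beta> + 10) + nat \<lceil>tm n (k + 1)\<rceil> +
     nat \<lceil>2 * (1 + 1 / real (q * \<beta>)) powr (6 * real \<beta> * real N)\<rceil>)"

lemma (in main_program) cMain_params_bound:
  assumes q: "5 \<le> q" and k: "1 \<le> k" and \<rho>: "\<rho> vIn = length x"
  shows "fst (sem x (params_bound C tm q k N) (cMain C P) (\<rho>, \<mu>)) vDone \<noteq> 0"
proof -
  define \<beta> where "\<beta> = q ^ 2 + q ^ 3"
  define \<theta>3 where "\<theta>3 = q ^ 2 * \<beta>"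
  define \<Delta> where "\<Delta> = 1 + 2 * q ^ 2 + 3 * \<theta>3"
  define s where "s = N div k + 1"
  define n where "n = graph_size C \<Delta> k N"
  define X where "X = 1 + 1 / real (q * \<beta>)"
  define M where "M = params_bound C tm q k N"
  have M: "M = 24 * N ^ 3 + n + (C + q ^ 2 + q ^ 3 + \<theta>3 + 10) + nat \<lceil>tm n (k + 1)\<rceil> +
     nat \<lceil>2 * X powr (6 * real \<beta> * real N)\<rceil>"
    by (simp add: M_def params_bound_def Let_def n_def \<Delta>_def \<theta>3_def \<beta>_def X_def)
  have n: "n = 2 ^ (C * (s * \<Delta> + 2)) + (2 + k + k * 2 ^ s + 2 * N * (2 * N * (2 * N)))"
    by (simp add: n_def graph_size_def s_def)
  have "N = k * (N div k) + N mod k" by simp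
  moreover have "N mod k < k" using k by simp
  ultimately have Nks: "N \<le> k * s" unfolding s_def distrib_left by linarith
  have len: "length x \<le> 1 + 24 * N ^ 3" using length_sat3_le[OF inst] x by simp
  have "s < 2 ^ s" by (rule less_exp)
  also have "\<dots> \<le> k * 2 ^ s" using k by simp
  finally have sn: "s < n" unfolding n by linarith
  have Nn: "2 * N \<le> n"
  proof (cases N)
    case (Suc m)
    then have "1 * 1 \<le> (2 * N) * (2 * N)" by (intro mult_le_mono) auto
    then have "2 * N * 1 \<le> 2 * N * (2 * N * (2 * N))" by (intro mult_le_mono2) simp
    then show ?thesis unfolding n by linarith
  qed simp
  have Cn: "C * (s * \<Delta> + 2) < n"
    using less_exp[of "C * (s * \<Delta> + 2)"] unfolding n by linarith
  have kn: "k \<le> n" unfolding n by linarith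
  have g: "guard M (q ^ 2) \<theta>3 k s n"
    unfolding guard_def \<Delta>_def[symmetric]
  proof (intro conjI)
    show "2 + k + k * 2 ^ s + 2 * N * (2 * N * (2 * N)) \<le> n" "2 ^ (C * (s * \<Delta> + 2)) \<le> n" unfolding n by simp_all
  qed (use len sn Nn Cn kn Nks in \<open>simp_all add: M\<close>)
  have "tm n (k + 1) \<le> real M"
  proof -
    have "tm n (k + 1) \<le> real (nat \<lceil>tm n (k + 1)\<rceil>)" by (rule real_nat_ceiling_ge)
    also have "\<dots> \<le> real M" by (rule of_nat_mono) (unfold M, linarith)
    finally show ?thesis .
  qed
  moreover have "contracting (q ^ 2) (q ^ 3) \<theta>3 X"
    unfolding \<theta>3_def X_def \<beta>_def by (rule contracting_params[OF q])
  moreover have "2 * X powr (3 * real (q ^ 2 + q ^ 3) * real (2 * N)) - 1 \<le> real M"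
  proof -
    have "2 * X powr (3 * real (q ^ 2 + q ^ 3) * real (2 * N)) - 1 \<le> 2 * X powr (6 * real \<beta> * real N)"
      by (simp add: \<beta>_def algebra_simps)
    also have "\<dots> \<le> real (nat \<lceil>2 * X powr (6 * real \<beta> * real N)\<rceil>)" by (rule real_nat_ceiling_ge)
    also have "\<dots> \<le> real M" by (rule of_nat_mono) (unfold M, linarith)
    finally show ?thesis .
  qed
  moreover have "q ^ 2 < M" "q ^ 3 < M" "\<theta>3 < M" by (simp_all add: M)
  ultimately show ?thesis unfolding M_def[symmetric]
    using cMain_complete[where \<rho> = \<rho>, OF \<rho> g, of "q ^ 3" X \<mu>] by blast
qed

lemma cubic_le_exp:
  fixes A \<epsilon> :: real
  assumes "0 < \<epsilon>"
  shows "\<forall>\<^sub>F N in sequentially. A * (real N + 1) ^ 3 \<le> 2 powr (\<epsilon> * real N)"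
proof -
  have "(\<lambda>N::nat. A * (real N + 1) ^ 3 / 2 powr (\<epsilon> * real N)) \<longlonglongrightarrow> 0"
    using assms by real_asymp
  then have "\<forall>\<^sub>F N in sequentially. A * (real N + 1) ^ 3 / 2 powr (\<epsilon> * real N) < 1"
    by (rule order_tendstoD) simp
  then show ?thesis by eventually_elim (simp add: divide_less_eq)
qed

text \<open>The exponent is really \<open>C * \<Delta> * N / k\<close> up to a constant; doubling it
  absorbs this constant and the cubic factor in \<open>N\<close>.\<close>

lemma graph_size_le:
  assumes k: "1 \<le> k" and C: "1 \<le> C" and \<Delta>: "1 \<le> \<Delta>"
  shows "\<forall>\<^sub>F N in sequentially. real (graph_size C \<Delta> k N) \<le> 2 powr (2 * (real C * real \<Delta> / real k) * real N)"
proof -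
  define \<eta> where "\<eta> = real C * real \<Delta> / real k"
  have \<eta>: "0 < \<eta>" using assms by (simp add: \<eta>_def)
  define A where "A = (11 + 2 * real k) * 2 powr real (C * (\<Delta> + 2))"
  have le: "real (graph_size C \<Delta> k N) \<le> (A * (real N + 1) ^ 3) * 2 powr (\<eta> * real N)" for N
  proof -
    define s where "s = N div k + 1"
    define e where "e = C * (s * \<Delta> + 2)"
    have se: "s \<le> e"
    proof -
      have "s * 1 \<le> s * \<Delta>" using \<Delta> by (intro mult_le_mono2)
      then have "s \<le> s * \<Delta> + 2" by linarith
      then have "1 * s \<le> C * (s * \<Delta> + 2)" using C by (intro mult_le_mono)
      then show ?thesis by (simp add: e_def)
    qed
    have e_le: "2 ^ e \<le> 2 powr real (C * (\<Delta> + 2)) * 2 powr (\<eta> * real N)"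
    proof -
      have "real e = real (C * (\<Delta> + 2)) + real C * real \<Delta> * real (N div k)"
        by (simp add: e_def s_def algebra_simps)
      also have "real C * real \<Delta> * real (N div k) \<le> real C * real \<Delta> * (real N / real k)"
        by (intro mult_left_mono) (auto simp: of_nat_div_le_of_nat)
      also have "\<dots> = \<eta> * real N" by (simp add: \<eta>_def)
      finally have "2 powr real e \<le> 2 powr (real (C * (\<Delta> + 2)) + \<eta> * real N)" by (intro powr_mono) auto
      then show ?thesis by (simp add: powr_realpow powr_add)
    qed
    have two: "1 \<le> (2::real) ^ e" by simp
    have s2: "(2::real) ^ s \<le> 2 ^ e" using se by (intro power_increasing) auto
    have cube: "1 \<le> (real N + 1) ^ 3" "real N ^ 3 \<le> (real N + 1) ^ 3" by (auto intro: power_mono one_le_power)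
    have "real (graph_size C \<Delta> k N) = 2 ^ e + 2 + real k + real k * 2 ^ s + 8 * real N ^ 3"
      by (simp add: graph_size_def e_def s_def power3_eq_cube)
    also have "\<dots> \<le> 2 ^ e * (3 + 2 * real k + 8 * real N ^ 3)"
    proof -
      have "real k * 2 ^ s \<le> real k * 2 ^ e" using s2 by (intro mult_left_mono) auto
      moreover have "(2 + real k + 8 * real N ^ 3) * 1 \<le> (2 + real k + 8 * real N ^ 3) * 2 ^ e"
        using two by (intro mult_left_mono) auto
      ultimately show ?thesis by (simp add: algebra_simps)
    qed
    also have "\<dots> \<le> 2 ^ e * ((11 + 2 * real k) * (real N + 1) ^ 3)"
    proof (rule mult_left_mono)
      have gen: "3 + 2 * \<kappa> + 8 * z \<le> (11 + 2 * \<kappa>) * Q" if "1 \<le> Q" "z \<le> Q" "0 \<le> \<kappa>" for \<kappa> z Q :: real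
      proof -
        have "(3 + 2 * \<kappa>) * 1 \<le> (3 + 2 * \<kappa>) * Q" using that by (intro mult_left_mono) auto
        then show ?thesis using that(2) by (simp add: algebra_simps)
      qed
      show "3 + 2 * real k + 8 * real N ^ 3 \<le> (11 + 2 * real k) * (real N + 1) ^ 3"
        by (rule gen[OF cube]) simp
    qed simp
    also have "\<dots> \<le> (2 powr real (C * (\<Delta> + 2)) * 2 powr (\<eta> * real N)) * ((11 + 2 * real k) * (real N + 1) ^ 3)"
      by (rule mult_right_mono[OF e_le]) simp
    finally show ?thesis unfolding A_def by (simp only: mult_ac)
  qed
  have "\<forall>\<^sub>F N in sequentially. A * (real N + 1) ^ 3 \<le> 2 powr (\<eta> * real N)" by (rule cubic_le_exp[OF \<eta>])
  then show ?thesis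
  proof eventually_elim
    case (elim N)
    have "real (graph_size C \<Delta> k N) \<le> 2 powr (\<eta> * real N) * 2 powr (\<eta> * real N)"
      by (rule order_trans[OF le]) (use elim in \<open>auto intro: mult_right_mono\<close>)
    moreover have "2 powr (\<eta> * real N) * 2 powr (\<eta> * real N) = 2 powr (2 * \<eta> * real N)"
      by (simp add: powr_add[symmetric] mult.assoc)
    ultimately show ?case by (simp only: \<eta>_def[symmetric])
  qed
qed

text \<open>Half of \<epsilon> is reserved for the polynomial factor in \<open>N\<close>, the other
  half for each of the graph, the simulated time and the branching tree. Since \<open>k\<close> is
  fixed before \<open>N\<close> grows, the value of \<open>f\<close> at \<open>k + 1\<close> is just
  another constant factor.\<close>

lemma params_bound_subexponential:
  fixes f g :: "nat \<Rightarrow> real"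
  assumes C: "1 \<le> C" and g: "g \<in> o(\<lambda>k. real k / log 2 (real k))" and \<epsilon>: "0 < \<epsilon>"
  shows "\<exists>q\<ge>5. \<exists>k\<ge>1. \<forall>\<^sub>F N in sequentially.
    real (params_bound C (\<lambda>n k. f k * real n powr g k) q k N) \<le> 2 powr (\<epsilon> * real N)"
proof -
  \<comment> \<open>Chosen such that exp (6 N / q), the bound for the branching tree, is at most 2
    to the power \<epsilon> N / 2.\<close>
  define q where "q = nat \<lceil>12 / (\<epsilon> * ln 2)\<rceil> + 5"
  have q: "5 \<le> q" "12 / (\<epsilon> * ln 2) \<le> real q"
    using real_nat_ceiling_ge[of "12 / (\<epsilon> * ln 2)"] by (simp_all add: q_def)
  define \<beta> where "\<beta> = q ^ 2 + q ^ 3"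
  define \<Delta> where "\<Delta> = 1 + 2 * q ^ 2 + 3 * (q ^ 2 * \<beta>)"
  have \<Delta>: "1 \<le> \<Delta>" by (simp add: \<Delta>_def)
  have C\<Delta>: "0 < real C * real \<Delta>" using C \<Delta> by simp
  \<comment> \<open>Fixed before \<open>k\<close>, since \<Delta> depends on \<open>q\<close> only.
    The product of the graph exponent 2 C \<Delta> / k with the bound 2 \<gamma> k on
    \<open>g\<close> is then exactly \<epsilon> / 2, whatever \<open>k\<close> is.\<close>
  define \<gamma> where "\<gamma> = \<epsilon> / (8 * (real C * real \<Delta>))"
  have \<gamma>: "0 < \<gamma>" using \<epsilon> C\<Delta> by (simp add: \<gamma>_def)
  obtain k0 where k0: "\<And>k. k0 \<le> k \<Longrightarrow> norm (g k) \<le> \<gamma> * norm (real k / log 2 (real k))"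
    using landau_o.smallD[OF g \<gamma>] unfolding eventually_sequentially by blast
  \<comment> \<open>Large enough for the asymptotic bound on \<open>g\<close> at
    \<open>k + 1\<close> and for 2 C \<Delta> / k to be at most \<epsilon> / 2; the summand 1 keeps
    the logarithm of \<open>k + 1\<close> at least 1.\<close>
  define k where "k = k0 + 1 + nat \<lceil>4 * (real C * real \<Delta>) / \<epsilon>\<rceil>"
  have k: "1 \<le> k" "k0 \<le> k + 1" "4 * (real C * real \<Delta>) / \<epsilon> \<le> real k"
    using real_nat_ceiling_ge[of "4 * (real C * real \<Delta>) / \<epsilon>"] by (simp_all add: k_def)
  define \<eta> where "\<eta> = real C * real \<Delta> / real k"
  have \<eta>: "0 \<le> \<eta>" "2 * \<eta> \<le> \<epsilon> / 2" using k \<epsilon> C\<Delta> by (auto simp: \<eta>_def field_simps)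
  have gk: "\<bar>g (k + 1)\<bar> \<le> 2 * \<gamma> * real k"
  proof -
    have "\<bar>g (k + 1)\<bar> \<le> \<gamma> * \<bar>real (k + 1) / log 2 (real (k + 1))\<bar>" using k0[OF k(2)] by simp
    also have "\<bar>real (k + 1) / log 2 (real (k + 1))\<bar> \<le> 2 * real k"
    proof -
      have "1 \<le> log 2 (real (k + 1))" using k(1) by (simp add: le_log_iff)
      then have "real (k + 1) / log 2 (real (k + 1)) \<le> real (k + 1) / 1" "0 \<le> real (k + 1) / log 2 (real (k + 1))"
        by (intro divide_left_mono divide_nonneg_nonneg; simp)+
      then show ?thesis using k(1) by simp
    qed
    finally show ?thesis using \<gamma> by (simp add: mult.assoc)
  qed
  have \<eta>g: "2 * \<eta> * \<bar>g (k + 1)\<bar> \<le> \<epsilon> / 2"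
  proof -
    have "2 * \<eta> * \<bar>g (k + 1)\<bar> \<le> 2 * \<eta> * (2 * \<gamma> * real k)" using gk \<eta> by (intro mult_left_mono) auto
    also have "\<dots> = \<epsilon> / 2"
    proof -
      have "C \<noteq> 0" "\<Delta> \<noteq> 0" "k \<noteq> 0" using C \<Delta> k(1) by auto
      then show ?thesis by (simp add: \<eta>_def \<gamma>_def field_simps)
    qed
    finally show ?thesis .
  qed
  define B0 where "B0 = real (C + q ^ 2 + q ^ 3 + q ^ 2 * \<beta> + 10)"
  define A where "A = 24 + 1 + B0 + (\<bar>f (k + 1)\<bar> + 1) + 3"
  have bnd: "real (params_bound C (\<lambda>n k. f k * real n powr g k) q k N) \<le> A * (real N + 1) ^ 3 * 2 powr (\<epsilon> / 2 * real N)"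
    if n_le: "real (graph_size C \<Delta> k N) \<le> 2 powr (2 * \<eta> * real N)" for N
  proof -
    define n where "n = graph_size C \<Delta> k N"
    define E where "E = 2 powr (\<epsilon> / 2 * real N)"
    define Q where "Q = (real N + 1) ^ 3"
    have E: "1 \<le> E" using \<epsilon> by (simp add: E_def ge_one_powr_ge_zero)
    have Q: "1 \<le> Q" "real N ^ 3 \<le> Q" by (auto simp: Q_def intro: power_mono one_le_power)
    have QE: "1 \<le> Q * E" "Q \<le> Q * E" "E \<le> Q * E" using Q E mult_mono[of 1 Q 1 E] by (auto intro: mult_mono[of Q Q 1 E, simplified])
    have n1: "1 \<le> n" by (simp add: n_def graph_size_def)
    have nE: "real n \<le> E"
    proof -
      have "2 powr (2 * \<eta> * real N) \<le> E" unfolding E_def using \<eta> by (intro powr_mono mult_right_mono) auto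
      then show ?thesis using n_le by (simp add: n_def)
    qed
    have tm: "f (k + 1) * real n powr g (k + 1) \<le> \<bar>f (k + 1)\<bar> * E"
    proof -
      have "f (k + 1) * real n powr g (k + 1) \<le> \<bar>f (k + 1)\<bar> * real n powr g (k + 1)" by (intro mult_right_mono) auto
      also have "real n powr g (k + 1) \<le> real n powr \<bar>g (k + 1)\<bar>" using n1 by (intro powr_mono) auto
      also have "\<dots> \<le> (2 powr (2 * \<eta> * real N)) powr \<bar>g (k + 1)\<bar>" using n_le by (intro powr_mono2) (auto simp: n_def)
      also have "\<dots> = 2 powr (2 * \<eta> * \<bar>g (k + 1)\<bar> * real N)" by (simp add: powr_powr mult.assoc mult.commute mult.left_commute)
      also have "\<dots> \<le> E" unfolding E_def using \<eta>g by (intro powr_mono mult_right_mono) auto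
      finally show ?thesis by (simp add: mult_left_mono)
    qed
    \<comment> \<open>By 1 + y \<le> exp y the factor \<beta> in the exponent cancels against that
      in the base.\<close>
    have X: "2 * (1 + 1 / real (q * \<beta>)) powr (6 * real \<beta> * real N) \<le> 2 * E"
    proof -
      have \<beta>0: "0 < real \<beta>" "0 < real q" using q(1) by (simp_all add: \<beta>_def add_pos_pos)
      have "1 + 1 / real (q * \<beta>) \<le> exp (1 / real (q * \<beta>))" by (rule exp_ge_add_one_self)
      then have "(1 + 1 / real (q * \<beta>)) powr (6 * real \<beta> * real N) \<le> exp (1 / real (q * \<beta>)) powr (6 * real \<beta> * real N)"
        by (intro powr_mono2) (auto intro: add_nonneg_nonneg)
      also have "\<dots> = exp (6 / real q * real N)" using \<beta>0 by (simp add: powr_def field_simps)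
      also have "\<dots> \<le> exp (\<epsilon> / 2 * ln 2 * real N)"
      proof -
        have "0 < \<epsilon> * ln 2" using \<epsilon> by simp
        then have "12 \<le> real q * (\<epsilon> * ln 2)" using q(2) by (simp add: divide_le_eq)
        then have "6 / real q \<le> \<epsilon> / 2 * ln 2" using \<beta>0 by (simp add: field_simps)
        then have "6 / real q * real N \<le> \<epsilon> / 2 * ln 2 * real N" by (rule mult_right_mono) simp
        then show ?thesis by (simp only: exp_le_cancel_iff)
      qed
      also have "\<dots> = E" by (simp add: E_def powr_def mult.commute mult.left_commute)
      finally show ?thesis by simp
    qed
    have ceil: "real (nat \<lceil>y\<rceil>) \<le> b + 1" if "y \<le> b" "0 \<le> b" for y b :: real using that by linarith
    have "real (params_bound C (\<lambda>n k. f k * real n powr g k) q k N) =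
        24 * real N ^ 3 + real n + B0 + real (nat \<lceil>f (k + 1) * real n powr g (k + 1)\<rceil>) +
        real (nat \<lceil>2 * (1 + 1 / real (q * \<beta>)) powr (6 * real \<beta> * real N)\<rceil>)"
      by (simp add: params_bound_def Let_def n_def \<Delta>_def \<beta>_def B0_def)
    also have "\<dots> \<le> 24 * Q + E + B0 + (\<bar>f (k + 1)\<bar> * E + 1) + (2 * E + 1)"
    proof -
      have "real (nat \<lceil>f (k + 1) * real n powr g (k + 1)\<rceil>) \<le> \<bar>f (k + 1)\<bar> * E + 1"
        by (rule ceil[OF tm]) (use E in auto)
      moreover have "real (nat \<lceil>2 * (1 + 1 / real (q * \<beta>)) powr (6 * real \<beta> * real N)\<rceil>) \<le> 2 * E + 1"
        by (rule ceil[OF X]) (use E in auto)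
      ultimately show ?thesis using Q(2) nE by linarith
    qed
    also have "\<dots> \<le> A * (Q * E)"
    proof -
      have "B0 * 1 \<le> B0 * (Q * E)" using QE by (intro mult_left_mono) (auto simp: B0_def)
      moreover have "\<bar>f (k + 1)\<bar> * E \<le> \<bar>f (k + 1)\<bar> * (Q * E)" using QE by (intro mult_left_mono) auto
      ultimately show ?thesis using QE unfolding A_def by (simp add: distrib_right)
    qed
    finally show ?thesis by (simp add: Q_def E_def mult.assoc)
  qed
  have "\<forall>\<^sub>F N in sequentially. A * (real N + 1) ^ 3 \<le> 2 powr (\<epsilon> / 2 * real N)" using \<epsilon> by (intro cubic_le_exp) simp
  moreover have "\<forall>\<^sub>F N in sequentially. real (graph_size C \<Delta> k N) \<le> 2 powr (2 * \<eta> * real N)"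
    unfolding \<eta>_def by (rule graph_size_le[OF k(1) C \<Delta>])
  ultimately have "\<forall>\<^sub>F N in sequentially.
      real (params_bound C (\<lambda>n k. f k * real n powr g k) q k N) \<le> 2 powr (\<epsilon> * real N)"
  proof eventually_elim
    case (elim N)
    have "A * (real N + 1) ^ 3 * 2 powr (\<epsilon> / 2 * real N) \<le> 2 powr (\<epsilon> / 2 * real N) * 2 powr (\<epsilon> / 2 * real N)"
      using elim(1) by (intro mult_right_mono) auto
    also have "\<dots> = 2 powr (\<epsilon> * real N)" by (simp add: powr_add[symmetric])
    finally show ?case using bnd[OF elim(2)] by linarith
  qed
  then show ?thesis using q(1) k(1) by blast
qed

theorem theorem11:
  fixes c :: real
  assumes "c > 0"
    and ETH
  shows "\<not> (\<exists>f :: nat \<Rightarrow> real. \<exists>g :: nat \<Rightarrow> real.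
           g \<in> o(\<lambda>k. real k / log 2 (real k)) \<and>
           solvable_in_time (ds_instances c) enc_ds has_dominating_set
             (\<lambda>(n, E, k). f k * real n powr g k))"
proof
  assume "\<exists>f :: nat \<Rightarrow> real. \<exists>g :: nat \<Rightarrow> real. g \<in> o(\<lambda>k. real k / log 2 (real k)) \<and>
    solvable_in_time (ds_instances c) enc_ds has_dominating_set (\<lambda>(n, E, k). f k * real n powr g k)"
  then obtain f g :: "nat \<Rightarrow> real" and P where g: "g \<in> o(\<lambda>k. real k / log 2 (real k))"
    and P: "\<forall>i\<in>ds_instances c. answers_within P (enc_ds i) (has_dominating_set i) (case i of (n, E, k) \<Rightarrow> f k * real n powr g k)"
    unfolding solvable_in_time_def by blast
  define tm where "tm = (\<lambda>n k. f k * real n powr g k)"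
  define C where "C = nat \<lceil>1 / c\<rceil>"
  have "1 / c \<le> real C" unfolding C_def by (rule real_nat_ceiling_ge)
  then have cC: "1 \<le> c * real C" using assms(1) by (simp add: divide_le_eq mult.commute)
  then have C: "1 \<le> C" by (cases C) auto
  have main: "main_program N \<phi> c tm P C (enc_sat3 (N, \<phi>))" if "(N, \<phi>) \<in> sat3_instances" for N \<phi>
    by unfold_locales (use that assms(1) cC P in \<open>auto simp: tm_def\<close>)
  obtain K D where KD: "\<And>B. tc B (cMain C P) \<le> K * (B + 1) ^ D"
    using poly_bounded_tc[of "cMain C P"] unfolding poly_bounded_def by blast
  \<comment> \<open>Uniform in the formula and in the initial memory, so that the resulting time
    depends on \<open>N\<close> alone.\<close>
  define works where "works N M \<longleftrightarrow> 1 \<le> M \<and> (\<forall>\<phi> \<rho> \<mu>. (N, \<phi>) \<in> sat3_instances \<longrightarrow> \<rho> vIn = length (enc_sat3 (N, \<phi>)) \<longrightarrow>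
      fst (sem (enc_sat3 (N, \<phi>)) M (cMain C P) (\<rho>, \<mu>)) vDone \<noteq> 0)" for N M
  have works: "works N (params_bound C tm q k N)" if "5 \<le> q" "1 \<le> k" for N q k
  proof -
    have "1 \<le> params_bound C tm q k N" by (simp add: params_bound_def Let_def)
    then show ?thesis unfolding works_def using main_program.cMain_params_bound[OF main that] by blast
  qed
  \<comment> \<open>The least bound involves no particular \<open>q\<close> and \<open>k\<close>.
    Both may therefore be chosen later for each \<delta>, although the machine and the function
    \<open>h\<close> are already fixed.\<close>
  define M where "M N = (LEAST M. works N M)" for N
  have M: "works N (M N)" for N
    \<comment> \<open>The parameters 5 and 1 merely witness that some bound works.\<close>
    unfolding M_def by (rule LeastI[of "works N" "params_bound C tm 5 1 N"]) (rule works; simp)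
  define h where "h N = log 2 (real ((K + 4) * (M N + 1) ^ (D + 1)))" for N
  have time: "2 powr h N = real ((K + 4) * (M N + 1) ^ (D + 1))" for N
  proof -
    have "0 < (K + 4) * (M N + 1) ^ (D + 1)" by simp
    then show ?thesis unfolding h_def by (intro powr_log_cancel of_nat_0_less_iff[THEN iffD2]) simp_all
  qed
  have "answers_within (search_program (cMain C P) vDone vAns) (enc_sat3 (N, \<phi>)) (satisfiable3 \<phi>) (2 powr h N)"
    if i: "(N, \<phi>) \<in> sat3_instances" for N \<phi>
    unfolding time
  proof (rule search_program_answers[where M = "M N", OF _ _ _ KD])
    interpret main_program N \<phi> c tm P C "enc_sat3 (N, \<phi>)" by (rule main[OF i])
    fix B and \<rho> :: store and \<mu>
    assume \<rho>: "\<rho> 0 = length (enc_sat3 (N, \<phi>))"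
    show "fst (sem (enc_sat3 (N, \<phi>)) B (cMain C P) (\<rho>, \<mu>)) 0 = length (enc_sat3 (N, \<phi>))"
      by (rule cMain_sound(1)[where \<rho> = \<rho>, OF \<rho>])
    show "fst (sem (enc_sat3 (N, \<phi>)) B (cMain C P) (\<rho>, \<mu>)) vDone \<noteq> 0 \<Longrightarrow>
        fst (sem (enc_sat3 (N, \<phi>)) B (cMain C P) (\<rho>, \<mu>)) vAns = (if satisfiable3 \<phi> then 1 else 0)"
      by (rule cMain_sound(2)[where \<rho> = \<rho>, OF \<rho>])
  next
    fix \<rho> :: store and \<mu> assume "\<rho> 0 = length (enc_sat3 (N, \<phi>))"
    then show "fst (sem (enc_sat3 (N, \<phi>)) (M N) (cMain C P) (\<rho>, \<mu>)) vDone \<noteq> 0"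
      using M[of N] i unfolding works_def by blast
  next
    show "1 \<le> M N" using M[of N] unfolding works_def by blast
  qed
  then have "solvable_in_time sat3_instances enc_sat3 (\<lambda>(n, \<phi>). satisfiable3 \<phi>) (\<lambda>(n, \<phi>). 2 powr h n)"
    unfolding solvable_in_time_def by (intro exI[of _ "search_program (cMain C P) vDone vAns"]) auto
  moreover have "h \<in> o(\<lambda>n. real n)"
  proof (rule landau_o.smallI)
    fix \<delta> :: real assume \<delta>: "0 < \<delta>"
    \<comment> \<open>The polynomial overhead multiplies the exponent by \<open>D + 1\<close>; the
      other half of \<delta> absorbs the additive constant \<open>a\<close>.\<close>
    define \<epsilon> where "\<epsilon> = \<delta> / (2 * real (D + 1))"
    have \<epsilon>: "0 < \<epsilon>" using \<delta> by (simp add: \<epsilon>_def)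
    obtain q k where qk: "5 \<le> q" "1 \<le> k" and
      ev: "\<forall>\<^sub>F N in sequentially. real (params_bound C tm q k N) \<le> 2 powr (\<epsilon> * real N)"
      using params_bound_subexponential[OF C g \<epsilon>, of f] unfolding tm_def by blast
    define a where "a = log 2 (real (K + 4)) + real (D + 1)"
    have "\<forall>\<^sub>F N in sequentially. a \<le> \<delta> / 2 * real N" using \<delta> by real_asymp
    with ev show "\<forall>\<^sub>F N in sequentially. norm (h N) \<le> \<delta> * norm (real N)"
    proof eventually_elim
      case (elim N)
      have "M N \<le> params_bound C tm q k N" unfolding M_def by (rule Least_le[of "works N"]) (rule works[OF qk])
      then have "real (M N) \<le> 2 powr (\<epsilon> * real N)" using elim(1) by linarith
      moreover have "1 \<le> 2 powr (\<epsilon> * real N)" using \<epsilon> by (simp add: ge_one_powr_ge_zero)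
      ultimately have "real (M N + 1) \<le> 2 powr (1 + \<epsilon> * real N)" by (simp add: powr_add)
      then have lM: "log 2 (real (M N + 1)) \<le> 1 + \<epsilon> * real N" by (subst log_le_iff) auto
      have "h N = log 2 (real (K + 4)) + log 2 (real (M N + 1) ^ (D + 1))"
        unfolding h_def of_nat_mult of_nat_power by (subst log_mult) simp_all
      also have "log 2 (real (M N + 1) ^ (D + 1)) = real (D + 1) * log 2 (real (M N + 1))"
        by (rule log_nat_power) simp
      also have "log 2 (real (K + 4)) + real (D + 1) * log 2 (real (M N + 1)) \<le>
          log 2 (real (K + 4)) + real (D + 1) * (1 + \<epsilon> * real N)"
        using lM by (intro add_left_mono mult_left_mono) auto
      also have "\<dots> = a + \<delta> / 2 * real N" by (simp add: a_def \<epsilon>_def field_simps)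
      also have "\<dots> \<le> \<delta> * real N" using elim(2) by simp
      finally have "h N \<le> \<delta> * real N" .
      moreover have "0 \<le> h N"
      proof -
        have "1 \<le> (K + 4) * (M N + 1) ^ (D + 1)" by (simp add: Suc_le_eq)
        then have "1 \<le> real ((K + 4) * (M N + 1) ^ (D + 1))" by linarith
        then show ?thesis unfolding h_def
          by (intro zero_le_log_cancel_iff[THEN iffD2] order.strict_trans2[OF zero_less_one]) (assumption | simp)+
      qed
      ultimately show ?case by simp
    qed
  qed
  ultimately show False using assms(2) unfolding ETH_def by blast
qed

end
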